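(* Let $(M,\omega,\eta)$ be a compact connected cosymplectic manifold, and let $\mathcal S$ and $\mathcal T$ be two linear sections of the projection $\pi:\mathcal Z^1(M)\to H^1(M,\mathbb R)$. Then the two norms $\|\cdot\|_C^{\mathcal S}$ and $\|\cdot\|_C^{\mathcal T}$ on $\chi_{\eta,\omega}(M)$ are equivalent.
   Context: A cosymplectic manifold $(M,\omega,\eta)$ is a manifold with a closed $2$-form $\omega$ and a closed $1$-form $\eta$, nowhere zero, such that $\widetilde I_{\eta,\omega}:X\mapsto \imath_X\omega+\eta(X)\eta$ is a (pointwise) isomorphism from vector fields to $1$-forms. $\chi_{\eta,\omega}(M)$ is the space of cosymplectic vector fields: $\mathcal L_X\omega=0$, $\mathcal L_X\eta=0$; for such $X$ the function $\eta(X)$ is constant, and $\imath_X\omega$ and $\eta(X)\eta$ are closed. $\mathcal Z^1(M)$ is the space of closed $1$-forms and $\pi$ sends a closed form to its de Rham class. A linear section $\mathcal S:H^1(M,\mathbb R)\to\mathcal Z^1(M)$ (i.e. $\pi\circ\mathcal S=\mathrm{id}$) splits each closed $\alpha$ as $\alpha=\mathcal S(\pi(\alpha))+(\alpha-\mathcal S(\pi(\alpha)))$, the second term being exact. For $X\in\chi_{\eta,\omega}(M)$ write in this way $\imath_X\omega=\mathcal H_\omega+dU_\omega$ and $\eta(X)\eta=\mathcal K_\eta+dV_\eta$, where $\mathcal H_\omega=\mathcal S(\pi(\imath_X\omega))$ and $\mathcal K_\eta=\mathcal S(\pi(\eta(X)\eta))$, and define $$\|X\|_C^{\mathcal S}:=\|\mathcal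 K_\eta+\mathcal H_\omega\|_{L^2}+\nu^B\big(d(U_\omega+V_\eta)\big)+|\eta(X)|,$$ where $\|\cdot\|_{L^2}$ is the $L^2$-Hodge norm on $1$-forms of a fixed Riemannian metric on $M$ and $\nu^B$ is a fixed norm on the space of exact $1$-forms equivalent to the oscillation norm $df\mapsto osc(df)=\max_Mf-\min_Mf$. Two norms are equivalent if each is bounded by a positive constant multiple of the other. *)

theory Defs
  imports "HOL-Analysis.Analysis" "HOL-Library.Function_Algebras"
begin

section \<open>Smooth maps between normed spaces\<close>

text \<open>For an open subset \<open>S\<close> of a finite-dimensional space this is the usual class \<open>C\<^sup>k\<close>: all
  iterated directional derivatives up to order \<open>k\<close> exist as Frechet derivatives and are continuous.
  It is only used for open \<open>S\<close>.\<close>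

primrec Ck_on ::
    "nat \<Rightarrow> ('e::real_normed_vector \<Rightarrow> 'f::real_normed_vector) \<Rightarrow> 'e set \<Rightarrow> bool" where
  "Ck_on 0 f S \<longleftrightarrow> continuous_on S f"
| "Ck_on (Suc k) f S \<longleftrightarrow>
     (\<forall>x\<in>S. f differentiable (at x)) \<and> (\<forall>v. Ck_on k (\<lambda>x. frechet_derivative f (at x) v) S)"

definition smooth_on ::
    "('e::real_normed_vector \<Rightarrow> 'f::real_normed_vector) \<Rightarrow> 'e set \<Rightarrow> bool" where
  "smooth_on f S \<longleftrightarrow> (\<forall>k. Ck_on k f S)"

section \<open>Smooth manifolds\<close>

text \<open>The underlying set of the manifold is a whole type \<open>'a\<close> (Hausdorff and second countable); a
  chart is a pair of a domain and a coordinate map. The dimension is \<open>CARD('n)\<close>. Only the values of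
  the coordinate map on the domain matter.\<close>

type_synonym ('a, 'n) chart = "'a set \<times> ('a \<Rightarrow> real ^ 'n)"

abbreviation chart_dom :: "('a, 'n) chart \<Rightarrow> 'a set" where
  "chart_dom c \<equiv> fst c"

abbreviation chart_map :: "('a, 'n) chart \<Rightarrow> 'a \<Rightarrow> real ^ 'n" where
  "chart_map c \<equiv> snd c"

definition chart_inv :: "('a, 'n) chart \<Rightarrow> real ^ 'n \<Rightarrow> 'a" where
  "chart_inv c = inv_into (chart_dom c) (chart_map c)"

abbreviation chart_img :: "('a, 'n) chart \<Rightarrow> (real ^ 'n) set" where
  "chart_img c \<equiv> chart_map c ` chart_dom c"

definition smooth_atlas ::
    "('a::{t2_space,second_countable_topology}, 'n::finite) chart set \<Rightarrow> bool" where
  "smooth_atlas A \<longleftrightarrow>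
     (\<forall>c\<in>A. open (chart_dom c) \<and> open (chart_img c) \<and>
        homeomorphism (chart_dom c) (chart_img c) (chart_map c) (chart_inv c)) \<and>
     (\<Union>c\<in>A. chart_dom c) = UNIV \<and>
     (\<forall>c\<in>A. \<forall>c'\<in>A.
        smooth_on (chart_map c' \<circ> chart_inv c) (chart_map c ` (chart_dom c \<inter> chart_dom c')))"

text \<open>Every point gets a preferred chart, and a tangent vector at \<open>p\<close> is given by its coordinates
  in the chart preferred at \<open>p\<close>: the tangent space at \<open>p\<close> is \<open>real ^ 'n\<close>, and vector fields and
  tensor fields are plain functions on \<open>'a\<close>. Since the preferred chart may jump from point to point,
  regularity is a condition on the representation in each fixed chart of the atlas, obtained with
  the change of tangent coordinates below.\<close>

definition chart_at :: "('a, 'n) chart set \<Rightarrow> 'a \<Rightarrow> ('a, 'n) chart" where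
  "chart_at A p = (SOME c. c \<in> A \<and> p \<in> chart_dom c)"

definition tangent_change ::
    "('a, 'n::finite) chart \<Rightarrow> ('a, 'n) chart \<Rightarrow> 'a \<Rightarrow> real ^ 'n \<Rightarrow> real ^ 'n" where
  "tangent_change c c' p = frechet_derivative (chart_map c' \<circ> chart_inv c) (at (chart_map c p))"

type_synonym ('a, 'n) vfield = "'a \<Rightarrow> real ^ 'n"
type_synonym ('a, 'n) field1 = "'a \<Rightarrow> real ^ 'n \<Rightarrow> real"
type_synonym ('a, 'n) field2 = "'a \<Rightarrow> real ^ 'n \<Rightarrow> real ^ 'n \<Rightarrow> real"

definition local_vfield ::
    "('a, 'n::finite) chart set \<Rightarrow> ('a, 'n) chart \<Rightarrow> ('a, 'n) vfield \<Rightarrow> real ^ 'n \<Rightarrow> real ^ 'n" where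
  "local_vfield A c X x = (let p = chart_inv c x in tangent_change (chart_at A p) c p (X p))"

definition local1 ::
    "('a, 'n::finite) chart set \<Rightarrow> ('a, 'n) chart \<Rightarrow> ('a, 'n) field1 \<Rightarrow>
      real ^ 'n \<Rightarrow> real ^ 'n \<Rightarrow> real" where
  "local1 A c \<alpha> x v = (let p = chart_inv c x in \<alpha> p (tangent_change c (chart_at A p) p v))"

definition local2 ::
    "('a, 'n::finite) chart set \<Rightarrow> ('a, 'n) chart \<Rightarrow> ('a, 'n) field2 \<Rightarrow>
      real ^ 'n \<Rightarrow> real ^ 'n \<Rightarrow> real ^ 'n \<Rightarrow> real" where
  "local2 A c \<omega> x u v = (let p = chart_inv c x; T = tangent_change c (chart_at A p) p
     in \<omega> p (T u) (T v))"

definition smooth_fun :: "('a, 'n::finite) chart set \<Rightarrow> ('a \<Rightarrow> real) \<Rightarrow> bool" where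
  "smooth_fun A f \<longleftrightarrow> (\<forall>c\<in>A. smooth_on (f \<circ> chart_inv c) (chart_img c))"

definition smooth_vfield :: "('a, 'n::finite) chart set \<Rightarrow> ('a, 'n) vfield \<Rightarrow> bool" where
  "smooth_vfield A X \<longleftrightarrow> (\<forall>c\<in>A. smooth_on (local_vfield A c X) (chart_img c))"

definition form1 :: "('a, 'n::finite) chart set \<Rightarrow> ('a, 'n) field1 \<Rightarrow> bool" where
  "form1 A \<alpha> \<longleftrightarrow> (\<forall>p. linear (\<alpha> p)) \<and>
     (\<forall>c\<in>A. \<forall>v. smooth_on (\<lambda>x. local1 A c \<alpha> x v) (chart_img c))"

definition tensor2 :: "('a, 'n::finite) chart set \<Rightarrow> ('a, 'n) field2 \<Rightarrow> bool" where
  "tensor2 A \<omega> \<longleftrightarrow> (\<forall>p. bilinear (\<omega> p)) \<and>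
     (\<forall>c\<in>A. \<forall>u v. smooth_on (\<lambda>x. local2 A c \<omega> x u v) (chart_img c))"

definition form2 :: "('a, 'n::finite) chart set \<Rightarrow> ('a, 'n) field2 \<Rightarrow> bool" where
  "form2 A \<omega> \<longleftrightarrow> tensor2 A \<omega> \<and> (\<forall>p v. \<omega> p v v = 0)"

section \<open>Exterior and Lie derivatives\<close>

text \<open>The values at \<open>p\<close> are computed by the usual coordinate formulas in the chart preferred at
  \<open>p\<close>, i.e. the one in which tangent vectors at \<open>p\<close> are expressed. Below \<open>pderiv_at A p F u\<close> is
  the derivative in direction \<open>u\<close>, at the coordinates of \<open>p\<close>, of a function \<open>F\<close> of these
  coordinates.\<close>

definition pderiv_at ::
    "('a, 'n::finite) chart set \<Rightarrow> 'a \<Rightarrow> (real ^ 'n \<Rightarrow> 'f::real_normed_vector) \<Rightarrow> real ^ 'n \<Rightarrow> 'f" where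
  "pderiv_at A p F u = frechet_derivative F (at (chart_map (chart_at A p) p)) u"

definition ext_d0 :: "('a, 'n::finite) chart set \<Rightarrow> ('a \<Rightarrow> real) \<Rightarrow> ('a, 'n) field1" where
  "ext_d0 A f p v = pderiv_at A p (f \<circ> chart_inv (chart_at A p)) v"

definition ext_d1 :: "('a, 'n::finite) chart set \<Rightarrow> ('a, 'n) field1 \<Rightarrow> ('a, 'n) field2" where
  "ext_d1 A \<alpha> p u v = (let a = local1 A (chart_at A p) \<alpha> in
     pderiv_at A p (\<lambda>x. a x v) u - pderiv_at A p (\<lambda>x. a x u) v)"

definition ext_d2 ::
    "('a, 'n::finite) chart set \<Rightarrow> ('a, 'n) field2 \<Rightarrow>
      'a \<Rightarrow> real ^ 'n \<Rightarrow> real ^ 'n \<Rightarrow> real ^ 'n \<Rightarrow> real" where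
  "ext_d2 A \<omega> p u v w = (let b = local2 A (chart_at A p) \<omega> in
     pderiv_at A p (\<lambda>x. b x v w) u - pderiv_at A p (\<lambda>x. b x u w) v + pderiv_at A p (\<lambda>x. b x u v) w)"

definition lie1 ::
    "('a, 'n::finite) chart set \<Rightarrow> ('a, 'n) vfield \<Rightarrow> ('a, 'n) field1 \<Rightarrow> ('a, 'n) field1" where
  "lie1 A X \<alpha> p v = (let Y = local_vfield A (chart_at A p) X; a = local1 A (chart_at A p) \<alpha> in
     pderiv_at A p (\<lambda>x. a x v) (X p) + \<alpha> p (pderiv_at A p Y v))"

definition lie2 ::
    "('a, 'n::finite) chart set \<Rightarrow> ('a, 'n) vfield \<Rightarrow> ('a, 'n) field2 \<Rightarrow> ('a, 'n) field2" where
  "lie2 A X \<omega> p u v = (let Y = local_vfield A (chart_at A p) X; b = local2 A (chart_at A p) \<omega> in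
     pderiv_at A p (\<lambda>x. b x u v) (X p) + \<omega> p (pderiv_at A p Y u) v + \<omega> p u (pderiv_at A p Y v))"

section \<open>First de Rham cohomology\<close>

text \<open>Addition and subtraction of fields are the pointwise ones of the library; the type of fields
  is not an instance of \<open>real_vector\<close>, so the scalings are spelled out.\<close>

definition scale1 :: "real \<Rightarrow> ('a, 'n) field1 \<Rightarrow> ('a, 'n) field1" where
  "scale1 r \<alpha> = (\<lambda>p v. r * \<alpha> p v)"

definition scale_vfield :: "real \<Rightarrow> ('a, 'n::finite) vfield \<Rightarrow> ('a, 'n) vfield" where
  "scale_vfield r X = (\<lambda>p. r *\<^sub>R X p)"

definition closed1 :: "('a, 'n::finite) chart set \<Rightarrow> ('a, 'n) field1 set" where
  "closed1 A = {\<alpha>. form1 A \<alpha> \<and> (\<forall>p u v. ext_d1 A \<alpha> p u v = 0)}"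

definition exact1 :: "('a, 'n::finite) chart set \<Rightarrow> ('a, 'n) field1 set" where
  "exact1 A = {ext_d0 A f |f. smooth_fun A f}"

definition cohomologous ::
    "('a, 'n::finite) chart set \<Rightarrow> (('a, 'n) field1 \<times> ('a, 'n) field1) set" where
  "cohomologous A = {(\<alpha>, \<beta>). \<alpha> \<in> closed1 A \<and> \<beta> \<in> closed1 A \<and> \<beta> - \<alpha> \<in> exact1 A}"

definition H1 :: "('a, 'n::finite) chart set \<Rightarrow> ('a, 'n) field1 set set" where
  "H1 A = closed1 A // cohomologous A"

definition coh_class :: "('a, 'n::finite) chart set \<Rightarrow> ('a, 'n) field1 \<Rightarrow> ('a, 'n) field1 set" where
  "coh_class A \<alpha> = cohomologous A `` {\<alpha>}"

definition H1_add :: "('a, 'n::finite) chart set \<Rightarrow>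
    ('a, 'n) field1 set \<Rightarrow> ('a, 'n) field1 set \<Rightarrow> ('a, 'n) field1 set" where
  "H1_add A a b = (\<Union>\<alpha>\<in>a. \<Union>\<beta>\<in>b. coh_class A (\<alpha> + \<beta>))"

definition H1_scale :: "('a, 'n::finite) chart set \<Rightarrow>
    real \<Rightarrow> ('a, 'n) field1 set \<Rightarrow> ('a, 'n) field1 set" where
  "H1_scale A r a = (\<Union>\<alpha>\<in>a. coh_class A (scale1 r \<alpha>))"

definition linear_section ::
    "('a, 'n::finite) chart set \<Rightarrow> (('a, 'n) field1 set \<Rightarrow> ('a, 'n) field1) \<Rightarrow> bool" where
  "linear_section A S \<longleftrightarrow>
     (\<forall>a\<in>H1 A. S a \<in> closed1 A \<and> coh_class A (S a) = a) \<and>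
     (\<forall>a\<in>H1 A. \<forall>b\<in>H1 A. S (H1_add A a b) = S a + S b) \<and>
     (\<forall>r. \<forall>a\<in>H1 A. S (H1_scale A r a) = scale1 r (S a))"

text \<open>A potential of an exact form; on a connected manifold it is unique up to a constant.\<close>

definition potential :: "('a, 'n::finite) chart set \<Rightarrow> ('a, 'n) field1 \<Rightarrow> 'a \<Rightarrow> real" where
  "potential A \<alpha> = (SOME f. smooth_fun A f \<and> ext_d0 A f = \<alpha>)"

section \<open>Norms\<close>

definition norm_on ::
    "(real \<Rightarrow> 'v::ab_group_add \<Rightarrow> 'v) \<Rightarrow> 'v set \<Rightarrow> ('v \<Rightarrow> real) \<Rightarrow> bool" where
  "norm_on sc V N \<longleftrightarrow>
     (\<forall>x\<in>V. 0 \<le> N x \<and> (N x = 0 \<longleftrightarrow> x = 0)) \<and>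
     (\<forall>r. \<forall>x\<in>V. N (sc r x) = \<bar>r\<bar> * N x) \<and>
     (\<forall>x\<in>V. \<forall>y\<in>V. N (x + y) \<le> N x + N y)"

definition equivalent_norms_on ::
    "(real \<Rightarrow> 'v::ab_group_add \<Rightarrow> 'v) \<Rightarrow> 'v set \<Rightarrow> ('v \<Rightarrow> real) \<Rightarrow> ('v \<Rightarrow> real) \<Rightarrow> bool" where
  "equivalent_norms_on sc V N N' \<longleftrightarrow> norm_on sc V N \<and> norm_on sc V N' \<and>
     (\<exists>C>0. \<forall>x\<in>V. N x \<le> C * N' x) \<and> (\<exists>C>0. \<forall>x\<in>V. N' x \<le> C * N x)"

text \<open>On a compact manifold the supremum and infimum of a smooth function are attained.\<close>

definition osc :: "('a, 'n::finite) chart set \<Rightarrow> ('a, 'n) field1 \<Rightarrow> real" where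
  "osc A \<alpha> = (let f = potential A \<alpha> in (SUP p. f p) - (INF p. f p))"

section \<open>Riemannian metrics and the $L^2$ norm of 1-forms\<close>

definition riemannian_metric :: "('a, 'n::finite) chart set \<Rightarrow> ('a, 'n) field2 \<Rightarrow> bool" where
  "riemannian_metric A g \<longleftrightarrow> tensor2 A g \<and>
     (\<forall>p u v. g p u v = g p v u) \<and> (\<forall>p v. v \<noteq> 0 \<longrightarrow> 0 < g p v v)"

definition gram :: "(real ^ 'n \<Rightarrow> real ^ 'n \<Rightarrow> real) \<Rightarrow> real ^ 'n ^ 'n::finite" where
  "gram b = (\<chi> i j. b (axis i 1) (axis j 1))"

text \<open>The squared pointwise norm \<open>g\<^sup>i\<^sup>j \<alpha>\<^sub>i \<alpha>\<^sub>j\<close>, which is the function \<open>h\<close> with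
  \<open>\<alpha> \<and> *\<alpha> = h dvol\<close> for the Hodge star of \<open>g\<close>.\<close>

definition norm1_sq :: "('a, 'n::finite) field2 \<Rightarrow> ('a, 'n) field1 \<Rightarrow> 'a \<Rightarrow> real" where
  "norm1_sq g \<alpha> p = (let a = (\<chi> i. \<alpha> p (axis i 1)) in a \<bullet> (matrix_inv (gram (g p)) *v a))"

text \<open>Integration over a compact manifold with respect to the Riemannian volume: cut the manifold
  into finitely many disjoint Borel pieces, each relatively compact in a chart domain, and integrate
  each piece in its chart against \<open>sqrt (det g)\<close>. By the change of variables formula
  the result does not depend on the pieces and charts chosen.\<close>

definition chart_partition ::
    "('a::topological_space, 'n::finite) chart set \<Rightarrow> ('a set \<times> ('a, 'n) chart) set \<Rightarrow> bool" where
  "chart_partition A P \<longleftrightarrow> finite P \<and>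
     (\<forall>(B, c)\<in>P. c \<in> A \<and> B \<in> sets borel \<and> (\<exists>K. compact K \<and> B \<subseteq> K \<and> K \<subseteq> chart_dom c)) \<and>
     pairwise (\<lambda>q q'. fst q \<inter> fst q' = {}) P \<and> (\<Union>q\<in>P. fst q) = UNIV"

definition riemannian_integral ::
    "('a::topological_space, 'n::finite) chart set \<Rightarrow> ('a, 'n) field2 \<Rightarrow> ('a \<Rightarrow> real) \<Rightarrow> real" where
  "riemannian_integral A g h = (let P = (SOME P. chart_partition A P) in
     \<Sum>(B, c)\<in>P. LINT x : chart_map c ` B | lborel.
       h (chart_inv c x) * sqrt (det (gram (local2 A c g x))))"

definition L2_norm1 ::
    "('a::topological_space, 'n::finite) chart set \<Rightarrow> ('a, 'n) field2 \<Rightarrow> ('a, 'n) field1 \<Rightarrow> real" where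
  "L2_norm1 A g \<alpha> = sqrt (riemannian_integral A g (norm1_sq g \<alpha>))"

section \<open>Cosymplectic structures\<close>

text \<open>In the last clause the target is the cotangent space at \<open>p\<close>.\<close>

definition cosymplectic ::
    "('a, 'n::finite) chart set \<Rightarrow> ('a, 'n) field2 \<Rightarrow> ('a, 'n) field1 \<Rightarrow> bool" where
  "cosymplectic A \<omega> \<eta> \<longleftrightarrow>
     form2 A \<omega> \<and> (\<forall>p u v w. ext_d2 A \<omega> p u v w = 0) \<and>
     form1 A \<eta> \<and> (\<forall>p u v. ext_d1 A \<eta> p u v = 0) \<and>
     (\<forall>p. \<exists>v. \<eta> p v \<noteq> 0) \<and>
     (\<forall>p. bij_betw (\<lambda>v w. \<omega> p v w + \<eta> p v * \<eta> p w) UNIV {l. linear l})"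

definition cosymplectic_vfields ::
    "('a, 'n::finite) chart set \<Rightarrow> ('a, 'n) field2 \<Rightarrow> ('a, 'n) field1 \<Rightarrow> ('a, 'n) vfield set" where
  "cosymplectic_vfields A \<omega> \<eta> = {X. smooth_vfield A X \<and>
     (\<forall>p u v. lie2 A X \<omega> p u v = 0) \<and> (\<forall>p v. lie1 A X \<eta> p v = 0)}"

definition interior2 :: "('a, 'n) vfield \<Rightarrow> ('a, 'n) field2 \<Rightarrow> ('a, 'n) field1" where
  "interior2 X \<omega> = (\<lambda>p. \<omega> p (X p))"

text \<open>The value of the function \<open>\<eta>(X)\<close>, which is constant for cosymplectic \<open>X\<close> on a connected
  manifold.\<close>

definition eta_value :: "('a, 'n) field1 \<Rightarrow> ('a, 'n) vfield \<Rightarrow> real" where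
  "eta_value \<eta> X = (THE r. \<forall>p. \<eta> p (X p) = r)"

definition cosymplectic_norm ::
    "('a::topological_space, 'n::finite) chart set \<Rightarrow> ('a, 'n) field2 \<Rightarrow> ('a, 'n) field1 \<Rightarrow>
      ('a, 'n) field2 \<Rightarrow> (('a, 'n) field1 \<Rightarrow> real) \<Rightarrow> (('a, 'n) field1 set \<Rightarrow> ('a, 'n) field1) \<Rightarrow>
      ('a, 'n) vfield \<Rightarrow> real" where
  "cosymplectic_norm A \<omega> \<eta> g \<nu> S X =
     (let \<alpha> = interior2 X \<omega>; \<beta> = (\<lambda>p v. \<eta> p (X p) * \<eta> p v);
          H = S (coh_class A \<alpha>); K = S (coh_class A \<beta>);
          U = potential A (\<alpha> - H); V = potential A (\<beta> - K)
      in L2_norm1 A g (K + H) + \<nu> (ext_d0 A (U + V)) + \<bar>eta_value \<eta> X\<bar>)"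

end

theory Submission
  imports Defs
begin

text \<open>For a cosymplectic field \<open>X\<close> put \<open>\<gamma> = \<iota>\<^sub>X \<omega> + \<eta>(X) \<eta>\<close>, a closed 1-form. By linearity of \<open>S\<close> the norm
  belonging to \<open>S\<close> is \<open>|S[\<gamma>]|\<close> in \<open>L2\<close> plus \<open>\<nu> (\<gamma> - S[\<gamma>]) + |\<eta>(X)|\<close>, and it depends on \<open>S\<close> only through
  a norm on closed 1-forms. With \<open>\<sigma> = S[\<gamma>]\<close>, passing from \<open>S\<close> to \<open>T\<close> increases this norm by at most
  \<open>|T[\<sigma>]| + \<nu> (\<sigma> - T[\<sigma>])\<close>, a seminorm on the image of \<open>S\<close>. This image is finite-dimensional because
  \<open>H\<^sup>1\<close> of a compact manifold is, so the seminorm is dominated by the \<open>L2\<close> norm.\<close>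

text \<open>\<open>equivalent_norms_on\<close> also asserts that both functions are norms, and this
  shapes much of the proof. Definiteness needs the isomorphism of the cosymplectic structure, which
  makes X \<mapsto> \<gamma> injective; the contraction of \<omega> with X alone forgets the
  component of X in the kernel of \<omega>. It also needs definiteness of the L2 norm, although
  \<open>riemannian_integral\<close> uses an arbitrarily chosen partition whose pieces may have
  empty interior; null sets are therefore compared across charts. Finite-dimensionality is used
  without bases, through finitely many linear functionals on closed forms whose common kernel
  consists of exact forms. They are differences of primitives on coordinate balls, and on the image
  of S they separate points. An induction on their number gives the domination by the L2 norm.
  Closedness is imposed at each point in the chart preferred there, so a version valid throughout a
  fixed chart is needed before the Poincare lemma can be applied on a ball.\<close>

section \<open>Calculus of smooth maps\<close>

text \<open>The clause for \<open>Suc k\<close> mentions no lower order: at the bottom continuity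
  comes from differentiability, higher up the claim passes to the directional derivatives.\<close>

lemma Ck_on_Suc_imp: "Ck_on (Suc k) f S \<Longrightarrow> Ck_on k f S"
proof (induction k arbitrary: f)
  case 0
  then show ?case
    by (auto intro!: differentiable_imp_continuous_on simp: differentiable_on_def
        differentiable_at_withinI)
next
  case (Suc k)
  then show ?case by (meson Ck_on.simps(2))
qed

text \<open>Smoothness unfolds into itself, which removes the order k from most later
  arguments.\<close>

lemma smooth_on_iff_frechet:
  "smooth_on f S \<longleftrightarrow>
    (\<forall>x\<in>S. f differentiable (at x)) \<and> (\<forall>v. smooth_on (\<lambda>x. frechet_derivative f (at x) v) S)"
proof
  assume f: "smooth_on f S"
  show "(\<forall>x\<in>S. f differentiable (at x)) \<and> (\<forall>v. smooth_on (\<lambda>x. frechet_derivative f (at x) v) S)"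
  proof -
    have "Ck_on (Suc k) f S" for k using f by (simp only: smooth_on_def)
    then show ?thesis by (simp add: smooth_on_def)
  qed
next
  assume f: "(\<forall>x\<in>S. f differentiable (at x)) \<and> (\<forall>v. smooth_on (\<lambda>x. frechet_derivative f (at x) v) S)"
  then have "Ck_on (Suc k) f S" for k
    by (simp add: smooth_on_def)
  then show "smooth_on f S"
    unfolding smooth_on_def using Ck_on_Suc_imp by blast
qed

lemma smooth_on_differentiable: "smooth_on f S \<Longrightarrow> x \<in> S \<Longrightarrow> f differentiable (at x)"
  using smooth_on_iff_frechet by blast

lemma smooth_on_frechet: "smooth_on f S \<Longrightarrow> smooth_on (\<lambda>x. frechet_derivative f (at x) v) S"
  using smooth_on_iff_frechet by blast

lemma smooth_on_has_derivative:
  "smooth_on f S \<Longrightarrow> x \<in> S \<Longrightarrow> (f has_derivative frechet_derivative f (at x)) (at x)"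
  using smooth_on_differentiable frechet_derivative_works by blast

lemma smooth_on_continuous: "smooth_on f S \<Longrightarrow> continuous_on S f"
  by (metis Ck_on.simps(1) smooth_on_def)

lemma Ck_on_subset: "Ck_on k f S \<Longrightarrow> T \<subseteq> S \<Longrightarrow> Ck_on k f T"
  by (induction k arbitrary: f) (auto intro: continuous_on_subset)

lemma smooth_on_subset: "smooth_on f S \<Longrightarrow> T \<subseteq> S \<Longrightarrow> smooth_on f T"
  by (meson Ck_on_subset smooth_on_def)

text \<open>\<open>frechet_derivative\<close> is a choice among all derivatives, so two functions
  with the same derivatives get the same chosen one, differentiable or not.\<close>

lemma frechet_derivative_cong_open:
  assumes "open S" "x \<in> S" "\<And>y. y \<in> S \<Longrightarrow> f y = g y"
  shows "frechet_derivative f (at x) = frechet_derivative g (at x)"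
proof -
  have "(f has_derivative D) (at x) \<longleftrightarrow> (g has_derivative D) (at x)" for D
    using has_derivative_transform_within_open[OF _ assms(1,2)] assms(3) by metis
  then show ?thesis by (simp add: frechet_derivative_def)
qed

lemma differentiable_cong_open:
  assumes "open S" "x \<in> S" "\<And>y. y \<in> S \<Longrightarrow> f y = g y"
  shows "f differentiable (at x) \<longleftrightarrow> g differentiable (at x)"
  unfolding differentiable_def
  using has_derivative_transform_within_open[OF _ assms(1,2)] assms(3) by metis

lemma Ck_on_cong:
  assumes "open S" "\<And>y. y \<in> S \<Longrightarrow> f y = g y"
  shows "Ck_on k f S \<longleftrightarrow> Ck_on k g S"
  using assms(2)
proof (induction k arbitrary: f g)
  case 0
  then show ?case by (simp cong: continuous_on_cong)
next
  case (Suc k)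
  have "Ck_on k (\<lambda>x. frechet_derivative f (at x) v) S \<longleftrightarrow> Ck_on k (\<lambda>x. frechet_derivative g (at x) v) S" for v
    by (rule Suc.IH) (simp add: frechet_derivative_cong_open[OF assms(1) _ Suc.prems])
  moreover have "(\<forall>x\<in>S. f differentiable (at x)) \<longleftrightarrow> (\<forall>x\<in>S. g differentiable (at x))"
    using differentiable_cong_open[OF assms(1), of _ f g] Suc.prems by blast
  ultimately show ?case by simp
qed

lemma smooth_on_cong:
  assumes "open S" "\<And>y. y \<in> S \<Longrightarrow> f y = g y"
  shows "smooth_on f S \<longleftrightarrow> smooth_on g S"
  unfolding smooth_on_def using Ck_on_cong[OF assms(1), of f g] assms(2) by simp

lemma smooth_on_if_has_derivative:
  assumes "open S" "\<And>x. x \<in> S \<Longrightarrow> (f has_derivative F x) (at x)" "\<And>v. smooth_on (\<lambda>x. F x v) S"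
  shows "smooth_on f S"
proof (subst smooth_on_iff_frechet, intro conjI ballI allI)
  fix v
  have "smooth_on (\<lambda>x. frechet_derivative f (at x) v) S \<longleftrightarrow> smooth_on (\<lambda>x. F x v) S"
    by (intro smooth_on_cong assms(1)) (simp add: frechet_derivative_at[OF assms(2), symmetric])
  then show "smooth_on (\<lambda>x. frechet_derivative f (at x) v) S" using assms(3) by blast
qed (use assms(2) in \<open>auto simp: differentiable_def\<close>)

section \<open>Closure of the classes \<open>Ck_on\<close> and \<open>smooth_on\<close> under
  algebraic operations\<close>

lemma Ck_on_linear_image:
  assumes "bounded_linear L" "open S" "Ck_on k f S"
  shows "Ck_on k (\<lambda>x. L (f x)) S"
  using assms(3)
proof (induction k arbitrary: f)
  case 0
  then show ?case using assms(1) by (simp add: linear_continuous_on_compose bounded_linear.continuous_on)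
next
  case (Suc k)
  have D: "((\<lambda>x. L (f x)) has_derivative (\<lambda>v. L (frechet_derivative f (at x) v))) (at x)" if "x \<in> S" for x
    using Suc.prems that by (intro bounded_linear.has_derivative[OF assms(1)])
      (simp add: frechet_derivative_works)
  have "Ck_on k (\<lambda>x. frechet_derivative (\<lambda>x. L (f x)) (at x) v) S" for v
  proof -
    have "Ck_on k (\<lambda>x. L (frechet_derivative f (at x) v)) S"
      using Suc.prems by (intro Suc.IH) simp
    moreover have "frechet_derivative (\<lambda>x. L (f x)) (at x) v = L (frechet_derivative f (at x) v)" if "x \<in> S" for x
      using fun_cong[OF frechet_derivative_at[OF D[OF that]]] by simp
    ultimately show ?thesis by (subst Ck_on_cong[OF assms(2)])
  qed
  then show ?case using D by (auto simp: differentiable_def)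
qed

lemma smooth_on_linear_image:
  "bounded_linear L \<Longrightarrow> open S \<Longrightarrow> smooth_on f S \<Longrightarrow> smooth_on (\<lambda>x. L (f x)) S"
  by (simp add: smooth_on_def Ck_on_linear_image)

lemma Ck_on_add:
  assumes "open S" "Ck_on k f S" "Ck_on k g S"
  shows "Ck_on k (\<lambda>x. f x + g x) S"
  using assms(2,3)
proof (induction k arbitrary: f g)
  case 0
  then show ?case by (simp add: continuous_on_add)
next
  case (Suc k)
  have D: "((\<lambda>x. f x + g x) has_derivative
      (\<lambda>v. frechet_derivative f (at x) v + frechet_derivative g (at x) v)) (at x)" if "x \<in> S" for x
    using Suc.prems that by (intro has_derivative_add) (simp_all add: frechet_derivative_works)
  have "Ck_on k (\<lambda>x. frechet_derivative (\<lambda>x. f x + g x) (at x) v) S" for v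
  proof -
    have "Ck_on k (\<lambda>x. frechet_derivative f (at x) v + frechet_derivative g (at x) v) S"
      using Suc.prems by (intro Suc.IH) simp_all
    moreover have "frechet_derivative (\<lambda>x. f x + g x) (at x) v =
        frechet_derivative f (at x) v + frechet_derivative g (at x) v" if "x \<in> S" for x
      using fun_cong[OF frechet_derivative_at[OF D[OF that]]] by simp
    ultimately show ?thesis by (subst Ck_on_cong[OF assms(1)])
  qed
  then show ?case using D by (auto simp: differentiable_def)
qed

lemma smooth_on_add:
  "open S \<Longrightarrow> smooth_on f S \<Longrightarrow> smooth_on g S \<Longrightarrow> smooth_on (\<lambda>x. f x + g x) S"
  by (simp add: smooth_on_def Ck_on_add)

lemma Ck_on_mult:
  fixes f g :: "'a::real_normed_vector \<Rightarrow> real"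
  assumes "open S" "Ck_on k f S" "Ck_on k g S"
  shows "Ck_on k (\<lambda>x. f x * g x) S"
  using assms(2,3)
proof (induction k arbitrary: f g)
  case 0
  then show ?case by (simp add: continuous_on_mult)
next
  case (Suc k)
  have D: "((\<lambda>x. f x * g x) has_derivative
      (\<lambda>v. f x * frechet_derivative g (at x) v + frechet_derivative f (at x) v * g x)) (at x)"
    if "x \<in> S" for x
    using Suc.prems that by (intro has_derivative_mult) (simp_all add: frechet_derivative_works)
  have "Ck_on k (\<lambda>x. frechet_derivative (\<lambda>x. f x * g x) (at x) v) S" for v
  proof -
    have "Ck_on k (\<lambda>x. f x * frechet_derivative g (at x) v + frechet_derivative f (at x) v * g x) S"
      using Suc.prems Ck_on_Suc_imp[OF Suc.prems(1)] Ck_on_Suc_imp[OF Suc.prems(2)]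
      by (intro Ck_on_add[OF assms(1)] Suc.IH) simp_all
    moreover have "frechet_derivative (\<lambda>x. f x * g x) (at x) v =
        f x * frechet_derivative g (at x) v + frechet_derivative f (at x) v * g x" if "x \<in> S" for x
      using fun_cong[OF frechet_derivative_at[OF D[OF that]]] by simp
    ultimately show ?thesis by (subst Ck_on_cong[OF assms(1)])
  qed
  then show ?case using D by (auto simp: differentiable_def)
qed

lemma smooth_on_mult:
  fixes f g :: "'a::real_normed_vector \<Rightarrow> real"
  shows "open S \<Longrightarrow> smooth_on f S \<Longrightarrow> smooth_on g S \<Longrightarrow> smooth_on (\<lambda>x. f x * g x) S"
  by (simp add: smooth_on_def Ck_on_mult)

lemma smooth_on_const: "smooth_on (\<lambda>x. c) S"
proof -
  have "Ck_on k (\<lambda>x. c) S" for k and c :: 'b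
    by (induction k arbitrary: c) simp_all
  then show ?thesis by (simp add: smooth_on_def)
qed

lemma smooth_on_sum:
  "open S \<Longrightarrow> (\<And>i. i \<in> I \<Longrightarrow> smooth_on (f i) S) \<Longrightarrow> smooth_on (\<lambda>x. \<Sum>i\<in>I. f i x) S"
  by (induction I rule: infinite_finite_induct) (auto intro: smooth_on_const smooth_on_add)

lemma smooth_on_cmult:
  fixes f :: "'a::real_normed_vector \<Rightarrow> real"
  shows "open S \<Longrightarrow> smooth_on f S \<Longrightarrow> smooth_on (\<lambda>x. r * f x) S"
  by (intro smooth_on_mult smooth_on_const)

lemma smooth_on_component:
  fixes f :: "'a::real_normed_vector \<Rightarrow> real ^ 'n::finite"
  shows "open S \<Longrightarrow> smooth_on f S \<Longrightarrow> smooth_on (\<lambda>x. f x $ i) S"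
  using smooth_on_linear_image[OF bounded_linear_vec_nth] by blast

lemma linear_expand_axis:
  fixes a :: "real ^ 'n::finite \<Rightarrow> real"
  assumes "linear a"
  shows "a v = (\<Sum>i\<in>UNIV. v $ i * a (axis i 1))"
proof -
  have "a v = a (\<Sum>i\<in>UNIV. v $ i *\<^sub>R axis i 1)"
    using basis_expansion[of v] by (simp add: scalar_mult_eq_scaleR)
  also have "\<dots> = (\<Sum>i\<in>UNIV. v $ i * a (axis i 1))"
    by (simp add: linear_sum[OF assms] linear_cmul[OF assms])
  finally show ?thesis .
qed

lemma smooth_on_linear_field:
  fixes a :: "'e::real_normed_vector \<Rightarrow> real ^ 'n::finite \<Rightarrow> real"
  assumes "open S" "\<And>y. y \<in> S \<Longrightarrow> linear (a y)" "\<And>v. smooth_on (\<lambda>y. a y v) S" "smooth_on Y S"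
  shows "smooth_on (\<lambda>y. a y (Y y)) S"
proof -
  have "smooth_on (\<lambda>y. \<Sum>i\<in>UNIV. Y y $ i * a y (axis i 1)) S"
    using assms by (intro smooth_on_sum smooth_on_mult smooth_on_component)
  then show ?thesis
    by (subst smooth_on_cong[OF assms(1)]) (rule linear_expand_axis[OF assms(2)])
qed

text \<open>Leibniz rule for the pairing of a field of linear forms with a vector field. Derivatives
  of the linear forms are known only on each fixed vector, so the pairing is expanded in the
  standard basis into finitely many products of real functions.\<close>

lemma has_derivative_linear_field:
  fixes a :: "'e::real_normed_vector \<Rightarrow> real ^ 'n::finite \<Rightarrow> real"
  assumes "open S" "x \<in> S" "\<And>y. y \<in> S \<Longrightarrow> linear (a y)"
    and a: "\<And>v. ((\<lambda>y. a y v) has_derivative (\<lambda>u. a' u v)) (at x)"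
    and Y: "(Y has_derivative Y') (at x)"
  shows "((\<lambda>y. a y (Y y)) has_derivative (\<lambda>u. a' u (Y x) + a x (Y' u))) (at x)"
proof -
  have Yi: "((\<lambda>y. Y y $ i) has_derivative (\<lambda>u. Y' u $ i)) (at x)" for i
    using bounded_linear.has_derivative[OF bounded_linear_vec_nth Y] by blast
  have 1: "((\<lambda>y. \<Sum>i\<in>UNIV. Y y $ i * a y (axis i 1)) has_derivative
      (\<lambda>u. \<Sum>i\<in>UNIV. Y x $ i * a' u (axis i 1) + Y' u $ i * a x (axis i 1))) (at x)"
    by (intro has_derivative_sum has_derivative_mult Yi a)
  \<comment> \<open>\<open>a'\<close> is given only as a family of derivatives, one for each vector.
    Its expansion in the second argument comes from uniqueness of the derivative of y \<mapsto>
    \<open>a y (Y x)\<close>.\<close>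
  have 2: "a' u (Y x) = (\<Sum>i\<in>UNIV. Y x $ i * a' u (axis i 1))" for u
  proof -
    have "((\<lambda>y. \<Sum>i\<in>UNIV. Y x $ i * a y (axis i 1)) has_derivative
      (\<lambda>u. \<Sum>i\<in>UNIV. Y x $ i * a' u (axis i 1))) (at x)"
      by (intro has_derivative_sum has_derivative_mult_right a)
    then have "((\<lambda>y. a y (Y x)) has_derivative (\<lambda>u. \<Sum>i\<in>UNIV. Y x $ i * a' u (axis i 1))) (at x)"
      by (rule has_derivative_transform_within_open[OF _ assms(1,2)])
        (simp add: linear_expand_axis[OF assms(3), symmetric])
    from has_derivative_unique[OF a this] show ?thesis by metis
  qed
  have "((\<lambda>y. \<Sum>i\<in>UNIV. Y y $ i * a y (axis i 1)) has_derivative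
      (\<lambda>u. a' u (Y x) + a x (Y' u))) (at x)"
    by (rule has_derivative_eq_rhs[OF 1])
      (simp add: sum.distrib 2 linear_expand_axis[OF assms(3)[OF assms(2)], symmetric])
  then show ?thesis
    by (rule has_derivative_transform_within_open[OF _ assms(1,2)])
      (simp add: linear_expand_axis[OF assms(3), symmetric])
qed

section \<open>Symmetry of second derivatives and the Poincare lemma\<close>

text \<open>The second difference is the increment over [0, t] of s \<mapsto> f(x + s u + t v) - f(x
  + s u). The mean value theorem turns it into t times a difference of values of
  \<open>F y u\<close>, and differentiability of y \<mapsto> \<open>F y u\<close> at the single
  point x then gives the limit.\<close>

lemma second_difference_tendsto:
  fixes f :: "'e::real_normed_vector \<Rightarrow> real"
  assumes "open S" "x \<in> S" and F: "\<And>y. y \<in> S \<Longrightarrow> (f has_derivative F y) (at y)"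
    and A: "((\<lambda>y. F y u) has_derivative A) (at x)"
  shows "((\<lambda>t. (f (x + t *\<^sub>R u + t *\<^sub>R v) - f (x + t *\<^sub>R u) - f (x + t *\<^sub>R v) + f x) / t\<^sup>2)
    \<longlongrightarrow> A v) (at_right 0)"
proof (rule tendstoI)
  fix e :: real assume e: "0 < e"
  \<comment> \<open>For s and q in [0, t] the displacement s u + q v has norm at most
    \<open>t * M\<close>. The linearisation error \<open>e' * (t * M)\<close> will occur twice, and
    the constant in \<open>e'\<close> makes the sum \<open>e / 2 * t\<close>.\<close>
  define M where "M = norm u + norm v + 1"
  have M: "M > 0" by (simp add: M_def add_nonneg_pos)
  define e' where "e' = e / (4 * M)"
  have e': "e' > 0" using e M by (simp add: e'_def)
  obtain r where r: "r > 0" "ball x r \<subseteq> S" using assms openE by blast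
  obtain d0 where d0: "d0 > 0"
      "\<And>y. norm (y - x) < d0 \<Longrightarrow> norm (F y u - F x u - A (y - x)) \<le> e' * norm (y - x)"
    using A e' unfolding has_derivative_at_alt by blast
  define d where "d = min d0 r / M"
  have d: "d > 0" using d0(1) r(1) M by (simp add: d_def)
  have linA: "linear A" using A has_derivative_linear by blast
  have "dist ((f (x + t *\<^sub>R u + t *\<^sub>R v) - f (x + t *\<^sub>R u) - f (x + t *\<^sub>R v) + f x) / t\<^sup>2) (A v) < e"
    if t: "0 < t" "t < d" for t
  proof -
    have tM: "t * M < d0" "t * M < r" using t(2) M by (auto simp: d_def field_simps)
    have near: "norm (s *\<^sub>R u + q *\<^sub>R v) \<le> t * M" if "0 \<le> s" "s \<le> t" "0 \<le> q" "q \<le> t" for s q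
    proof -
      have "norm (s *\<^sub>R u + q *\<^sub>R v) \<le> s * norm u + q * norm v"
        using norm_triangle_ineq[of "s *\<^sub>R u" "q *\<^sub>R v"] that by simp
      also have "\<dots> \<le> t * norm u + t * norm v"
        using that by (intro add_mono mult_right_mono) auto
      also have "\<dots> \<le> t * M" using t by (simp add: M_def algebra_simps)
      finally show ?thesis .
    qed
    have inS: "x + s *\<^sub>R u + q *\<^sub>R v \<in> S" if "0 \<le> s" "s \<le> t" "0 \<le> q" "q \<le> t" for s q
      using near[OF that] tM r(2) by (auto simp: dist_norm subset_iff norm_minus_commute add.assoc)
    define g where "g s = f (x + s *\<^sub>R u + t *\<^sub>R v) - f (x + s *\<^sub>R u)" for s
    have g: "(g has_real_derivative (F (x + s *\<^sub>R u + t *\<^sub>R v) u - F (x + s *\<^sub>R u) u)) (at s)"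
      if s: "0 \<le> s" "s \<le> t" for s
    proof -
      have "((\<lambda>s. f (x + s *\<^sub>R u + q *\<^sub>R v)) has_derivative (\<lambda>h. F (x + s *\<^sub>R u + q *\<^sub>R v) (h *\<^sub>R u))) (at s)"
        if q: "0 \<le> q" "q \<le> t" for q
      proof -
        have "((\<lambda>s. x + s *\<^sub>R u + q *\<^sub>R v) has_derivative (\<lambda>h. h *\<^sub>R u)) (at s)"
          by (auto intro!: derivative_eq_intros)
        from has_derivative_compose[OF this F[OF inS[OF s q]]] show ?thesis .
      qed
      from this[of t] this[of 0] t
      have "(g has_derivative (\<lambda>h. F (x + s *\<^sub>R u + t *\<^sub>R v) (h *\<^sub>R u) - F (x + s *\<^sub>R u) (h *\<^sub>R u))) (at s)"
        unfolding g_def by (auto intro!: has_derivative_diff)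
      moreover have "linear (F (x + s *\<^sub>R u + t *\<^sub>R v))" "linear (F (x + s *\<^sub>R u))"
        using F[OF inS[of s t]] F[OF inS[of s 0]] has_derivative_linear s t by auto
      ultimately show ?thesis
        unfolding has_field_derivative_def
        by (elim has_derivative_eq_rhs) (simp add: fun_eq_iff linear_cmul algebra_simps)
    qed
    obtain z where z: "0 < z" "z < t"
      "g t - g 0 = (t - 0) * (F (x + z *\<^sub>R u + t *\<^sub>R v) u - F (x + z *\<^sub>R u) u)"
      using MVT2[OF t(1), of g "\<lambda>s. F (x + s *\<^sub>R u + t *\<^sub>R v) u - F (x + s *\<^sub>R u) u"] g by auto
    \<comment> \<open>Linearisation of y \<mapsto> \<open>F y u\<close> at x. Taking q = t and q = 0
      and subtracting cancels both \<open>F x u\<close> and the contribution of z, which leaves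
      \<open>t * A v\<close>.\<close>
    have b: "\<bar>F (x + z *\<^sub>R u + q *\<^sub>R v) u - F x u - A (z *\<^sub>R u + q *\<^sub>R v)\<bar> \<le> e' * (t * M)"
      if "0 \<le> q" "q \<le> t" for q
      using d0(2)[of "x + z *\<^sub>R u + q *\<^sub>R v"] near[of z q] z that tM(1) e'
      by (smt (verit, ccfv_threshold) add.assoc add_diff_cancel_left' mult_left_mono real_norm_def)
    have "\<bar>F (x + z *\<^sub>R u + t *\<^sub>R v) u - F (x + z *\<^sub>R u) u - t * A v\<bar> \<le> 2 * (e' * (t * M))"
      using b[of t] b[of 0] t by (simp add: linear_add[OF linA] linear_cmul[OF linA])
    also have "\<dots> = e / 2 * t" using M by (simp add: e'_def)
    finally have "\<bar>(F (x + z *\<^sub>R u + t *\<^sub>R v) u - F (x + z *\<^sub>R u) u) / t - A v\<bar> \<le> e / 2"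
      using t by (simp add: field_simps abs_le_iff)
    moreover have "(f (x + t *\<^sub>R u + t *\<^sub>R v) - f (x + t *\<^sub>R u) - f (x + t *\<^sub>R v) + f x) / t\<^sup>2
       = (F (x + z *\<^sub>R u + t *\<^sub>R v) u - F (x + z *\<^sub>R u) u) / t"
    proof -
      have "f (x + t *\<^sub>R u + t *\<^sub>R v) - f (x + t *\<^sub>R u) - f (x + t *\<^sub>R v) + f x
          = t * (F (x + z *\<^sub>R u + t *\<^sub>R v) u - F (x + z *\<^sub>R u) u)"
        using z(3) by (simp add: g_def)
      then show ?thesis using t by (simp add: power2_eq_square)
    qed
    ultimately show ?thesis using e by (simp add: dist_real_def)
  qed
  then show "\<forall>\<^sub>F t in at_right 0. dist ((f (x + t *\<^sub>R u + t *\<^sub>R v) - f (x + t *\<^sub>R u) - f (x + t *\<^sub>R v) + f x) / t\<^sup>2) (A v) < e"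
    using d unfolding eventually_at_right_field by auto
qed

text \<open>The second difference does not change when u and v are exchanged, so \<open>A v\<close>
  and \<open>B u\<close> are limits of the same quotient.\<close>

lemma second_derivative_symmetric:
  fixes f :: "'e::real_normed_vector \<Rightarrow> real"
  assumes "open S" "x \<in> S" "\<And>y. y \<in> S \<Longrightarrow> (f has_derivative F y) (at y)"
    and "((\<lambda>y. F y u) has_derivative A) (at x)" "((\<lambda>y. F y v) has_derivative B) (at x)"
  shows "A v = B u"
proof -
  have "((\<lambda>t. (f (x + t *\<^sub>R u + t *\<^sub>R v) - f (x + t *\<^sub>R u) - f (x + t *\<^sub>R v) + f x) / t\<^sup>2)
      \<longlongrightarrow> B u) (at_right 0)"
    using second_difference_tendsto[OF assms(1-3,5), of u] by (simp add: algebra_simps)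
  then show ?thesis
    using second_difference_tendsto[OF assms(1-4), of v] tendsto_unique trivial_limit_at_right_real
    by blast
qed

section \<open>The Poincare lemma on a convex set, by the radial homotopy operator\<close>

definition radial_primitive ::
    "'e::real_normed_vector \<Rightarrow> ('e \<Rightarrow> 'e \<Rightarrow> real) \<Rightarrow> 'e \<Rightarrow> real" where
  "radial_primitive c a x = integral {0..1} (\<lambda>t. a (c + t *\<^sub>R (x - c)) (x - c))"

text \<open>Differentiation under the integral produces the integrand \<open>L x t u\<close>.
  Symmetry of \<open>D\<close> turns its first term into a derivative along the ray, so
  \<open>L x t u\<close> is the t-derivative of \<open>t * a (z x t) u\<close>, and the integral is
  the boundary value \<open>a x u\<close> at t = 1.\<close>

lemma has_derivative_radial_primitive:
  fixes a :: "real ^ 'n::finite \<Rightarrow> real ^ 'n \<Rightarrow> real"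
  assumes S: "open S" "convex S" "c \<in> S" "x \<in> S"
    and lin: "\<And>y. y \<in> S \<Longrightarrow> linear (a y)"
    and D: "\<And>y v. y \<in> S \<Longrightarrow> ((\<lambda>y. a y v) has_derivative (\<lambda>u. D y u v)) (at y)"
    and cont: "\<And>u v. continuous_on S (\<lambda>y. D y u v)"
    and sym: "\<And>y u v. y \<in> S \<Longrightarrow> D y u v = D y v u"
  shows "(radial_primitive c a has_derivative a x) (at x)"
proof -
  define z where "z y t = c + t *\<^sub>R (y - c)" for y :: "real ^ 'n" and t :: real
  have z: "z y t \<in> S" if "y \<in> S" "t \<in> {0..1}" for y t
  proof -
    have "z y t = (1 - t) *\<^sub>R c + t *\<^sub>R y" by (simp add: z_def algebra_simps)
    then show ?thesis using S that by (simp add: convex_def)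
  qed
  have contz: "continuous_on T (\<lambda>q. z (fst q) (snd q))" for T
    unfolding z_def by (intro continuous_intros)
  have linD: "linear (\<lambda>u. D y u v)" if "y \<in> S" for y v
    using D[OF that] has_derivative_linear by blast
  define L where "L y t u = t * D (z y t) u (y - c) + a (z y t) u" for y t u
  have linL: "linear (L y t)" if "y \<in> S" "t \<in> {0..1}" for y t
    using linD[OF z[OF that]] lin[OF z[OF that]]
    unfolding L_def linear_iff by (simp add: algebra_simps)
  \<comment> \<open>The Leibniz rule for integrals takes the derivative as a bounded linear operator
    depending continuously on (y, t). In finite dimension this continuity can be checked on each
    fixed vector.\<close>
  define fx where "fx y t = Blinfun (L y t)" for y t
  have fx: "blinfun_apply (fx y t) = L y t" if "y \<in> S" "t \<in> {0..1}" for y t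
    unfolding fx_def using linL[OF that]
    by (simp add: bounded_linear_Blinfun_apply linear_conv_bounded_linear)
  have conta: "continuous_on S (\<lambda>y. a y v)" for v
    using D has_derivative_continuous by (intro continuous_at_imp_continuous_on) blast
  \<comment> \<open>\<open>D\<close> is known to be continuous only for fixed vectors, while y - c
    moves with y. Symmetry moves y - c into the argument in which \<open>D\<close> is linear, where
    it can be expanded in the basis.\<close>
  have contL: "continuous_on (S \<times> {0..1}) (\<lambda>q. L (fst q) (snd q) u)" for u
  proof -
    have "continuous_on (S \<times> {0..1}) (\<lambda>q. snd q * (\<Sum>j\<in>UNIV. (fst q - c) $ j * D (z (fst q) (snd q)) (axis j 1) u) +
        a (z (fst q) (snd q)) u)"
      by (intro continuous_intros continuous_on_compose2[OF cont contz] continuous_on_compose2[OF conta contz])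
        (auto intro: z)
    moreover have "L (fst q) (snd q) u = snd q * (\<Sum>j\<in>UNIV. (fst q - c) $ j * D (z (fst q) (snd q)) (axis j 1) u) +
        a (z (fst q) (snd q)) u" if q: "q \<in> S \<times> {0..1}" for q
    proof -
      have zq: "z (fst q) (snd q) \<in> S" using q by (auto intro: z)
      show ?thesis unfolding L_def sym[OF zq, of u] using linear_expand_axis[OF linD[OF zq]] by metis
    qed
    ultimately show ?thesis by (simp cong: continuous_on_cong)
  qed
  have der: "((\<lambda>y. a (z y t) (y - c)) has_derivative blinfun_apply (fx y t)) (at y within S)"
    if y: "y \<in> S" and t: "t \<in> cbox 0 1" for y t
  proof -
    have t': "t \<in> {0..1}" using t by simp
    have "((\<lambda>y. a (z y t) v) has_derivative (\<lambda>u. D (z y t) (t *\<^sub>R u) v)) (at y)" for v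
    proof -
      have "((\<lambda>y. z y t) has_derivative (\<lambda>u. t *\<^sub>R u)) (at y)"
        unfolding z_def by (auto intro!: derivative_eq_intros)
      from has_derivative_compose[OF this D[OF z[OF y t']]] show ?thesis .
    qed
    moreover have "((\<lambda>y. y - c) has_derivative (\<lambda>u. u)) (at y)"
      by (auto intro!: derivative_eq_intros)
    ultimately have "((\<lambda>y. a (z y t) (y - c)) has_derivative
        (\<lambda>u. D (z y t) (t *\<^sub>R u) (y - c) + a (z y t) u)) (at y)"
      using has_derivative_linear_field[OF S(1) y, of "\<lambda>y. a (z y t)" "\<lambda>u. D (z y t) (t *\<^sub>R u)" "\<lambda>y. y - c" "\<lambda>u. u"]
        lin z[OF _ t'] by blast
    then show ?thesis
      unfolding fx[OF y t'] L_def using linear_cmul[OF linD[OF z[OF y t']]]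
      by (simp add: has_derivative_at_withinI)
  qed
  have contfx: "continuous_on (S \<times> cbox 0 1) (\<lambda>(y, t). fx y t)"
  proof (rule continuous_on_blinfun_componentwise)
    fix i :: "real ^ 'n"
    have "continuous_on (S \<times> cbox 0 1) (\<lambda>q. L (fst q) (snd q) i)" using contL by simp
    then show "continuous_on (S \<times> cbox 0 1) (\<lambda>q. blinfun_apply (case q of (y, t) \<Rightarrow> fx y t) i)"
      by (rule continuous_on_eq) (auto simp: fx)
  qed
  have intg: "(\<lambda>t. a (z y t) (y - c)) integrable_on cbox 0 1" if y: "y \<in> S" for y
  proof (rule integrable_continuous)
    have "continuous_on (cbox 0 1) (\<lambda>t. z y t)" unfolding z_def by (intro continuous_intros)
    then show "continuous_on (cbox 0 1) (\<lambda>t. a (z y t) (y - c))"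
      using z[OF y] by (intro continuous_on_compose2[OF conta]) auto
  qed
  have "((\<lambda>y. integral (cbox 0 1) (\<lambda>t. a (z y t) (y - c))) has_derivative
      blinfun_apply (integral (cbox 0 1) (fx x))) (at x within S)"
    using leibniz_rule[OF der intg contfx S(4,2)] by blast
  moreover have "blinfun_apply (integral (cbox 0 1) (fx x)) u = a x u" for u
  proof -
    have "continuous_on (cbox 0 1) (fx x)"
    proof -
      have "continuous_on (cbox 0 1) (\<lambda>t. (x, t :: real))" by (intro continuous_intros)
      from continuous_on_compose2[OF contfx this] show ?thesis using S(4) by auto
    qed
    then have fxi: "fx x integrable_on cbox 0 1" by (rule integrable_continuous)
    have "blinfun_apply (integral (cbox 0 1) (fx x)) u = integral (cbox 0 1) (\<lambda>t. fx x t u)"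
      by (rule blinfun_apply_integral[OF fxi])
    also have "\<dots> = integral {0..1} (\<lambda>t. L x t u)" using fx[OF S(4)] by (auto intro: integral_cong)
    also have "((\<lambda>t. L x t u) has_integral (1 * a (z x 1) u - 0 * a (z x 0) u)) {0..1}"
    proof (rule fundamental_theorem_of_calculus)
      fix t :: real assume t: "t \<in> {0..1}"
      have zt: "z x t \<in> S" using z[OF S(4) t] .
      have "((\<lambda>t. a (z x t) u) has_derivative (\<lambda>h. D (z x t) (h *\<^sub>R (x - c)) u)) (at t)"
      proof -
        have "((\<lambda>t. z x t) has_derivative (\<lambda>h. h *\<^sub>R (x - c))) (at t)"
          unfolding z_def by (auto intro!: derivative_eq_intros)
        from has_derivative_compose[OF this D[OF zt]] show ?thesis .
      qed
      then have "((\<lambda>t. t * a (z x t) u) has_derivative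
          (\<lambda>h. t * D (z x t) (h *\<^sub>R (x - c)) u + h * a (z x t) u)) (at t)"
        by (intro has_derivative_mult has_derivative_ident)
      then have "((\<lambda>t. t * a (z x t) u) has_vector_derivative L x t u) (at t)"
        unfolding has_vector_derivative_def L_def sym[OF zt, of u]
        by (elim has_derivative_eq_rhs)
          (simp add: fun_eq_iff linear_cmul[OF linD[OF zt]] distrib_left mult.left_commute)
      then show "((\<lambda>t. t * a (z x t) u) has_vector_derivative L x t u) (at t within {0..1})"
        by (rule has_vector_derivative_at_within)
    qed simp
    then have "integral {0..1} (\<lambda>t. L x t u) = a x u" by (simp add: integral_unique z_def)
    finally show ?thesis .
  qed
  ultimately have "((\<lambda>y. integral (cbox 0 1) (\<lambda>t. a (z y t) (y - c))) has_derivative a x) (at x within S)"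
    by (elim has_derivative_eq_rhs) (simp add: fun_eq_iff)
  then show ?thesis
    unfolding radial_primitive_def[abs_def] z_def at_within_open[OF S(4,1)] by simp
qed

section \<open>Charts and changes of coordinates\<close>

locale smooth_manifold =
  fixes A :: "('a::{t2_space,second_countable_topology}, 'n::finite) chart set"
  assumes atlas: "smooth_atlas A"
begin

lemma homeo: "c \<in> A \<Longrightarrow> homeomorphism (chart_dom c) (chart_img c) (chart_map c) (chart_inv c)"
  using atlas by (auto simp: smooth_atlas_def)

lemma open_dom: "c \<in> A \<Longrightarrow> open (chart_dom c)"
  and open_img: "c \<in> A \<Longrightarrow> open (chart_img c)"
  using atlas by (auto simp: smooth_atlas_def)

lemma chart_inv_map [simp]: "c \<in> A \<Longrightarrow> p \<in> chart_dom c \<Longrightarrow> chart_inv c (chart_map c p) = p"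
  using homeo homeomorphism_apply1 by metis

lemma chart_map_inv [simp]: "c \<in> A \<Longrightarrow> x \<in> chart_img c \<Longrightarrow> chart_map c (chart_inv c x) = x"
  using homeo homeomorphism_apply2 by metis

lemma chart_inv_dom [simp]: "c \<in> A \<Longrightarrow> x \<in> chart_img c \<Longrightarrow> chart_inv c x \<in> chart_dom c"
  by auto

lemma continuous_chart_map: "c \<in> A \<Longrightarrow> continuous_on (chart_dom c) (chart_map c)"
  and continuous_chart_inv: "c \<in> A \<Longrightarrow> continuous_on (chart_img c) (chart_inv c)"
  using homeo homeomorphism_cont1 homeomorphism_cont2 by metis+

lemma chart_map_image_eq:
  "c \<in> A \<Longrightarrow> W \<subseteq> chart_dom c \<Longrightarrow> chart_map c ` W = chart_inv c -` W \<inter> chart_img c"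
  by (force simp: subset_iff)

lemma chart_inv_image_eq:
  "c \<in> A \<Longrightarrow> V \<subseteq> chart_img c \<Longrightarrow> chart_inv c ` V = chart_map c -` V \<inter> chart_dom c"
proof safe
  fix x assume x: "c \<in> A" "V \<subseteq> chart_img c" "x \<in> V"
  then show "chart_inv c x \<in> chart_map c -` V" "chart_inv c x \<in> chart_dom c"
    by (auto simp: subsetD)
next
  fix p assume "c \<in> A" "chart_map c p \<in> V" "p \<in> chart_dom c"
  then show "p \<in> chart_inv c ` V" by (metis chart_inv_map imageI)
qed

lemma open_chart_map_image: "c \<in> A \<Longrightarrow> open W \<Longrightarrow> W \<subseteq> chart_dom c \<Longrightarrow> open (chart_map c ` W)"
  using continuous_open_preimage[OF continuous_chart_inv open_img, of c W]
  by (subst chart_map_image_eq) (simp_all add: Int_commute)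

lemma open_chart_inv_image: "c \<in> A \<Longrightarrow> open V \<Longrightarrow> V \<subseteq> chart_img c \<Longrightarrow> open (chart_inv c ` V)"
  using continuous_open_preimage[OF continuous_chart_map open_dom, of c V]
  by (subst chart_inv_image_eq) (simp_all add: Int_commute)

lemma chart_at: "chart_at A p \<in> A" "p \<in> chart_dom (chart_at A p)"
proof -
  have "\<exists>c. c \<in> A \<and> p \<in> chart_dom c" using atlas unfolding smooth_atlas_def by blast
  from someI_ex[OF this] show "chart_at A p \<in> A" "p \<in> chart_dom (chart_at A p)"
    by (auto simp: chart_at_def)
qed

lemma transition_smooth:
  "c \<in> A \<Longrightarrow> c' \<in> A \<Longrightarrow>
    smooth_on (chart_map c' \<circ> chart_inv c) (chart_map c ` (chart_dom c \<inter> chart_dom c'))"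
  using atlas by (auto simp: smooth_atlas_def)

lemma open_overlap:
  "c \<in> A \<Longrightarrow> c' \<in> A \<Longrightarrow> open (chart_map c ` (chart_dom c \<inter> chart_dom c'))"
  by (intro open_chart_map_image) (auto intro: open_dom)

lemma transition_has_derivative:
  assumes "c \<in> A" "c' \<in> A" "p \<in> chart_dom c" "p \<in> chart_dom c'"
  shows "((chart_map c' \<circ> chart_inv c) has_derivative tangent_change c c' p) (at (chart_map c p))"
  unfolding tangent_change_def
  by (rule smooth_on_has_derivative[OF transition_smooth[OF assms(1,2)]]) (use assms in auto)

lemma tangent_change_linear:
  assumes "c \<in> A" "c' \<in> A" "p \<in> chart_dom c" "p \<in> chart_dom c'"
  shows "linear (tangent_change c c' p)"
  using transition_has_derivative[OF assms] has_derivative_linear by blast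

lemma tangent_change_refl:
  assumes "c \<in> A" "p \<in> chart_dom c"
  shows "tangent_change c c p = (\<lambda>v. v)"
proof -
  have "((chart_map c \<circ> chart_inv c) has_derivative (\<lambda>v. v)) (at (chart_map c p))"
    by (rule has_derivative_transform_within_open[OF has_derivative_ident open_img[OF assms(1)]])
      (use assms in auto)
  then show ?thesis
    using transition_has_derivative[OF assms(1,1,2,2)] has_derivative_unique by blast
qed

lemma tangent_change_trans:
  assumes "c \<in> A" "c' \<in> A" "c'' \<in> A" "p \<in> chart_dom c" "p \<in> chart_dom c'" "p \<in> chart_dom c''"
  shows "tangent_change c' c'' p (tangent_change c c' p v) = tangent_change c c'' p v"
proof -
  let ?S = "chart_map c ` (chart_dom c \<inter> chart_dom c')"
  have "((chart_map c'' \<circ> chart_inv c') has_derivative tangent_change c' c'' p)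
      (at ((chart_map c' \<circ> chart_inv c) (chart_map c p)))"
    using transition_has_derivative[OF assms(2,3,5,6)] assms by simp
  from diff_chain_at[OF transition_has_derivative[OF assms(1,2,4,5)] this]
  have "((chart_map c'' \<circ> chart_inv c') \<circ> (chart_map c' \<circ> chart_inv c) has_derivative
      tangent_change c' c'' p \<circ> tangent_change c c' p) (at (chart_map c p))" .
  then have "((chart_map c'' \<circ> chart_inv c) has_derivative
      tangent_change c' c'' p \<circ> tangent_change c c' p) (at (chart_map c p))"
    by (rule has_derivative_transform_within_open[OF _ open_overlap[OF assms(1,2)]])
      (use assms in auto)
  from has_derivative_unique[OF this transition_has_derivative[OF assms(1,3,4,6)]]
  show ?thesis by (metis comp_apply)
qed

section \<open>Local representations of forms and vector fields\<close>

lemma local1_change: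
  assumes "c \<in> A" "c' \<in> A" "p \<in> chart_dom c" "p \<in> chart_dom c'"
  shows "local1 A c \<alpha> (chart_map c p) v = local1 A c' \<alpha> (chart_map c' p) (tangent_change c c' p v)"
  using assms by (simp add: local1_def Let_def tangent_change_trans chart_at)

text \<open>Values at p are by convention expressed in the chart preferred at p, so at this one
  point no change of coordinates occurs. Neighbouring points may prefer other charts.\<close>

lemma local1_chart_at: "local1 A (chart_at A p) \<alpha> (chart_map (chart_at A p) p) = \<alpha> p"
  by (rule ext) (simp add: local1_def Let_def tangent_change_refl chart_at)

lemma local2_chart_at: "local2 A (chart_at A p) \<omega> (chart_map (chart_at A p) p) = \<omega> p"
  by (intro ext) (simp add: local2_def Let_def tangent_change_refl chart_at)

lemma local_vfield_chart_at: "local_vfield A (chart_at A p) X (chart_map (chart_at A p) p) = X p"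
  by (simp add: local_vfield_def Let_def tangent_change_refl chart_at)

lemma tangent_change_local_vfield:
  assumes "c \<in> A" "x \<in> chart_img c"
  shows "tangent_change c (chart_at A (chart_inv c x)) (chart_inv c x) (local_vfield A c X x) = X (chart_inv c x)"
  using assms by (simp add: local_vfield_def Let_def tangent_change_trans tangent_change_refl chart_at)

lemma local1_interior2:
  assumes "c \<in> A" "x \<in> chart_img c"
  shows "local1 A c (interior2 X \<omega>) x v = local2 A c \<omega> x (local_vfield A c X x) v"
  using tangent_change_local_vfield[OF assms]
  by (simp add: local1_def local2_def Let_def interior2_def)

lemma local1_vfield:
  assumes "c \<in> A" "x \<in> chart_img c"
  shows "local1 A c \<alpha> x (local_vfield A c X x) = \<alpha> (chart_inv c x) (X (chart_inv c x))"
  using tangent_change_local_vfield[OF assms] by (simp add: local1_def Let_def)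

lemma linear_local1:
  assumes "form1 A \<alpha>" "c \<in> A" "x \<in> chart_img c"
  shows "linear (local1 A c \<alpha> x)"
proof -
  have "linear (\<alpha> (chart_inv c x) \<circ> tangent_change c (chart_at A (chart_inv c x)) (chart_inv c x))"
    using assms by (intro linear_compose tangent_change_linear) (auto simp: form1_def chart_at)
  then show ?thesis by (simp add: local1_def[abs_def] Let_def comp_def)
qed

lemma smooth_local1: "form1 A \<alpha> \<Longrightarrow> c \<in> A \<Longrightarrow> smooth_on (\<lambda>x. local1 A c \<alpha> x v) (chart_img c)"
  by (simp add: form1_def)

lemma bilinear_local2:
  assumes "tensor2 A \<omega>" "c \<in> A" "x \<in> chart_img c"
  shows "bilinear (local2 A c \<omega> x)"
proof -
  let ?T = "tangent_change c (chart_at A (chart_inv c x)) (chart_inv c x)"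
  have T: "linear ?T" using assms by (intro tangent_change_linear) (auto simp: chart_at)
  have w: "bilinear (\<omega> (chart_inv c x))" using assms(1) by (auto simp: tensor2_def)
  show ?thesis
    unfolding bilinear_def
    by (auto simp: local2_def Let_def linear_iff linear_add[OF T] linear_cmul[OF T]
        bilinear_ladd[OF w] bilinear_radd[OF w] bilinear_lmul[OF w] bilinear_rmul[OF w])
qed

lemma smooth_local2:
  "tensor2 A \<omega> \<Longrightarrow> c \<in> A \<Longrightarrow> smooth_on (\<lambda>x. local2 A c \<omega> x u v) (chart_img c)"
  by (simp add: tensor2_def)

text \<open>Closedness of \<open>\<alpha>\<close> only speaks about the derivatives at \<open>p\<close> in the chart preferred at \<open>p\<close>.
  In another chart the second derivatives of the transition map enter, and cancel by their symmetry.\<close>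

lemma closed1_symmetric:
  assumes "\<alpha> \<in> closed1 A" and c: "c \<in> A" and x: "x \<in> chart_img c"
  shows "frechet_derivative (\<lambda>y. local1 A c \<alpha> y v) (at x) u = frechet_derivative (\<lambda>y. local1 A c \<alpha> y u) (at x) v"
proof -
  have form: "form1 A \<alpha>" and closed: "\<And>p u v. ext_d1 A \<alpha> p u v = 0"
    using assms(1) by (auto simp: closed1_def)
  define p where "p = chart_inv c x"
  define c' where "c' = chart_at A p"
  define W where "W = chart_map c ` (chart_dom c \<inter> chart_dom c')"
  define \<phi> where "\<phi> = chart_map c' \<circ> chart_inv c"
  define D where "D = (\<lambda>y. frechet_derivative \<phi> (at y))"
  have c': "c' \<in> A" by (simp add: c'_def chart_at)
  have p: "p \<in> chart_dom c" "p \<in> chart_dom c'" "chart_map c p = x" "\<phi> x = chart_map c' p"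
    using c x by (auto simp: p_def c'_def chart_at \<phi>_def)
  have W: "open W" "x \<in> W" using open_overlap[OF c c'] p by (auto simp: W_def)
  have smooth: "smooth_on \<phi> W" using transition_smooth[OF c c'] by (simp add: \<phi>_def W_def)
  have D\<phi>: "(\<phi> has_derivative D y) (at y)" if "y \<in> W" for y
    using smooth_on_has_derivative[OF smooth that] by (simp add: D_def)
  define a where "a = local1 A c' \<alpha>"
  define a' where "a' = (\<lambda>v. frechet_derivative (\<lambda>y. a y v) (at (chart_map c' p)))"
  have \<phi>W: "\<phi> y \<in> chart_img c'" if "y \<in> W" for y using that c by (auto simp: W_def \<phi>_def)
  have a: "((\<lambda>y. a y v) has_derivative a' v) (at (\<phi> x))" for v
    unfolding a'_def a_def p(4)
    by (rule smooth_on_has_derivative[OF smooth_local1[OF form c']]) (use p in auto)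
  have loc: "local1 A c \<alpha> y v = a (\<phi> y) (D y v)" if "y \<in> W" for y v
  proof -
    from that obtain q where q: "q \<in> chart_dom c" "q \<in> chart_dom c'" "y = chart_map c q"
      by (auto simp: W_def)
    then show ?thesis
      using local1_change[OF c c' q(1,2)] c by (simp add: a_def \<phi>_def D_def tangent_change_def)
  qed
  have DD: "((\<lambda>y. D y v) has_derivative frechet_derivative (\<lambda>y. D y v) (at x)) (at x)" for v
    unfolding D_def using smooth_on_has_derivative[OF smooth_on_frechet[OF smooth] W(2)] .
  define B where "B = (\<lambda>v. frechet_derivative (\<lambda>y. D y v) (at x))"
  have lin: "linear (a (\<phi> y))" if "y \<in> W" for y
    unfolding a_def using linear_local1[OF form c' \<phi>W[OF that]] .
  have main: "frechet_derivative (\<lambda>y. local1 A c \<alpha> y v) (at x) u = a' (D x v) (D x u) + a (\<phi> x) (B v u)" for u v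
  proof -
    have "((\<lambda>y. a (\<phi> y) (D y v)) has_derivative (\<lambda>u. a' (D x v) (D x u) + a (\<phi> x) (B v u))) (at x)"
    proof (rule has_derivative_linear_field[OF W])
      show "((\<lambda>y. a (\<phi> y) w) has_derivative (\<lambda>u. a' w (D x u))) (at x)" for w
        using has_derivative_compose[OF D\<phi>[OF W(2)] a] by (simp add: D_def)
    qed (use lin DD B_def in auto)
    then have "((\<lambda>y. local1 A c \<alpha> y v) has_derivative (\<lambda>u. a' (D x v) (D x u) + a (\<phi> x) (B v u))) (at x)"
      by (rule has_derivative_transform_within_open[OF _ W]) (simp add: loc)
    from frechet_derivative_at[OF this] show ?thesis by metis
  qed
  \<comment> \<open>With the linear form frozen at \<phi>(x), both sides are second derivatives of
    the real function y \<mapsto> \<open>a (\<phi> x) (\<phi> y)\<close>.\<close>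
  have "a (\<phi> x) (B v u) = a (\<phi> x) (B u v)" for u v
  proof -
    have l: "bounded_linear (a (\<phi> x))" using lin[OF W(2)] by (simp add: linear_conv_bounded_linear)
    show ?thesis
    proof (rule second_derivative_symmetric[OF W, where A = "\<lambda>w. a (\<phi> x) (B v w)" and B = "\<lambda>w. a (\<phi> x) (B u w)"])
      show "((\<lambda>y. a (\<phi> x) (\<phi> y)) has_derivative (\<lambda>v. a (\<phi> x) (D y v))) (at y)" if "y \<in> W" for y
        by (rule bounded_linear.has_derivative[OF l D\<phi>[OF that]])
    qed (use bounded_linear.has_derivative[OF l DD] in \<open>simp_all add: B_def\<close>)
  qed
  moreover have "a' (D x v) (D x u) = a' (D x u) (D x v)"
    using closed[of p "D x u" "D x v"]
    by (simp add: ext_d1_def pderiv_at_def Let_def a'_def a_def c'_def)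
  ultimately show ?thesis using main by metis
qed

end

section \<open>Primitives of closed forms\<close>

lemma frechet_derivative_add:
  "f differentiable (at x) \<Longrightarrow> g differentiable (at x) \<Longrightarrow>
    frechet_derivative (\<lambda>x. f x + g x) (at x) v = frechet_derivative f (at x) v + frechet_derivative g (at x) v"
  using fun_cong[OF frechet_derivative_at[OF has_derivative_add[of f _ "at x" g]], symmetric]
  by (simp add: frechet_derivative_works)

lemma frechet_derivative_cmult:
  fixes f :: "'a::real_normed_vector \<Rightarrow> real"
  shows "f differentiable (at x) \<Longrightarrow>
    frechet_derivative (\<lambda>x. r * f x) (at x) v = r * frechet_derivative f (at x) v"
  using fun_cong[OF frechet_derivative_at[OF has_derivative_mult_right[of f _ "at x" r]], symmetric]
  by (simp add: frechet_derivative_works)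

lemma local1_add: "local1 A c (\<alpha> + \<beta>) x v = local1 A c \<alpha> x v + local1 A c \<beta> x v"
  by (simp add: local1_def Let_def)

lemma local1_scale1: "local1 A c (scale1 r \<alpha>) x v = r * local1 A c \<alpha> x v"
  by (simp add: local1_def Let_def scale1_def)

lemma local1_zero: "local1 A c 0 x v = 0"
  by (simp add: local1_def Let_def)

lemma radial_primitive_add:
  fixes a b :: "real ^ 'n::finite \<Rightarrow> real ^ 'n \<Rightarrow> real"
  assumes "convex S" "c \<in> S" "x \<in> S" "\<And>v. continuous_on S (\<lambda>y. a y v)" "\<And>v. continuous_on S (\<lambda>y. b y v)"
  shows "radial_primitive c (\<lambda>y v. a y v + b y v) x = radial_primitive c a x + radial_primitive c b x"
proof -
  have "continuous_on {0..1} (\<lambda>t. a (c + t *\<^sub>R (x - c)) (x - c))"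
    if "\<And>v. continuous_on S (\<lambda>y. a y v)" for a :: "real ^ 'n::finite \<Rightarrow> real ^ 'n \<Rightarrow> real"
  proof (rule continuous_on_compose2[OF that])
    show "(\<lambda>t. c + t *\<^sub>R (x - c)) ` {0..1} \<subseteq> S"
    proof clarify
      fix t :: real assume "t \<in> {0..1}"
      moreover have "c + t *\<^sub>R (x - c) = (1 - t) *\<^sub>R c + t *\<^sub>R x" by (simp add: algebra_simps)
      ultimately show "c + t *\<^sub>R (x - c) \<in> S" using assms(1-3) by (simp add: convex_def)
    qed
  qed (intro continuous_intros)
  from this[OF assms(4)] this[OF assms(5)] show ?thesis
    unfolding radial_primitive_def by (intro integral_add integrable_continuous_real)
qed

lemma radial_primitive_cmult:
  "radial_primitive c (\<lambda>y v. r * a y v) x = r * radial_primitive c a x"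
  by (simp add: radial_primitive_def)

context smooth_manifold
begin

text \<open>The relation df = \<alpha> at a single point. It makes sense for functions that are good
  only near p, such as local primitives; smoothness of f is recovered afterwards from that of
  \<alpha>.\<close>

definition has_differential :: "('a \<Rightarrow> real) \<Rightarrow> ('a, 'n) field1 \<Rightarrow> 'a \<Rightarrow> bool" where
  "has_differential f \<alpha> p \<longleftrightarrow> (\<forall>c\<in>A. p \<in> chart_dom c \<longrightarrow>
    ((f \<circ> chart_inv c) has_derivative local1 A c \<alpha> (chart_map c p)) (at (chart_map c p)))"

text \<open>One chart around p suffices: the chain rule along the transition map carries the
  derivative to every other chart, where the form transforms in the same way.\<close>

lemma has_differentialI:
  assumes "c \<in> A" "p \<in> chart_dom c"
    and "((f \<circ> chart_inv c) has_derivative local1 A c \<alpha> (chart_map c p)) (at (chart_map c p))"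
  shows "has_differential f \<alpha> p"
  unfolding has_differential_def
proof (intro ballI impI)
  fix c' assume c': "c' \<in> A" "p \<in> chart_dom c'"
  have "((f \<circ> chart_inv c) has_derivative local1 A c \<alpha> (chart_map c p))
      (at ((chart_map c \<circ> chart_inv c') (chart_map c' p)))"
    using assms c' by simp
  from diff_chain_at[OF transition_has_derivative[OF c'(1) assms(1) c'(2) assms(2)] this]
  have "((f \<circ> chart_inv c) \<circ> (chart_map c \<circ> chart_inv c') has_derivative
      local1 A c \<alpha> (chart_map c p) \<circ> tangent_change c' c p) (at (chart_map c' p))" .
  then have "((f \<circ> chart_inv c') has_derivative
      local1 A c \<alpha> (chart_map c p) \<circ> tangent_change c' c p) (at (chart_map c' p))"
    by (rule has_derivative_transform_within_open[OF _ open_overlap[OF c'(1) assms(1)]])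
      (use assms c' in auto)
  then show "((f \<circ> chart_inv c') has_derivative local1 A c' \<alpha> (chart_map c' p)) (at (chart_map c' p))"
    by (rule has_derivative_eq_rhs)
      (simp add: fun_eq_iff local1_change[OF c'(1) assms(1) c'(2) assms(2)])
qed

lemma has_differentialD:
  "has_differential f \<alpha> p \<Longrightarrow> c \<in> A \<Longrightarrow> p \<in> chart_dom c \<Longrightarrow>
    ((f \<circ> chart_inv c) has_derivative local1 A c \<alpha> (chart_map c p)) (at (chart_map c p))"
  by (simp add: has_differential_def)

lemma has_differential_cong:
  assumes "open W" "p \<in> W" "\<And>q. q \<in> W \<Longrightarrow> f q = g q" "has_differential f \<alpha> p"
  shows "has_differential g \<alpha> p"
proof (rule has_differentialI[OF chart_at])
  let ?c = "chart_at A p"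
  have o: "open (chart_map ?c ` (W \<inter> chart_dom ?c))"
    by (intro open_chart_map_image) (auto intro: assms open_dom chart_at)
  have c: "?c \<in> A" by (rule chart_at)
  show "((g \<circ> chart_inv ?c) has_derivative local1 A ?c \<alpha> (chart_map ?c p)) (at (chart_map ?c p))"
    by (rule has_derivative_transform_within_open[OF has_differentialD[OF assms(4) chart_at] o])
      (use assms chart_at in \<open>auto simp: chart_inv_map[OF c]\<close>)
qed

lemma has_differential_add:
  assumes "has_differential f \<alpha> p" "has_differential g \<beta> p"
  shows "has_differential (\<lambda>q. f q + g q) (\<alpha> + \<beta>) p"
  unfolding has_differential_def
proof (intro ballI impI)
  fix c assume c: "c \<in> A" "p \<in> chart_dom c"
  from has_derivative_add[OF has_differentialD[OF assms(1) c] has_differentialD[OF assms(2) c]]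
  show "((\<lambda>q. f q + g q) \<circ> chart_inv c has_derivative local1 A c (\<alpha> + \<beta>) (chart_map c p)) (at (chart_map c p))"
    by (simp add: comp_def local1_add[abs_def])
qed

lemma has_differential_cmult:
  assumes "has_differential f \<alpha> p"
  shows "has_differential (\<lambda>q. r * f q) (scale1 r \<alpha>) p"
  unfolding has_differential_def
proof (intro ballI impI)
  fix c assume c: "c \<in> A" "p \<in> chart_dom c"
  from has_derivative_mult_right[OF has_differentialD[OF assms(1) c]]
  show "((\<lambda>q. r * f q) \<circ> chart_inv c has_derivative local1 A c (scale1 r \<alpha>) (chart_map c p)) (at (chart_map c p))"
    by (simp add: comp_def local1_scale1[abs_def])
qed

lemma has_differential_diff:
  assumes "has_differential f \<alpha> p" "has_differential g \<alpha> p"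
  shows "has_differential (\<lambda>q. f q - g q) 0 p"
  unfolding has_differential_def
proof (intro ballI impI)
  fix c assume c: "c \<in> A" "p \<in> chart_dom c"
  from has_derivative_diff[OF has_differentialD[OF assms(1) c] has_differentialD[OF assms(2) c]]
  show "((\<lambda>q. f q - g q) \<circ> chart_inv c has_derivative local1 A c 0 (chart_map c p)) (at (chart_map c p))"
    by (simp add: comp_def local1_zero[abs_def])
qed

lemma has_differential_ext_d0:
  assumes "smooth_fun A f"
  shows "has_differential f (ext_d0 A f) p"
proof (rule has_differentialI[OF chart_at])
  let ?c = "chart_at A p"
  have "smooth_on (f \<circ> chart_inv ?c) (chart_img ?c)" using assms chart_at by (auto simp: smooth_fun_def)
  from smooth_on_has_derivative[OF this, of "chart_map ?c p"]
  show "((f \<circ> chart_inv ?c) has_derivative local1 A ?c (ext_d0 A f) (chart_map ?c p)) (at (chart_map ?c p))"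
    by (simp add: local1_chart_at ext_d0_def[abs_def] pderiv_at_def chart_at)
qed

lemma has_differential_unique:
  assumes "\<And>p. has_differential f \<alpha> p"
  shows "ext_d0 A f = \<alpha>"
proof (intro ext)
  fix p v
  show "ext_d0 A f p v = \<alpha> p v"
    using frechet_derivative_at[OF has_differentialD[OF assms chart_at, of p], symmetric]
    by (simp add: ext_d0_def pderiv_at_def local1_chart_at)
qed

text \<open>In a chart the derivative of f is the local representation of \<alpha>, which has smooth
  coefficients.\<close>

lemma smooth_fun_if_has_differential:
  assumes "form1 A \<alpha>" "\<And>p. has_differential f \<alpha> p"
  shows "smooth_fun A f"
  unfolding smooth_fun_def
proof
  fix c assume c: "c \<in> A"
  show "smooth_on (f \<circ> chart_inv c) (chart_img c)"
  proof (rule smooth_on_if_has_derivative[OF open_img[OF c]])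
    show "(f \<circ> chart_inv c has_derivative local1 A c \<alpha> x) (at x)" if "x \<in> chart_img c" for x
      using has_differentialD[OF assms(2) c, of "chart_inv c x"] c that by simp
  qed (rule smooth_local1[OF assms(1) c])
qed

lemma exact1_iff:
  assumes "form1 A \<alpha>"
  shows "\<alpha> \<in> exact1 A \<longleftrightarrow> (\<exists>f. \<forall>p. has_differential f \<alpha> p)"
  unfolding exact1_def
  using has_differential_ext_d0 has_differential_unique smooth_fun_if_has_differential[OF assms]
  by blast

lemma small_connected_neighbourhood:
  assumes "open W" "p \<in> W"
  obtains N c x r where "c \<in> A" "ball x r \<subseteq> chart_img c" "N = chart_inv c ` ball x r"
    "open N" "connected N" "p \<in> N" "N \<subseteq> W"
proof -
  let ?c = "chart_at A p"
  have c: "?c \<in> A" "p \<in> chart_dom ?c" by (rule chart_at)+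
  have o: "open (chart_map ?c ` (W \<inter> chart_dom ?c))"
    by (intro open_chart_map_image) (auto intro: assms open_dom c)
  have "chart_map ?c p \<in> chart_map ?c ` (W \<inter> chart_dom ?c)" using assms c by auto
  then obtain r where r: "r > 0" "ball (chart_map ?c p) r \<subseteq> chart_map ?c ` (W \<inter> chart_dom ?c)"
    using o openE by blast
  then have img: "ball (chart_map ?c p) r \<subseteq> chart_img ?c" by blast
  show ?thesis
  proof (rule that[OF c(1) img refl])
    show "open (chart_inv ?c ` ball (chart_map ?c p) r)"
      by (rule open_chart_inv_image[OF c(1) open_ball img])
    show "connected (chart_inv ?c ` ball (chart_map ?c p) r)"
      by (intro connected_continuous_image continuous_on_subset[OF continuous_chart_inv[OF c(1)] img] connected_ball)
    show "p \<in> chart_inv ?c ` ball (chart_map ?c p) r"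
      using r(1) c by (metis centre_in_ball chart_inv_map imageI)
    show "chart_inv ?c ` ball (chart_map ?c p) r \<subseteq> W"
      using r(2) chart_inv_map[OF c(1)] by fastforce
  qed
qed

text \<open>On a coordinate ball the derivative vanishes on a convex set, so f is constant there;
  being locally constant, f is constant on the connected set W.\<close>

lemma has_differential_0_imp_constant:
  assumes W: "open W" "connected W" "\<And>p. p \<in> W \<Longrightarrow> has_differential f 0 p" and "p \<in> W" "q \<in> W"
  shows "f p = f q"
proof (rule connected_local_const[OF W(2) assms(4,5)], intro ballI)
  fix a assume "a \<in> W"
  obtain N c x r where N: "c \<in> A" "ball x r \<subseteq> chart_img c" "N = chart_inv c ` ball x r"
    "open N" "connected N" "a \<in> N" "N \<subseteq> W"
    using small_connected_neighbourhood[OF W(1) \<open>a \<in> W\<close>] .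
  have "((f \<circ> chart_inv c) has_derivative (\<lambda>v. 0)) (at y within ball x r)" if y: "y \<in> ball x r" for y
  proof -
    have "chart_inv c y \<in> W" using N y by auto
    from has_differentialD[OF W(3)[OF this] N(1)] show ?thesis
      using N y by (auto simp: local1_zero[abs_def] subset_iff intro: has_derivative_at_withinI)
  qed
  from has_derivative_zero_constant[OF convex_ball this]
  obtain k where k: "\<And>y. y \<in> ball x r \<Longrightarrow> (f \<circ> chart_inv c) y = k" by blast
  have "f b = k" if "b \<in> N" for b using that k N by auto
  then show "eventually (\<lambda>b. f a = f b) (at a within W)"
    unfolding eventually_at_topological using N by auto
qed

section \<open>Closed and exact 1-forms as real vector spaces\<close>

lemma vector_space_scale1: "vector_space (scale1 :: real \<Rightarrow> ('a, 'n) field1 \<Rightarrow> ('a, 'n) field1)"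
  by unfold_locales (auto simp: scale1_def fun_eq_iff algebra_simps)

sublocale fields: vector_space "scale1 :: real \<Rightarrow> ('a, 'n) field1 \<Rightarrow> ('a, 'n) field1"
  by (rule vector_space_scale1)

lemma form1_0: "form1 A 0"
  unfolding form1_def local1_zero using smooth_on_const by (auto simp: linear_iff)

lemma form1_add: "form1 A \<alpha> \<Longrightarrow> form1 A \<beta> \<Longrightarrow> form1 A (\<alpha> + \<beta>)"
  unfolding form1_def local1_add
  by (auto intro!: smooth_on_add open_img simp: linear_iff algebra_simps)

lemma form1_scale1: "form1 A \<alpha> \<Longrightarrow> form1 A (scale1 r \<alpha>)"
  unfolding form1_def local1_scale1
  by (auto intro!: smooth_on_cmult open_img simp: scale1_def linear_iff algebra_simps)

lemma local1_differentiable: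
  "form1 A \<alpha> \<Longrightarrow> c \<in> A \<Longrightarrow> x \<in> chart_img c \<Longrightarrow> (\<lambda>x. local1 A c \<alpha> x v) differentiable (at x)"
  using smooth_local1 smooth_on_differentiable by blast

lemma subspace_closed1: "fields.subspace (closed1 A)"
proof (rule fields.subspaceI)
  show "0 \<in> closed1 A"
    by (simp add: closed1_def form1_0 ext_d1_def pderiv_at_def Let_def local1_zero)
next
  fix \<alpha> \<beta> assume ab: "\<alpha> \<in> closed1 A" "\<beta> \<in> closed1 A"
  then have f: "form1 A \<alpha>" "form1 A \<beta>" by (auto simp: closed1_def)
  have "ext_d1 A (\<alpha> + \<beta>) p u v = ext_d1 A \<alpha> p u v + ext_d1 A \<beta> p u v" for p u v
    unfolding ext_d1_def pderiv_at_def Let_def local1_add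
    by (simp add: frechet_derivative_add local1_differentiable f chart_at)
  with ab f show "\<alpha> + \<beta> \<in> closed1 A" by (simp add: closed1_def form1_add)
next
  fix r \<alpha> assume a: "\<alpha> \<in> closed1 A"
  then have f: "form1 A \<alpha>" by (auto simp: closed1_def)
  have "ext_d1 A (scale1 r \<alpha>) p u v = r * ext_d1 A \<alpha> p u v" for p u v
    unfolding ext_d1_def pderiv_at_def Let_def local1_scale1
    by (simp add: frechet_derivative_cmult local1_differentiable f chart_at right_diff_distrib)
  with a f show "scale1 r \<alpha> \<in> closed1 A" by (simp add: closed1_def form1_scale1)
qed

lemma subspace_exact1: "fields.subspace (exact1 A)"
proof (rule fields.subspaceI)
  have fun_form: "form1 A (ext_d0 A f)" if f: "smooth_fun A f" for f
    unfolding form1_def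
  proof (intro conjI allI ballI)
    fix p
    show "linear (ext_d0 A f p)"
      using has_derivative_linear[OF has_differentialD[OF has_differential_ext_d0[OF f] chart_at, of p]]
      by (simp add: local1_chart_at)
  next
    fix c v assume c: "c \<in> A"
    have "local1 A c (ext_d0 A f) x v = frechet_derivative (f \<circ> chart_inv c) (at x) v" if x: "x \<in> chart_img c" for x
      using frechet_derivative_at[OF has_differentialD[OF has_differential_ext_d0[OF f] c, of "chart_inv c x"]] c x
      by simp
    then show "smooth_on (\<lambda>x. local1 A c (ext_d0 A f) x v) (chart_img c)"
      using f c by (subst smooth_on_cong[OF open_img[OF c]]) (auto simp: smooth_fun_def intro: smooth_on_frechet)
  qed
  have exactI: "\<alpha> \<in> exact1 A" if "form1 A \<alpha>" "\<And>p. has_differential f \<alpha> p" for f \<alpha>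
    using exact1_iff that by blast
  have exactE: "\<exists>f. form1 A \<alpha> \<and> (\<forall>p. has_differential f \<alpha> p)" if "\<alpha> \<in> exact1 A" for \<alpha>
    using that fun_form has_differential_ext_d0 by (force simp: exact1_def)
  show "0 \<in> exact1 A"
    by (rule exactI[OF form1_0, of "\<lambda>_. 0"]) (simp add: has_differential_def comp_def local1_zero[abs_def])
  fix \<alpha> assume "\<alpha> \<in> exact1 A"
  then obtain f where f: "form1 A \<alpha>" "\<And>p. has_differential f \<alpha> p" using exactE by blast
  show "scale1 r \<alpha> \<in> exact1 A" for r
    by (rule exactI[OF form1_scale1[OF f(1)] has_differential_cmult[OF f(2)]])
  fix \<beta> assume "\<beta> \<in> exact1 A"
  then obtain g where g: "form1 A \<beta>" "\<And>p. has_differential g \<beta> p" using exactE by blast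
  show "\<alpha> + \<beta> \<in> exact1 A"
    by (rule exactI[OF form1_add[OF f(1) g(1)] has_differential_add[OF f(2) g(2)]])
qed

text \<open>An explicit integral instead of a chosen primitive, because it is linear in \<alpha>:
  differences of its values will serve as linear functionals on closed forms.\<close>

definition local_primitive :: "'a \<Rightarrow> ('a, 'n) field1 \<Rightarrow> 'a \<Rightarrow> real" where
  "local_primitive p \<alpha> q = (let c = chart_at A p in
    radial_primitive (chart_map c p) (local1 A c \<alpha>) (chart_map c q))"

lemma continuous_local1:
  "form1 A \<alpha> \<Longrightarrow> c \<in> A \<Longrightarrow> S \<subseteq> chart_img c \<Longrightarrow> continuous_on S (\<lambda>x. local1 A c \<alpha> x v)"
  using smooth_on_continuous[OF smooth_local1] continuous_on_subset by blast

context
  fixes p r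
  assumes r: "0 < r" "ball (chart_map (chart_at A p) p) r \<subseteq> chart_img (chart_at A p)"
begin

private abbreviation (input) "c \<equiv> chart_at A p"
private abbreviation (input) "B \<equiv> ball (chart_map (chart_at A p) p) r"

lemma has_differential_local_primitive:
  assumes "\<alpha> \<in> closed1 A" "q \<in> chart_inv c ` B"
  shows "has_differential (local_primitive p \<alpha>) \<alpha> q"
proof -
  have c: "c \<in> A" by (rule chart_at)
  have f: "form1 A \<alpha>" using assms(1) by (simp add: closed1_def)
  obtain x where x: "x \<in> B" "q = chart_inv c x" using assms(2) by blast
  have xi: "x \<in> chart_img c" using x r by blast
  have q: "q \<in> chart_dom c" "chart_map c q = x" using x c xi by auto
  have smooth: "smooth_on (\<lambda>y. local1 A c \<alpha> y v) B" for v
    using smooth_on_subset[OF smooth_local1[OF f c]] r(2) by blast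
  have "(radial_primitive (chart_map c p) (local1 A c \<alpha>) has_derivative local1 A c \<alpha> x) (at x)"
  proof (rule has_derivative_radial_primitive[OF open_ball convex_ball _ x(1),
        where D = "\<lambda>y u v. frechet_derivative (\<lambda>y. local1 A c \<alpha> y v) (at y) u"])
    show "linear (local1 A c \<alpha> y)" if "y \<in> B" for y
      using linear_local1[OF f c] that r by blast
    show "((\<lambda>y. local1 A c \<alpha> y v) has_derivative frechet_derivative (\<lambda>y. local1 A c \<alpha> y v) (at y)) (at y)"
      if "y \<in> B" for y v
      using smooth_on_has_derivative[OF smooth that] .
    show "continuous_on B (\<lambda>y. frechet_derivative (\<lambda>y. local1 A c \<alpha> y v) (at y) u)" for u v
      by (intro smooth_on_continuous smooth_on_frechet smooth)
    show "frechet_derivative (\<lambda>y. local1 A c \<alpha> y v) (at y) u = frechet_derivative (\<lambda>y. local1 A c \<alpha> y u) (at y) v"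
      if "y \<in> B" for y u v
      using closed1_symmetric[OF assms(1) c] that r by blast
  qed (use r in simp)
  then have "(local_primitive p \<alpha> \<circ> chart_inv c has_derivative local1 A c \<alpha> x) (at x)"
    by (rule has_derivative_transform_within_open[OF _ open_img[OF c] xi])
      (simp add: local_primitive_def Let_def c)
  then show ?thesis
    using has_differentialI[OF c q(1)] q(2) by simp
qed

lemma local_primitive_add:
  assumes "\<alpha> \<in> closed1 A" "\<beta> \<in> closed1 A" "q \<in> chart_inv c ` B"
  shows "local_primitive p (\<alpha> + \<beta>) q = local_primitive p \<alpha> q + local_primitive p \<beta> q"
proof -
  have c: "c \<in> A" by (rule chart_at)
  obtain x where x: "x \<in> B" "q = chart_inv c x" using assms(3) by blast
  then have "chart_map c q \<in> B" using c r(2) by auto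
  moreover have "form1 A \<alpha>" "form1 A \<beta>" using assms by (auto simp: closed1_def)
  ultimately show ?thesis
    unfolding local_primitive_def Let_def local1_add[abs_def]
    by (intro radial_primitive_add[OF convex_ball, of _ _ r] continuous_local1 c r) (use r in auto)
qed

end

lemma local_primitive_scale1: "local_primitive p (scale1 r \<alpha>) q = r * local_primitive p \<alpha> q"
  unfolding local_primitive_def Let_def local1_scale1[abs_def] by (rule radial_primitive_cmult)

end

context smooth_manifold
begin

section \<open>Finiteness of the first cohomology\<close>

text \<open>On finitely many balls covering the manifold a closed form has primitives, and two of these
  differ by a locally constant function. The finitely many values of these differences detect
  exactness.\<close>

lemma finite_functionals_detect_exactness:
  assumes "compact (UNIV :: 'a set)"
  shows "\<exists>L :: (('a, 'n) field1 \<Rightarrow> real) set. finite L \<and>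
    (\<forall>l\<in>L. (\<forall>\<alpha>\<in>closed1 A. \<forall>\<beta>\<in>closed1 A. l (\<alpha> + \<beta>) = l \<alpha> + l \<beta>) \<and>
      (\<forall>r. \<forall>\<alpha>\<in>closed1 A. l (scale1 r \<alpha>) = r * l \<alpha>)) \<and>
    (\<forall>\<alpha>\<in>closed1 A. (\<forall>l\<in>L. l \<alpha> = 0) \<longrightarrow> \<alpha> \<in> exact1 A)"
proof -
  define x where "x p = chart_map (chart_at A p) p" for p
  have "\<exists>r>0. cball (x p) r \<subseteq> chart_img (chart_at A p)" for p
    using open_img[OF chart_at(1), of p] chart_at(2)[of p] open_contains_cball unfolding x_def by blast
  then obtain r where r: "\<And>p. r p > 0" "\<And>p. cball (x p) (r p) \<subseteq> chart_img (chart_at A p)"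
    by metis
  have rb: "ball (x p) (r p) \<subseteq> chart_img (chart_at A p)" for p
    using r(2)[of p] ball_subset_cball by blast
  \<comment> \<open>Three nested sets around each p: \<open>V p\<close> carries a primitive, the
    compact \<open>C p\<close> of half the radius makes finite covers of overlaps possible, and the
    open \<open>U p\<close> cover the manifold and are used for gluing.\<close>
  define V where "V p = chart_inv (chart_at A p) ` ball (x p) (r p)" for p
  define C where "C p = chart_inv (chart_at A p) ` cball (x p) (r p / 2)" for p
  define U where "U p = chart_inv (chart_at A p) ` ball (x p) (r p / 2)" for p
  have half: "cball (x p) (r p / 2) \<subseteq> ball (x p) (r p)" for p
    using r(1)[of p] by auto
  have V: "open (V p)" for p
    unfolding V_def by (intro open_chart_inv_image chart_at open_ball rb)
  have U: "open (U p)" for p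
    unfolding U_def using half[of p] rb[of p] ball_subset_cball
    by (intro open_chart_inv_image chart_at open_ball) blast
  have C: "compact (C p)" for p
    unfolding C_def using half[of p] rb[of p]
    by (intro compact_continuous_image continuous_on_subset[OF continuous_chart_inv[OF chart_at(1)]] compact_cball) blast
  have UC: "U p \<subseteq> C p" for p unfolding U_def C_def using ball_subset_cball by blast
  have CV: "C p \<subseteq> V p" for p unfolding C_def V_def using half by blast
  have "p \<in> U p" for p
  proof -
    have "x p \<in> ball (x p) (r p / 2)" using r(1)[of p] by simp
    moreover have "chart_inv (chart_at A p) (x p) = p" by (simp add: x_def chart_at)
    ultimately show ?thesis unfolding U_def by (intro image_eqI[of _ _ "x p"]) simp_all
  qed
  then have "(UNIV :: 'a set) \<subseteq> (\<Union>p\<in>UNIV. U p)" by blast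
  then obtain F where F: "finite F" "(UNIV :: 'a set) \<subseteq> (\<Union>p\<in>F. U p)"
    by (rule compactE_image[OF assms U])
  \<comment> \<open>The overlap of two balls may have many components. \<open>N\<close> supplies
    connected neighbourhoods inside it; finitely many of them cover
    \<open>C p \<inter> C p'\<close>, and on each the difference of the two primitives is determined
    by its value at the one point \<open>q\<close>.\<close>
  define N where "N p p' q = (SOME N. open N \<and> connected N \<and> q \<in> N \<and> N \<subseteq> V p \<inter> V p')" for p p' q
  have N: "open (N p p' q) \<and> connected (N p p' q) \<and> q \<in> N p p' q \<and> N p p' q \<subseteq> V p \<inter> V p'"
    if "q \<in> C p \<inter> C p'" for p p' q
  proof -
    have q: "q \<in> V p \<inter> V p'" using that CV by blast
    have "\<exists>N. open N \<and> connected N \<and> q \<in> N \<and> N \<subseteq> V p \<inter> V p'"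
      by (rule small_connected_neighbourhood[OF open_Int[OF V V] q]) blast
    from someI_ex[OF this] show ?thesis by (simp add: N_def)
  qed
  have "\<exists>Q. finite Q \<and> Q \<subseteq> C p \<inter> C p' \<and> C p \<inter> C p' \<subseteq> (\<Union>q\<in>Q. N p p' q)" for p p'
  proof -
    have cpt: "compact (C p \<inter> C p')" using C compact_Int by blast
    have cov: "C p \<inter> C p' \<subseteq> (\<Union>q\<in>C p \<inter> C p'. N p p' q)" using N by blast
    obtain Q where "Q \<subseteq> C p \<inter> C p'" "finite Q" "C p \<inter> C p' \<subseteq> (\<Union>q\<in>Q. N p p' q)"
      by (rule compactE_image[OF cpt _ cov]) (use N in auto)
    then show ?thesis by blast
  qed
  then obtain Q where Q: "\<And>p p'. finite (Q p p')" "\<And>p p'. Q p p' \<subseteq> C p \<inter> C p'"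
      "\<And>p p'. C p \<inter> C p' \<subseteq> (\<Union>q\<in>Q p p'. N p p' q)"
    by metis
  define l where "l p p' q \<alpha> = local_primitive p \<alpha> q + (- 1) * local_primitive p' \<alpha> q" for p p' q \<alpha>
  define I where "I = Sigma (F \<times> F) (\<lambda>(p, p'). Q p p')"
  define L where "L = (\<lambda>((p, p'), q). l p p' q) ` I"
  have finL: "finite L" unfolding L_def I_def
    by (intro finite_imageI finite_SigmaI) (auto simp: F(1) Q(1))
  note prim_add = local_primitive_add[OF r(1) rb[unfolded x_def], folded x_def, folded V_def]
  note prim_diff = has_differential_local_primitive[OF r(1) rb[unfolded x_def], folded x_def, folded V_def]
  have ladd: "l p p' q (\<alpha> + \<beta>) = l p p' q \<alpha> + l p p' q \<beta>"
    if "\<alpha> \<in> closed1 A" "\<beta> \<in> closed1 A" "q \<in> Q p p'" for p p' q \<alpha> \<beta>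
  proof -
    have "q \<in> V p" "q \<in> V p'" using that(3) Q(2)[of p p'] CV by blast+
    then show ?thesis unfolding l_def using prim_add[OF that(1,2)] by simp
  qed
  have lscale: "l p p' q (scale1 s \<alpha>) = s * l p p' q \<alpha>" for p p' q s \<alpha>
    unfolding l_def by (simp add: local_primitive_scale1 algebra_simps)
  have ex: "\<alpha> \<in> exact1 A" if \<alpha>: "\<alpha> \<in> closed1 A" and l0: "\<And>l. l \<in> L \<Longrightarrow> l \<alpha> = 0" for \<alpha>
  proof -
    have agree: "local_primitive p \<alpha> q = local_primitive p' \<alpha> q"
      if "p \<in> F" "p' \<in> F" "q \<in> C p" "q \<in> C p'" for p p' q
    proof -
      have "q \<in> C p \<inter> C p'" using that by simp
      with Q(3)[of p p'] have "q \<in> (\<Union>k\<in>Q p p'. N p p' k)" by (rule subsetD)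
      then obtain k where k: "k \<in> Q p p'" "q \<in> N p p' k" by (elim UN_E)
      have kC: "k \<in> C p \<inter> C p'" using k Q(2) by blast
      have "l p p' k \<in> L" unfolding L_def I_def using that k by (auto intro!: image_eqI[of _ _ "((p, p'), k)"])
      from l0[OF this] have "local_primitive p \<alpha> k - local_primitive p' \<alpha> k = 0" by (simp add: l_def)
      moreover have "local_primitive p \<alpha> k - local_primitive p' \<alpha> k = local_primitive p \<alpha> q - local_primitive p' \<alpha> q"
      proof (rule has_differential_0_imp_constant[of "N p p' k" "\<lambda>q. local_primitive p \<alpha> q - local_primitive p' \<alpha> q"])
        show "has_differential (\<lambda>q. local_primitive p \<alpha> q - local_primitive p' \<alpha> q) 0 m" if "m \<in> N p p' k" for m
          using that N[OF kC] by (intro has_differential_diff[of _ \<alpha>] prim_diff \<alpha>) auto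
      qed (use N[OF kC] k in auto)
      ultimately show ?thesis by simp
    qed
    \<comment> \<open>\<open>s\<close> picks for every point a ball containing it. Since the
      primitives agree on overlaps, near q the glued function is the primitive of the single ball
      \<open>s q\<close>, whichever balls are picked at nearby points.\<close>
    have "\<forall>q. \<exists>p. p \<in> F \<and> q \<in> U p" using F(2) by blast
    then obtain s where s: "\<And>q. s q \<in> F" "\<And>q. q \<in> U (s q)" by metis
    have "has_differential (\<lambda>q. local_primitive (s q) \<alpha> q) \<alpha> q" for q
    proof (rule has_differential_cong[of "U (s q)" q "local_primitive (s q) \<alpha>"])
      show "local_primitive (s q) \<alpha> m = local_primitive (s m) \<alpha> m" if "m \<in> U (s q)" for m
        using agree s UC that by blast
      show "has_differential (local_primitive (s q) \<alpha>) \<alpha> q"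
        using prim_diff[OF \<alpha>] s UC CV by blast
    qed (use U s in auto)
    then show ?thesis using exact1_iff \<alpha> by (auto simp: closed1_def)
  qed
  have "\<forall>l\<in>L. (\<forall>\<alpha>\<in>closed1 A. \<forall>\<beta>\<in>closed1 A. l (\<alpha> + \<beta>) = l \<alpha> + l \<beta>) \<and>
      (\<forall>r. \<forall>\<alpha>\<in>closed1 A. l (scale1 r \<alpha>) = r * l \<alpha>)"
    unfolding L_def I_def using ladd lscale by auto
  then show ?thesis using finL ex by (intro exI[of _ L]) blast
qed

section \<open>Cosymplectic vector fields\<close>

context
  fixes \<omega> \<eta> X
  assumes cosymp: "cosymplectic A \<omega> \<eta>" and X: "X \<in> cosymplectic_vfields A \<omega> \<eta>"
begin

private lemma smooth_local_vfield: "c \<in> A \<Longrightarrow> smooth_on (local_vfield A c X) (chart_img c)"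
  using X by (simp add: cosymplectic_vfields_def smooth_vfield_def)

text \<open>Cartan's formula: the Lie derivative of \<omega> is the sum of d of the contraction and
  the contraction of d\<omega>. It is checked in coordinates, where subtracting the vanishing of
  d\<omega> from that of the Lie derivative leaves exactly \<open>ext_d1\<close> of the
  contraction.\<close>

lemma interior2_closed1: "interior2 X \<omega> \<in> closed1 A"
proof -
  have t: "tensor2 A \<omega>" and alt: "\<And>p v. \<omega> p v v = 0" and d: "\<And>p u v w. ext_d2 A \<omega> p u v w = 0"
    using cosymp by (auto simp: cosymplectic_def form2_def)
  have bil: "bilinear (\<omega> p)" for p using t by (auto simp: tensor2_def)
  have skew: "\<omega> p u v = - \<omega> p v u" for p u v
    using alt[of p "u + v"] alt[of p u] alt[of p v]
    by (simp add: bilinear_ladd[OF bil] bilinear_radd[OF bil])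
  have lie: "lie2 A X \<omega> p u v = 0" for p u v using X by (simp add: cosymplectic_vfields_def)
  have lin: "linear (\<lambda>w. local2 A c \<omega> x w v)" if "c \<in> A" "x \<in> chart_img c" for c x v
    using bilinear_local2[OF t that] by (simp add: bilinear_def)
  have "form1 A (interior2 X \<omega>)"
    unfolding form1_def
  proof (intro conjI allI ballI)
    show "linear (interior2 X \<omega> p)" for p using bil[of p] by (simp add: interior2_def bilinear_def)
    fix c v assume c: "c \<in> A"
    show "smooth_on (\<lambda>x. local1 A c (interior2 X \<omega>) x v) (chart_img c)"
      by (subst smooth_on_cong[OF open_img[OF c] local1_interior2[OF c]])
        (auto intro!: smooth_on_linear_field[where a = "\<lambda>x w. local2 A c \<omega> x w v"]
          open_img c lin smooth_local2[OF t] smooth_local_vfield)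
  qed
  moreover have "ext_d1 A (interior2 X \<omega>) p u v = 0" for p u v
  proof -
    define c where "c = chart_at A p"
    define x where "x = chart_map c p"
    define b where "b = local2 A c \<omega>"
    define Y where "Y = local_vfield A c X"
    have c: "c \<in> A" "x \<in> chart_img c" by (auto simp: c_def x_def chart_at)
    have at_p: "b x = \<omega> p" "Y x = X p"
      by (simp_all add: b_def c_def x_def Y_def local2_chart_at local_vfield_chart_at)
    have DY: "(Y has_derivative frechet_derivative Y (at x)) (at x)"
      unfolding Y_def using smooth_on_has_derivative[OF smooth_local_vfield c(2)] c by blast
    have Db: "((\<lambda>y. b y w v) has_derivative frechet_derivative (\<lambda>y. b y w v) (at x)) (at x)" for w v
      unfolding b_def using smooth_on_has_derivative[OF smooth_local2[OF t c(1)] c(2)] .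
    have "frechet_derivative (\<lambda>y. local1 A c (interior2 X \<omega>) y v) (at x) u =
        frechet_derivative (\<lambda>y. b y (X p) v) (at x) u + \<omega> p (frechet_derivative Y (at x) u) v" for u v
    proof -
      have "((\<lambda>y. b y (Y y) v) has_derivative
        (\<lambda>u. frechet_derivative (\<lambda>y. b y (Y x) v) (at x) u + b x (frechet_derivative Y (at x) u) v)) (at x)"
        by (rule has_derivative_linear_field[OF open_img[OF c(1)] c(2), where a = "\<lambda>y w. b y w v"])
          (use lin[OF c(1)] Db DY in \<open>auto simp: b_def\<close>)
      then have "((\<lambda>y. local1 A c (interior2 X \<omega>) y v) has_derivative
        (\<lambda>u. frechet_derivative (\<lambda>y. b y (Y x) v) (at x) u + b x (frechet_derivative Y (at x) u) v)) (at x)"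
        by (rule has_derivative_transform_within_open[OF _ open_img[OF c(1)] c(2)])
          (simp add: local1_interior2 c b_def Y_def)
      from fun_cong[OF frechet_derivative_at[OF this], symmetric] show ?thesis by (simp add: at_p)
    qed
    then have "ext_d1 A (interior2 X \<omega>) p u v =
      (frechet_derivative (\<lambda>y. b y (X p) v) (at x) u + \<omega> p (frechet_derivative Y (at x) u) v) -
      (frechet_derivative (\<lambda>y. b y (X p) u) (at x) v + \<omega> p (frechet_derivative Y (at x) v) u)"
      by (simp add: ext_d1_def pderiv_at_def Let_def c_def x_def)
    moreover have "frechet_derivative (\<lambda>y. b y u v) (at x) (X p) + \<omega> p (frechet_derivative Y (at x) u) v
        + \<omega> p u (frechet_derivative Y (at x) v) = 0"
      using lie[of p u v] by (simp add: lie2_def pderiv_at_def Let_def c_def x_def b_def Y_def)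
    moreover have "frechet_derivative (\<lambda>y. b y u v) (at x) (X p) - frechet_derivative (\<lambda>y. b y (X p) v) (at x) u
        + frechet_derivative (\<lambda>y. b y (X p) u) (at x) v = 0"
      using d[of p "X p" u v] by (simp add: ext_d2_def pderiv_at_def Let_def c_def x_def b_def)
    moreover have "\<omega> p u (frechet_derivative Y (at x) v) = - \<omega> p (frechet_derivative Y (at x) v) u"
      by (rule skew)
    ultimately show ?thesis by linarith
  qed
  ultimately show ?thesis by (simp add: closed1_def)
qed

lemma eta_closed1: "\<eta> \<in> closed1 A"
  using cosymp by (simp add: cosymplectic_def closed1_def)

text \<open>By Cartan's formula the differential of \<eta>(X) is the Lie derivative of \<eta> minus
  the contraction of d\<eta>, and both vanish. Connectedness then makes the function constant, so
  the description in \<open>eta_value\<close> denotes its value.\<close>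

lemma eta_value:
  assumes "connected (UNIV :: 'a set)"
  shows "\<eta> p (X p) = eta_value \<eta> X"
proof -
  have form: "form1 A \<eta>" and d: "\<And>p u v. ext_d1 A \<eta> p u v = 0"
    using eta_closed1 by (auto simp: closed1_def)
  have lie: "lie1 A X \<eta> p v = 0" for p v using X by (simp add: cosymplectic_vfields_def)
  have "has_differential (\<lambda>p. \<eta> p (X p)) 0 p" for p
  proof -
    define c where "c = chart_at A p"
    define x where "x = chart_map c p"
    define a where "a = local1 A c \<eta>"
    define Y where "Y = local_vfield A c X"
    have c: "c \<in> A" "x \<in> chart_img c" "p \<in> chart_dom c" by (auto simp: c_def x_def chart_at)
    have at_p: "a x = \<eta> p" "Y x = X p"
      by (simp_all add: a_def c_def x_def Y_def local1_chart_at local_vfield_chart_at)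
    have DY: "(Y has_derivative frechet_derivative Y (at x)) (at x)"
      unfolding Y_def using smooth_on_has_derivative[OF smooth_local_vfield c(2)] c by blast
    have Da: "((\<lambda>y. a y v) has_derivative frechet_derivative (\<lambda>y. a y v) (at x)) (at x)" for v
      unfolding a_def using smooth_on_has_derivative[OF smooth_local1[OF form c(1)] c(2)] .
    have "((\<lambda>y. a y (Y y)) has_derivative
      (\<lambda>u. frechet_derivative (\<lambda>y. a y (Y x)) (at x) u + a x (frechet_derivative Y (at x) u))) (at x)"
      by (rule has_derivative_linear_field[OF open_img[OF c(1)] c(2)])
        (use linear_local1[OF form c(1)] Da DY in \<open>auto simp: a_def\<close>)
    moreover have "frechet_derivative (\<lambda>y. a y (Y x)) (at x) u + a x (frechet_derivative Y (at x) u) = 0" for u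
      unfolding at_p using lie[of p u] d[of p u "X p"]
      by (simp add: lie1_def ext_d1_def pderiv_at_def Let_def c_def x_def a_def Y_def)
    ultimately have "((\<lambda>y. a y (Y y)) has_derivative (\<lambda>u. 0)) (at x)" by simp
    then have "(((\<lambda>p. \<eta> p (X p)) \<circ> chart_inv c) has_derivative (\<lambda>u. 0)) (at x)"
      by (rule has_derivative_transform_within_open[OF _ open_img[OF c(1)] c(2)])
        (simp add: local1_vfield c a_def Y_def)
    then show ?thesis
      using has_differentialI[OF c(1,3)] by (simp add: x_def local1_zero[abs_def])
  qed
  then have "\<eta> q (X q) = \<eta> p (X p)" for q
    by (intro has_differential_0_imp_constant[OF open_UNIV assms]) simp_all
  then have "(THE r. \<forall>q. \<eta> q (X q) = r) = \<eta> p (X p)" by (intro the_equality) auto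
  then show ?thesis by (simp only: eta_value_def)
qed

end

end

section \<open>Positive definite forms and the dual norm\<close>

lemma continuous_on_det:
  fixes M :: "'e::topological_space \<Rightarrow> real ^ 'n::finite ^ 'n"
  assumes "\<And>i j. continuous_on S (\<lambda>x. M x $ i $ j)"
  shows "continuous_on S (\<lambda>x. det (M x))"
  unfolding det_def by (intro continuous_intros assms)

lemma det_nonzero_if_positive:
  fixes G :: "real ^ 'n::finite ^ 'n"
  assumes "\<And>v. v \<noteq> 0 \<Longrightarrow> 0 < v \<bullet> (G *v v)"
  shows "det G \<noteq> 0"
proof -
  have "\<forall>v. G *v v = 0 \<longrightarrow> v = 0" using assms by (metis inner_zero_right less_irrefl)
  then show ?thesis
    using matrix_left_invertible_ker invertible_left_inverse invertible_det_nz by metis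
qed

text \<open>Positivity is a convex condition, so the determinant has no zero on the segment from the
  identity to G and keeps the sign it has at the identity.\<close>

lemma det_positive:
  fixes G :: "real ^ 'n::finite ^ 'n"
  assumes G: "\<And>v. v \<noteq> 0 \<Longrightarrow> 0 < v \<bullet> (G *v v)"
  shows "0 < det G"
proof (rule ccontr)
  assume n: "\<not> 0 < det G"
  define H where "H t = (1 - t) *\<^sub>R mat 1 + t *\<^sub>R G" for t :: real
  have "continuous_on {0..1} (\<lambda>t. det (H t))"
    by (intro continuous_on_det) (simp add: H_def, intro continuous_intros)
  moreover have "det (H 1) \<le> 0" "0 \<le> det (H 0)" using n by (simp_all add: H_def)
  ultimately obtain t where t: "0 \<le> t" "t \<le> 1" "det (H t) = 0"
    using IVT2'[of "\<lambda>t. det (H t)" 1 0 0] by auto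
  have "0 < v \<bullet> (H t *v v)" if "v \<noteq> 0" for v
  proof -
    have "v \<bullet> (H t *v v) = (1 - t) * (v \<bullet> v) + t * (v \<bullet> (G *v v))"
      by (simp add: H_def matrix_vector_mult_add_rdistrib scaleR_matrix_vector_assoc[symmetric] inner_add_right)
    moreover have "0 < v \<bullet> v" "0 < v \<bullet> (G *v v)" using G that by auto
    ultimately show ?thesis using t(1,2)
      by (cases "t = 0") (auto intro: add_nonneg_pos)
  qed
  then show False using det_nonzero_if_positive t(3) by blast
qed

lemma matrix_inv_vector_mult:
  fixes G :: "real ^ 'n::finite ^ 'n"
  assumes "det G \<noteq> 0"
  shows "G *v (matrix_inv G *v a) = a" "matrix_inv G *v (G *v a) = a"
proof -
  have "\<exists>B. G ** B = mat 1 \<and> B ** G = mat 1"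
    using assms invertible_det_nz invertible_def by blast
  from someI_ex[OF this] have "G ** matrix_inv G = mat 1 \<and> matrix_inv G ** G = mat 1"
    by (simp add: matrix_inv_def)
  then show "G *v (matrix_inv G *v a) = a" "matrix_inv G *v (G *v a) = a"
    by (simp_all add: matrix_vector_mul_assoc)
qed

definition positive_form :: "(real ^ 'n::finite \<Rightarrow> real ^ 'n \<Rightarrow> real) \<Rightarrow> bool" where
  "positive_form b \<longleftrightarrow> bilinear b \<and> (\<forall>v. v \<noteq> 0 \<longrightarrow> 0 < b v v)"

definition coords :: "(real ^ 'n::finite \<Rightarrow> real) \<Rightarrow> real ^ 'n" where
  "coords l = (\<chi> i. l (axis i 1))"

text \<open>The expression inside \<open>norm1_sq\<close>, detached from points of the manifold so
  that it can also be evaluated on local representations in an arbitrary chart.\<close>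

definition dual_form :: "(real ^ 'n::finite \<Rightarrow> real ^ 'n \<Rightarrow> real) \<Rightarrow> (real ^ 'n \<Rightarrow> real) \<Rightarrow> real" where
  "dual_form b l = coords l \<bullet> (matrix_inv (gram b) *v coords l)"

lemma norm1_sq_eq: "norm1_sq g \<alpha> p = dual_form (g p) (\<alpha> p)"
  by (simp add: norm1_sq_def dual_form_def coords_def Let_def)

lemma inner_coords: "linear l \<Longrightarrow> coords l \<bullet> v = l v" "linear l \<Longrightarrow> v \<bullet> coords l = l v"
  using linear_expand_axis[of l v] by (simp_all add: coords_def inner_vec_def mult.commute)

lemma gram_mult:
  assumes "bilinear b"
  shows "gram b *v v = coords (\<lambda>u. b u v)"
proof -
  have "(gram b *v v) $ i = b (axis i 1) v" for i
    using linear_expand_axis[of "b (axis i 1)" v] assms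
    by (simp add: gram_def matrix_vector_mult_def bilinear_def mult.commute)
  then show ?thesis by (simp add: coords_def vec_eq_iff)
qed

lemma inner_gram_mult: "bilinear b \<Longrightarrow> u \<bullet> (gram b *v v) = b u v"
  by (simp add: gram_mult inner_coords bilinear_def)

lemma det_gram_positive: "positive_form b \<Longrightarrow> 0 < det (gram b)"
  by (intro det_positive) (auto simp: positive_form_def inner_gram_mult)

lemma riesz_representation:
  assumes "positive_form b" "linear l"
  obtains y where "\<And>w. b w y = l w"
proof
  fix w
  have b: "bilinear b" using assms by (simp add: positive_form_def)
  have "det (gram b) \<noteq> 0" using det_gram_positive[OF assms(1)] by simp
  then have "gram b *v (matrix_inv (gram b) *v coords l) = coords l"
    by (rule matrix_inv_vector_mult)
  then show "b w (matrix_inv (gram b) *v coords l) = l w"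
    using inner_gram_mult[OF b, of w] inner_coords[OF assms(2), of w] by metis
qed

text \<open>A description without coordinates: y is the Riesz vector of l. Positivity, definiteness
  and the behaviour under changes of coordinates are derived from it rather than from the inverse
  matrix.\<close>

lemma dual_form_eq:
  assumes "positive_form b" "linear l" "\<And>w. b w y = l w"
  shows "dual_form b l = l y"
proof -
  have b: "bilinear b" using assms by (simp add: positive_form_def)
  have d: "det (gram b) \<noteq> 0" using det_gram_positive[OF assms(1)] by simp
  have "gram b *v y = coords l" using gram_mult[OF b] assms(3) by simp
  then have "matrix_inv (gram b) *v coords l = y" using matrix_inv_vector_mult(2)[OF d] by metis
  then show ?thesis by (simp add: dual_form_def inner_coords assms(2))
qed

lemma dual_form_nonneg:
  assumes "positive_form b" "linear l"
  shows "0 \<le> dual_form b l"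
proof -
  obtain y where y: "\<And>w. b w y = l w" using riesz_representation[OF assms] by blast
  have "bilinear b" using assms by (simp add: positive_form_def)
  then have "0 \<le> b y y" using assms(1)
    by (cases "y = 0") (auto simp: positive_form_def bilinear_lzero less_imp_le)
  then show ?thesis using dual_form_eq[OF assms y] y by simp
qed

lemma dual_form_eq_0:
  assumes "positive_form b" "linear l" "dual_form b l = 0"
  shows "l v = 0"
proof -
  obtain y where y: "\<And>w. b w y = l w" using riesz_representation[OF assms(1,2)] by blast
  have b: "bilinear b" using assms by (simp add: positive_form_def)
  have "b y y = 0" using dual_form_eq[OF assms(1,2) y] y assms(3) by simp
  then have "y = 0" using assms(1) by (metis positive_form_def less_irrefl)
  then show ?thesis using y[of v] bilinear_rzero[OF b] by simp
qed

text \<open>If y is the Riesz vector of the pulled-back form, then T y is that of l, because T is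
  onto. This is the invariance that allows the pointwise norm to be computed in any chart.\<close>

lemma dual_form_pullback:
  assumes "positive_form b" "linear l" "linear T" "surj T" "positive_form (\<lambda>u v. b (T u) (T v))"
  shows "dual_form (\<lambda>u v. b (T u) (T v)) (\<lambda>v. l (T v)) = dual_form b l"
proof -
  have lT: "linear (\<lambda>v. l (T v))" using linear_compose[OF assms(3,2)] by (simp add: comp_def)
  obtain y where y: "\<And>w. b (T w) (T y) = l (T w)" using riesz_representation[OF assms(5) lT] by blast
  have "b w (T y) = l w" for w using y assms(4) by (metis surjD)
  from dual_form_eq[OF assms(1,2) this] dual_form_eq[OF assms(5) lT y] show ?thesis by simp
qed

text \<open>The difference of the two sides is the form at \<open>sqrt t * l - m / sqrt t\<close>. Minimising over \<open>t\<close>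
  after integration gives Minkowski's inequality without the Cauchy-Schwarz inequality.\<close>

lemma dual_form_add_le:
  assumes b: "positive_form b" and l: "linear l" "linear m" and t: "0 < t"
  shows "dual_form b (\<lambda>v. l v + m v) \<le> (1 + t) * dual_form b l + (1 + 1 / t) * dual_form b m"
proof -
  define s where "s = sqrt t"
  define r where "r = 1 / s"
  have s: "s * s = t" "r * r = 1 / t" "s * r = 1" using t by (auto simp: s_def r_def)
  obtain y where y: "\<And>w. b w y = l w" using riesz_representation[OF b l(1)] by blast
  obtain z where z: "\<And>w. b w z = m w" using riesz_representation[OF b l(2)] by blast
  have bil: "bilinear b" using b by (simp add: positive_form_def)
  have lin: "linear (\<lambda>v. s * l v - r * m v)"
    using l by (simp add: linear_iff algebra_simps)
  have "0 \<le> dual_form b (\<lambda>v. s * l v - r * m v)"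
    by (rule dual_form_nonneg[OF b lin])
  also have "\<dots> = s * l (s *\<^sub>R y - r *\<^sub>R z) - r * m (s *\<^sub>R y - r *\<^sub>R z)"
    by (rule dual_form_eq[OF b lin]) (simp add: bilinear_rsub[OF bil] bilinear_rmul[OF bil] y z)
  also have "\<dots> = (s * s) * l y - (s * r) * (l z + m y) + (r * r) * m z"
    by (simp add: linear_cmul[OF l(1)] linear_cmul[OF l(2)] linear_diff[OF l(1)] linear_diff[OF l(2)]
        algebra_simps)
  finally have "l z + m y \<le> t * l y + 1 / t * m z"
    by (simp add: s)
  moreover have "dual_form b (\<lambda>v. l v + m v) = l (y + z) + m (y + z)"
    using y z linear_compose_add[OF l]
    by (intro dual_form_eq[OF b]) (simp_all add: bilinear_radd[OF bil])
  moreover have "dual_form b l = l y" "dual_form b m = m z"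
    by (rule dual_form_eq[OF b l(1) y], rule dual_form_eq[OF b l(2) z])
  ultimately show ?thesis
    by (simp add: linear_add[OF l(1)] linear_add[OF l(2)] distrib_right)
qed

lemma dual_form_cmult: "dual_form b (\<lambda>v. r * l v) = r\<^sup>2 * dual_form b l"
proof -
  have "coords (\<lambda>v. r * l v) = r *\<^sub>R coords l" by (simp add: coords_def vec_eq_iff)
  then show ?thesis
    by (simp add: dual_form_def matrix_vector_mult_scaleR power2_eq_square)
qed

text \<open>Cramer's rule replaces the inverse matrix by quotients of determinants, whose continuity
  follows from that of the entries.\<close>

lemma continuous_on_dual_form:
  fixes b :: "'e::topological_space \<Rightarrow> real ^ 'n::finite \<Rightarrow> real ^ 'n \<Rightarrow> real"
  assumes "\<And>x. x \<in> S \<Longrightarrow> positive_form (b x)"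
    and b: "\<And>u v. continuous_on S (\<lambda>x. b x u v)" and l: "\<And>v. continuous_on S (\<lambda>x. l x v)"
  shows "continuous_on S (\<lambda>x. dual_form (b x) (l x))"
proof -
  have d: "det (gram (b x)) \<noteq> 0" if "x \<in> S" for x using det_gram_positive[OF assms(1)[OF that]] by simp
  have cg: "continuous_on S (\<lambda>x. gram (b x) $ i $ j)" for i j unfolding gram_def using b by simp
  have cl: "continuous_on S (\<lambda>x. coords (l x) $ i)" for i unfolding coords_def using l by simp
  have cdg: "continuous_on S (\<lambda>x. det (gram (b x)))" by (rule continuous_on_det[OF cg])
  have cd: "continuous_on S (\<lambda>x. det (\<chi> i j. if j = k then coords (l x) $ i else gram (b x) $ i $ j))" for k
  proof (rule continuous_on_det)
    show "continuous_on S (\<lambda>x. (\<chi> i j. if j = k then coords (l x) $ i else gram (b x) $ i $ j) $ i $ j)" for i j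
      using cl cg by (cases "j = k") simp_all
  qed
  have "continuous_on S (\<lambda>x. \<Sum>k\<in>UNIV. coords (l x) $ k *
      (det (\<chi> i j. if j = k then coords (l x) $ i else gram (b x) $ i $ j) / det (gram (b x))))"
    by (intro continuous_on_sum continuous_on_mult continuous_on_divide cl cd cdg) (use d in auto)
  moreover have "dual_form (b x) (l x) = (\<Sum>k\<in>UNIV. coords (l x) $ k *
      (det (\<chi> i j. if j = k then coords (l x) $ i else gram (b x) $ i $ j) / det (gram (b x))))" if "x \<in> S" for x
  proof -
    have "matrix_inv (gram (b x)) *v coords (l x) =
        (\<chi> k. det (\<chi> i j. if j = k then coords (l x) $ i else gram (b x) $ i $ j) / det (gram (b x)))"
      using cramer[OF d[OF that]] matrix_inv_vector_mult(1)[OF d[OF that]] by blast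
    then show ?thesis by (simp add: dual_form_def inner_vec_def)
  qed
  ultimately show ?thesis by (simp cong: continuous_on_cong)
qed

section \<open>The L2 norm on 1-forms\<close>

text \<open>For positive a and b the right-hand side is least at t = sqrt b / sqrt a, with minimum
  (sqrt a + sqrt b)^2. A root may vanish, so this value of t is only approximated.\<close>

lemma sqrt_triangle_from_weighted:
  fixes a b c :: real
  assumes nn: "0 \<le> a" "0 \<le> b" and le: "\<And>t. 0 < t \<Longrightarrow> c \<le> (1 + t) * a + (1 + 1 / t) * b"
  shows "sqrt c \<le> sqrt a + sqrt b"
proof -
  have "c \<le> (sqrt a + sqrt b)\<^sup>2 + e" if e: "0 < e" for e
  proof -
    define s where "s = sqrt a"
    define r where "r = sqrt b"
    have sr: "0 \<le> s" "0 \<le> r" "a = s\<^sup>2" "b = r\<^sup>2" using nn by (auto simp: s_def r_def)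
    \<comment> \<open>\<open>d\<close> is added to both roots in the optimal t to keep them away
      from 0. The loss is \<open>d * (s + r)\<close>, which this choice keeps below
      \<open>e\<close>.\<close>
    define d where "d = e / (1 + s + r)"
    have d: "0 < d" "d * (s + r) \<le> e"
    proof -
      show "0 < d" using e sr by (simp add: d_def add_pos_nonneg)
      have "e * (s + r) \<le> e * (1 + s + r)" using e by (intro mult_left_mono) auto
      then show "d * (s + r) \<le> e" using sr by (simp add: d_def divide_le_eq add_pos_nonneg)
    qed
    define t where "t = (r + d) / (s + d)"
    have t: "0 < t" using d sr by (simp add: t_def add_nonneg_pos)
    have "t * s\<^sup>2 \<le> (r + d) * s"
    proof -
      have "t * s\<^sup>2 = (r + d) * s * (s / (s + d))" by (simp add: t_def power2_eq_square)
      also have "\<dots> \<le> (r + d) * s * 1" using sr d by (intro mult_left_mono) auto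
      finally show ?thesis by simp
    qed
    moreover have "1 / t * r\<^sup>2 \<le> (s + d) * r"
    proof -
      have "1 / t * r\<^sup>2 = (s + d) * r * (r / (r + d))" by (simp add: t_def power2_eq_square)
      also have "\<dots> \<le> (s + d) * r * 1" using sr d by (intro mult_left_mono) auto
      finally show ?thesis by simp
    qed
    moreover have "c \<le> s\<^sup>2 + t * s\<^sup>2 + (r\<^sup>2 + 1 / t * r\<^sup>2)"
      using le[OF t] by (simp only: sr(3,4) distrib_right mult_1)
    ultimately have "c \<le> s\<^sup>2 + (r + d) * s + (r\<^sup>2 + (s + d) * r)" by linarith
    also have "\<dots> = (s + r)\<^sup>2 + d * (s + r)" by (simp add: power2_eq_square algebra_simps)
    finally show ?thesis using d(2) by (simp add: s_def r_def)
  qed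
  then have "c \<le> (sqrt a + sqrt b)\<^sup>2" by (rule field_le_epsilon)
  then show ?thesis using nn by (intro real_le_lsqrt) auto
qed

section \<open>Chart partitions and the Riemannian integral\<close>

locale compact_riemannian_manifold = smooth_manifold A
  for A :: "('a::{t2_space,second_countable_topology}, 'n::finite) chart set" +
  fixes g :: "('a, 'n) field2"
  assumes compact: "compact (UNIV :: 'a set)" and metric: "riemannian_metric A g"
begin

text \<open>This gives meaning to the choice inside \<open>riemannian_integral\<close>. A finite
  cover by coordinate balls is made disjoint by subtracting the earlier balls; the closed balls are
  the required compact sets.\<close>

lemma ex_chart_partition: "\<exists>P. chart_partition A P"
proof -
  have "\<exists>r>0. cball (chart_map (chart_at A p) p) r \<subseteq> chart_img (chart_at A p)" for p
    using open_img[OF chart_at(1), of p] chart_at(2)[of p] open_contains_cball by blast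
  then obtain r where r: "\<And>p. r p > 0" "\<And>p. cball (chart_map (chart_at A p) p) (r p) \<subseteq> chart_img (chart_at A p)"
    by metis
  define C where "C p = chart_inv (chart_at A p) ` cball (chart_map (chart_at A p) p) (r p)" for p
  define U where "U p = chart_inv (chart_at A p) ` ball (chart_map (chart_at A p) p) (r p)" for p
  have U: "open (U p)" for p
    unfolding U_def using r(2)[of p] ball_subset_cball
    by (intro open_chart_inv_image chart_at open_ball) blast
  have C: "compact (C p)" for p
    unfolding C_def
    by (intro compact_continuous_image continuous_on_subset[OF continuous_chart_inv[OF chart_at(1)]] compact_cball r)
  have Cdom: "C p \<subseteq> chart_dom (chart_at A p)" for p
    unfolding C_def using r(2)[of p] chart_inv_dom[OF chart_at(1)] by blast
  have UC: "U p \<subseteq> C p" for p unfolding U_def C_def using ball_subset_cball by blast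
  have "p \<in> U p" for p
    unfolding U_def by (intro image_eqI[of _ _ "chart_map (chart_at A p) p"]) (simp_all add: chart_at r)
  then have cov: "(UNIV :: 'a set) \<subseteq> (\<Union>p\<in>UNIV. U p)" by blast
  obtain F where F: "finite F" "(UNIV :: 'a set) \<subseteq> (\<Union>p\<in>F. U p)"
    by (rule compactE_image[OF compact U cov])
  obtain h where h: "bij_betw h {0..<card F} F" using ex_bij_betw_nat_finite[OF F(1)] by blast
  \<comment> \<open>\<open>disjointed\<close> acts on sequences, so the enumerated finite cover is
    continued by empty sets.\<close>
  define V where "V i = (if i < card F then U (h i) else {})" for i
  define P where "P = (\<lambda>i. (disjointed V i, chart_at A (h i))) ` {0..<card F}"
  have "chart_partition A P"
    unfolding chart_partition_def
  proof (intro conjI)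
    show "finite P" by (simp add: P_def)
    show "\<forall>(B, c)\<in>P. c \<in> A \<and> B \<in> sets borel \<and> (\<exists>K. compact K \<and> B \<subseteq> K \<and> K \<subseteq> chart_dom c)"
    proof -
      have "disjointed V i \<in> sets borel" for i
        using sets.range_disjointed_sets[of V borel] by (auto simp: V_def U image_subset_iff)
      moreover have "disjointed V i \<subseteq> C (h i)" if "i < card F" for i
        using disjointed_subset[of V i] UC[of "h i"] that by (auto simp: V_def)
      ultimately have "chart_at A (h i) \<in> A \<and> disjointed V i \<in> sets borel \<and>
          (\<exists>K. compact K \<and> disjointed V i \<subseteq> K \<and> K \<subseteq> chart_dom (chart_at A (h i)))" if "i < card F" for i
        using that chart_at(1) C[of "h i"] Cdom[of "h i"] by blast
      then show ?thesis by (simp add: P_def)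
    qed
    show "pairwise (\<lambda>q q'. fst q \<inter> fst q' = {}) P"
      unfolding P_def using disjoint_family_disjointed[of V]
      by (intro pairwise_imageI) (simp add: disjoint_family_on_def)
    have "(\<Union>i. disjointed V i) = (\<Union>i. V i)" by (rule UN_disjointed_eq)
    also have "\<dots> = UNIV"
    proof -
      have "\<exists>i. p \<in> V i" for p
      proof -
        obtain q where q: "q \<in> F" "p \<in> U q" using F(2) by blast
        then obtain i where "i < card F" "h i = q" using h by (force simp: bij_betw_def)
        then show ?thesis using q by (intro exI[of _ i]) (simp add: V_def)
      qed
      then show ?thesis by blast
    qed
    finally have U1: "(\<Union>i. disjointed V i) = UNIV" .
    have "disjointed V i = {}" if "\<not> i < card F" for i
      using disjointed_subset[of V i] that by (simp add: V_def)
    then have "(\<Union>i\<in>{0..<card F}. disjointed V i) = UNIV" using U1 by fastforce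
    then show "(\<Union>q\<in>P. fst q) = UNIV" by (simp add: P_def)
  qed
  then show ?thesis by blast
qed

text \<open>The very partition chosen inside \<open>riemannian_integral\<close>; all properties of
  the integral are established for this choice.\<close>

definition pieces :: "('a set \<times> ('a, 'n) chart) set" where
  "pieces = (SOME P. chart_partition A P)"

lemma chart_partition_pieces: "chart_partition A pieces"
  unfolding pieces_def using someI_ex[OF ex_chart_partition] .

definition volume_density :: "('a, 'n) chart \<Rightarrow> real ^ 'n \<Rightarrow> real" where
  "volume_density c x = sqrt (det (gram (local2 A c g x)))"

lemma tensor2_g: "tensor2 A g" and g_positive: "v \<noteq> 0 \<Longrightarrow> 0 < g p v v"
  using metric by (auto simp: riemannian_metric_def)

lemma positive_g: "positive_form (g p)"
  using tensor2_g g_positive by (auto simp: positive_form_def tensor2_def)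

lemma surj_tangent_change:
  assumes "c \<in> A" "c' \<in> A" "p \<in> chart_dom c" "p \<in> chart_dom c'"
  shows "surj (tangent_change c c' p)" "inj (tangent_change c c' p)"
proof -
  have "tangent_change c c' p (tangent_change c' c p v) = v" for v
    using assms tangent_change_trans[of c' c c' p v] tangent_change_refl[of c' p] by simp
  then show "surj (tangent_change c c' p)" by (rule surjI)
  have "tangent_change c' c p (tangent_change c c' p v) = v" for v
    using assms tangent_change_trans[of c c' c p v] tangent_change_refl[of c p] by simp
  then show "inj (tangent_change c c' p)" by (rule inj_on_inverseI)
qed

lemma positive_local2_g:
  assumes "c \<in> A" "x \<in> chart_img c"
  shows "positive_form (local2 A c g x)"
  unfolding positive_form_def
proof (intro conjI allI impI)
  show "bilinear (local2 A c g x)" by (rule bilinear_local2[OF tensor2_g assms])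
  fix v :: "real ^ 'n" assume v: "v \<noteq> 0"
  let ?p = "chart_inv c x"
  let ?T = "tangent_change c (chart_at A ?p) ?p"
  have p: "c \<in> A" "chart_at A ?p \<in> A" "?p \<in> chart_dom c" "?p \<in> chart_dom (chart_at A ?p)"
    using assms by (auto simp: chart_at)
  have "?T v \<noteq> 0"
    using surj_tangent_change(2)[OF p] linear_0[OF tangent_change_linear[OF p]] v by (metis injD)
  then show "0 < local2 A c g x v v" by (simp add: local2_def Let_def g_positive)
qed

text \<open>The change of tangent coordinates pulls g and \<alpha> back to their local
  representations, so the invariance of the dual form applies. It yields continuity of the pointwise
  norm in a fixed chart, although the defining formula may jump with the preferred chart.\<close>

lemma norm1_sq_chart:
  assumes "\<And>p. linear (\<alpha> p)" "c \<in> A" "x \<in> chart_img c"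
  shows "norm1_sq g \<alpha> (chart_inv c x) = dual_form (local2 A c g x) (local1 A c \<alpha> x)"
proof -
  let ?p = "chart_inv c x"
  let ?T = "tangent_change c (chart_at A ?p) ?p"
  have p: "c \<in> A" "chart_at A ?p \<in> A" "?p \<in> chart_dom c" "?p \<in> chart_dom (chart_at A ?p)"
    using assms by (auto simp: chart_at)
  have l2: "local2 A c g x = (\<lambda>u v. g ?p (?T u) (?T v))" by (intro ext) (simp add: local2_def Let_def)
  have l1: "local1 A c \<alpha> x = (\<lambda>v. \<alpha> ?p (?T v))" by (intro ext) (simp add: local1_def Let_def)
  have "dual_form (\<lambda>u v. g ?p (?T u) (?T v)) (\<lambda>v. \<alpha> ?p (?T v)) = dual_form (g ?p) (\<alpha> ?p)"
    by (rule dual_form_pullback[OF positive_g assms(1) tangent_change_linear[OF p] surj_tangent_change(1)[OF p]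
        positive_local2_g[OF assms(2,3), unfolded l2]])
  then show ?thesis by (simp add: norm1_sq_eq l1 l2)
qed

lemma continuous_local2_g: "c \<in> A \<Longrightarrow> continuous_on (chart_img c) (\<lambda>x. local2 A c g x u v)"
  by (rule smooth_on_continuous[OF smooth_local2[OF tensor2_g]])

lemma volume_density:
  assumes "c \<in> A"
  shows "continuous_on (chart_img c) (volume_density c)" "x \<in> chart_img c \<Longrightarrow> 0 < volume_density c x"
proof -
  show "continuous_on (chart_img c) (volume_density c)"
    unfolding volume_density_def[abs_def]
    by (intro continuous_on_real_sqrt continuous_on_det) (simp add: gram_def continuous_local2_g[OF assms])
  show "0 < volume_density c x" if "x \<in> chart_img c"
    using det_gram_positive[OF positive_local2_g[OF assms that]] by (simp add: volume_density_def)
qed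

definition continuous_fun :: "('a \<Rightarrow> real) \<Rightarrow> bool" where
  "continuous_fun h \<longleftrightarrow> (\<forall>c\<in>A. continuous_on (chart_img c) (\<lambda>x. h (chart_inv c x)))"

lemma continuous_norm1_sq:
  assumes "form1 A \<alpha>"
  shows "continuous_fun (norm1_sq g \<alpha>)"
  unfolding continuous_fun_def
proof
  fix c assume c: "c \<in> A"
  have lin: "linear (\<alpha> p)" for p using assms by (simp add: form1_def)
  have "continuous_on (chart_img c) (\<lambda>x. dual_form (local2 A c g x) (local1 A c \<alpha> x))"
    by (intro continuous_on_dual_form positive_local2_g c continuous_local2_g continuous_local1[OF assms c] subset_refl)
  then show "continuous_on (chart_img c) (\<lambda>x. norm1_sq g \<alpha> (chart_inv c x))"
    by (rule continuous_on_eq) (simp add: norm1_sq_chart[OF lin c])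
qed

text \<open>The image of a piece is its preimage under the continuous inverse chart, hence Borel.
  The compact set around it is what makes continuous integrands integrable.\<close>

lemma piece:
  assumes "(B, c) \<in> pieces"
  shows "c \<in> A" "B \<subseteq> chart_dom c" "chart_map c ` B \<in> sets borel"
    and "\<exists>K. compact K \<and> chart_map c ` B \<subseteq> K \<and> K \<subseteq> chart_img c"
proof -
  have "c \<in> A \<and> B \<in> sets borel \<and> (\<exists>K. compact K \<and> B \<subseteq> K \<and> K \<subseteq> chart_dom c)"
    using chart_partition_pieces assms by (auto simp: chart_partition_def)
  then obtain K where c: "c \<in> A" and B: "B \<in> sets borel" and K: "compact K" "B \<subseteq> K" "K \<subseteq> chart_dom c" by blast
  show "c \<in> A" by fact
  show Bd: "B \<subseteq> chart_dom c" using K by blast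
  have "chart_inv c \<in> borel_measurable (restrict_space borel (chart_img c))"
    by (rule borel_measurable_continuous_on_restrict[OF continuous_chart_inv[OF c]])
  from measurable_sets[OF this B]
  have "chart_inv c -` B \<inter> chart_img c \<in> sets (restrict_space borel (chart_img c))"
    by (simp add: space_restrict_space)
  then have "chart_inv c -` B \<inter> chart_img c \<in> sets borel"
    using open_img[OF c] by (simp add: sets_restrict_space_iff)
  then show "chart_map c ` B \<in> sets borel" by (subst chart_map_image_eq[OF c Bd])
  have "compact (chart_map c ` K)"
    by (intro compact_continuous_image continuous_on_subset[OF continuous_chart_map[OF c]] K)
  then show "\<exists>K. compact K \<and> chart_map c ` B \<subseteq> K \<and> K \<subseteq> chart_img c"
    using K by (intro exI[of _ "chart_map c ` K"]) blast
qed

lemma piece_integrable: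
  assumes "continuous_fun h" "(B, c) \<in> pieces"
  shows "set_integrable lborel (chart_map c ` B) (\<lambda>x. h (chart_inv c x) * volume_density c x)"
proof -
  note p = piece[OF assms(2)]
  obtain K where K: "compact K" "chart_map c ` B \<subseteq> K" "K \<subseteq> chart_img c" using p(4) by blast
  have "continuous_on (chart_img c) (\<lambda>x. h (chart_inv c x) * volume_density c x)"
    using assms(1) p(1) volume_density(1)[OF p(1)] by (intro continuous_on_mult) (auto simp: continuous_fun_def)
  then have "set_integrable lborel K (\<lambda>x. h (chart_inv c x) * volume_density c x)"
    unfolding set_integrable_def using K by (intro borel_integrable_compact) (auto intro: continuous_on_subset)
  then show ?thesis by (rule set_integrable_subset) (use p(3) K(2) in auto)
qed

abbreviation vol :: "('a \<Rightarrow> real) \<Rightarrow> real" where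
  "vol h \<equiv> riemannian_integral A g h"

lemma vol_eq:
  "vol h = (\<Sum>(B, c)\<in>pieces. LINT x : chart_map c ` B | lborel. h (chart_inv c x) * volume_density c x)"
  by (simp add: riemannian_integral_def pieces_def volume_density_def Let_def)

lemma vol_add:
  assumes "continuous_fun h" "continuous_fun k"
  shows "vol (\<lambda>p. h p + k p) = vol h + vol k"
  unfolding vol_eq sum.distrib[symmetric]
proof (intro sum.cong refl, clarify)
  fix B c assume "(B, c) \<in> pieces"
  from set_integral_add(2)[OF piece_integrable[OF assms(1) this] piece_integrable[OF assms(2) this]]
  show "(LINT x : chart_map c ` B | lborel. (h (chart_inv c x) + k (chart_inv c x)) * volume_density c x) =
    (LINT x : chart_map c ` B | lborel. h (chart_inv c x) * volume_density c x) +
    (LINT x : chart_map c ` B | lborel. k (chart_inv c x) * volume_density c x)"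
    by (simp add: distrib_right)
qed

lemma vol_cmult: "vol (\<lambda>p. r * h p) = r * vol h"
  unfolding vol_eq sum_distrib_left
  by (intro sum.cong refl) (auto simp: mult.assoc)

lemma piece_nonneg:
  assumes "\<And>p. 0 \<le> h p" "(B, c) \<in> pieces"
  shows "0 \<le> (LINT x : chart_map c ` B | lborel. h (chart_inv c x) * volume_density c x)"
  unfolding set_lebesgue_integral_def
proof (rule integral_nonneg_AE, rule AE_I2)
  fix x
  show "0 \<le> indicat_real (chart_map c ` B) x *\<^sub>R (h (chart_inv c x) * volume_density c x)"
  proof (cases "x \<in> chart_map c ` B")
    case True
    then have "x \<in> chart_img c" using piece(2)[OF assms(2)] by blast
    then show ?thesis using volume_density(2)[OF piece(1)[OF assms(2)]] assms(1) True
      by (simp add: less_imp_le)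
  qed simp
qed

lemma vol_nonneg: "(\<And>p. 0 \<le> h p) \<Longrightarrow> 0 \<le> vol h"
  unfolding vol_eq using piece_nonneg by (intro sum_nonneg) auto

lemma vol_mono:
  assumes "continuous_fun h" "continuous_fun k" "\<And>p. h p \<le> k p"
  shows "vol h \<le> vol k"
proof -
  have d: "continuous_fun (\<lambda>p. k p + (- 1) * h p)"
    using assms(1,2) unfolding continuous_fun_def by (auto intro!: continuous_intros)
  have "vol (\<lambda>p. h p + (k p + (- 1) * h p)) = vol h + vol (\<lambda>p. k p + (- 1) * h p)"
    by (rule vol_add[OF assms(1) d])
  moreover have "0 \<le> vol (\<lambda>p. k p + (- 1) * h p)" using assms(3) by (intro vol_nonneg) simp
  ultimately show ?thesis by simp
qed

text \<open>A point with h \<noteq> 0 may lie in a piece with empty interior, so positivity on one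
  piece cannot be read off directly. Instead h vanishes almost everywhere on each piece. If h p
  \<noteq> 0, then in a chart at p the open set where h is nonzero would be covered by the images of
  these finitely many null sets under transition maps.\<close>

lemma vol_eq_0:
  assumes h: "continuous_fun h" "\<And>p. 0 \<le> h p" and v: "vol h = 0"
  shows "h p = 0"
proof (rule ccontr)
  assume np: "h p \<noteq> 0"
  have fin: "finite pieces" and cov: "(\<Union>q\<in>pieces. fst q) = UNIV"
    using chart_partition_pieces by (auto simp: chart_partition_def)
  define Z :: "'a set \<times> ('a, 'n) chart \<Rightarrow> (real ^ 'n) set" where "Z = (\<lambda>(B, c). {x \<in> chart_map c ` B. h (chart_inv c x) \<noteq> 0})"
  have Z: "negligible (Z (B, c))" if q: "(B, c) \<in> pieces" for B c
  proof -
    let ?f = "\<lambda>x. h (chart_inv c x) * volume_density c x"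
    have "\<forall>q\<in>pieces. (case q of (B, c) \<Rightarrow> LINT x : chart_map c ` B | lborel. h (chart_inv c x) * volume_density c x) = 0"
      using v fin piece_nonneg[OF h(2)] unfolding vol_eq by (subst (asm) sum_nonneg_eq_0_iff) auto
    then have "(LINT x : chart_map c ` B | lborel. ?f x) = 0" using q by auto
    then have "(LINT x|lborel. indicat_real (chart_map c ` B) x *\<^sub>R ?f x) = 0" by (simp add: set_lebesgue_integral_def)
    moreover have "0 \<le> indicat_real (chart_map c ` B) x *\<^sub>R ?f x" for x
    proof (cases "x \<in> chart_map c ` B")
      case True
      then have "x \<in> chart_img c" using piece(2)[OF q] by blast
      then show ?thesis using volume_density(2)[OF piece(1)[OF q]] h(2) True by (simp add: less_imp_le)
    qed simp
    ultimately have "AE x in lborel. indicat_real (chart_map c ` B) x *\<^sub>R ?f x = 0"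
      using integral_nonneg_eq_0_iff_AE[OF piece_integrable[OF h(1) q, unfolded set_integrable_def]] by simp
    then have "AE x in lebesgue. indicat_real (chart_map c ` B) x *\<^sub>R ?f x = 0" by (rule AE_completion)
    then have "{x. indicat_real (chart_map c ` B) x *\<^sub>R ?f x \<noteq> 0} \<in> null_sets lebesgue"
      by (simp add: completion.AE_iff_null_sets)
    moreover have "Z (B, c) \<subseteq> {x. indicat_real (chart_map c ` B) x *\<^sub>R ?f x \<noteq> 0}"
    proof
      fix x assume x: "x \<in> Z (B, c)"
      then have "x \<in> chart_img c" using piece(2)[OF q] by (auto simp: Z_def)
      from volume_density(2)[OF piece(1)[OF q] this] x
      show "x \<in> {x. indicat_real (chart_map c ` B) x *\<^sub>R ?f x \<noteq> 0}" by (simp add: Z_def)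
    qed
    ultimately show ?thesis using negligible_subset negligible_iff_null_sets by blast
  qed
  define c0 where "c0 = chart_at A p"
  have c0: "c0 \<in> A" "p \<in> chart_dom c0" by (auto simp: c0_def chart_at)
  define W where "W = {x \<in> chart_img c0. h (chart_inv c0 x) \<noteq> 0}"
  have "W = chart_img c0 \<inter> (\<lambda>x. h (chart_inv c0 x)) -` (- {0})" by (auto simp: W_def)
  moreover have "continuous_on (chart_img c0) (\<lambda>x. h (chart_inv c0 x))" using h(1) c0 by (simp add: continuous_fun_def)
  ultimately have oW: "open W" using open_img[OF c0(1)] continuous_open_preimage open_delete[OF open_UNIV]
    by (metis Compl_eq_Diff_UNIV)
  have neW: "chart_map c0 p \<in> W" using np c0 by (simp add: W_def)
  have "W \<subseteq> (\<Union>q\<in>pieces. (chart_map c0 \<circ> chart_inv (snd q)) ` (Z q \<inter> chart_map (snd q) ` (chart_dom (snd q) \<inter> chart_dom c0)))"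
  proof
    fix x assume x: "x \<in> W"
    then have xi: "x \<in> chart_img c0" "h (chart_inv c0 x) \<noteq> 0" by (auto simp: W_def)
    obtain B c where q: "(B, c) \<in> pieces" "chart_inv c0 x \<in> B"
    proof -
      have "chart_inv c0 x \<in> (\<Union>q\<in>pieces. fst q)" by (simp add: cov)
      then show ?thesis using that by (elim UN_E) (metis prod.collapse)
    qed
    have c: "c \<in> A" "chart_inv c0 x \<in> chart_dom c" using piece[OF q(1)] q(2) by auto
    let ?y = "chart_map c (chart_inv c0 x)"
    have "?y \<in> Z (B, c) \<inter> chart_map c ` (chart_dom c \<inter> chart_dom c0)"
      using q c xi c0 by (auto simp: Z_def)
    moreover have "x = (chart_map c0 \<circ> chart_inv c) ?y" using c c0 xi by simp
    ultimately show "x \<in> (\<Union>q\<in>pieces. (chart_map c0 \<circ> chart_inv (snd q)) ` (Z q \<inter> chart_map (snd q) ` (chart_dom (snd q) \<inter> chart_dom c0)))"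
      using q(1) by (intro UN_I[of "(B, c)"]) auto
  qed
  moreover have "negligible (\<Union>q\<in>pieces. (chart_map c0 \<circ> chart_inv (snd q)) ` (Z q \<inter> chart_map (snd q) ` (chart_dom (snd q) \<inter> chart_dom c0)))"
  proof (rule negligible_Union[OF finite_imageI[OF fin]], erule imageE, hypsubst)
    fix q assume q: "q \<in> pieces"
    obtain B c where Bc: "q = (B, c)" by (cases q)
    have c: "c \<in> A" using piece q Bc by blast
    show "negligible ((chart_map c0 \<circ> chart_inv (snd q)) ` (Z q \<inter> chart_map (snd q) ` (chart_dom (snd q) \<inter> chart_dom c0)))"
    \<comment> \<open>A differentiable map between spaces of equal dimension takes null sets to null
      sets. The intersection with the chart overlap is where the transition map is
      differentiable.\<close>
    proof (rule negligible_differentiable_image_negligible[OF order_refl])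
      show "negligible (Z q \<inter> chart_map (snd q) ` (chart_dom (snd q) \<inter> chart_dom c0))"
        using Z q Bc by (intro negligible_Int) simp_all
      show "chart_map c0 \<circ> chart_inv (snd q) differentiable_on Z q \<inter> chart_map (snd q) ` (chart_dom (snd q) \<inter> chart_dom c0)"
        unfolding differentiable_on_def Bc snd_conv
      proof
        fix x assume "x \<in> Z (B, c) \<inter> chart_map c ` (chart_dom c \<inter> chart_dom c0)"
        from smooth_on_differentiable[OF transition_smooth[OF c c0(1)] IntD2[OF this]]
        show "chart_map c0 \<circ> chart_inv c differentiable
            at x within Z (B, c) \<inter> chart_map c ` (chart_dom c \<inter> chart_dom c0)"
          by (rule differentiable_at_withinI)
      qed
    qed
  qed
  ultimately have "negligible W" using negligible_subset by blast
  then show False using open_not_negligible[OF oW] neW by blast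
qed

section \<open>Norm axioms for the L2 norm\<close>

lemma L2_norm1_eq: "L2_norm1 A g \<alpha> = sqrt (vol (norm1_sq g \<alpha>))"
  by (simp add: L2_norm1_def)

lemma norm1_sq_nonneg: "form1 A \<alpha> \<Longrightarrow> 0 \<le> norm1_sq g \<alpha> p"
  unfolding norm1_sq_eq by (rule dual_form_nonneg[OF positive_g]) (simp add: form1_def)

lemma L2_norm1_nonneg: "form1 A \<alpha> \<Longrightarrow> 0 \<le> L2_norm1 A g \<alpha>"
  by (simp add: L2_norm1_eq vol_nonneg norm1_sq_nonneg)

lemma L2_norm1_eq_0:
  assumes "form1 A \<alpha>" "L2_norm1 A g \<alpha> = 0"
  shows "\<alpha> = 0"
proof (intro ext)
  fix p v
  have "norm1_sq g \<alpha> p = 0"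
  proof (rule vol_eq_0[OF continuous_norm1_sq[OF assms(1)] norm1_sq_nonneg[OF assms(1)]])
    show "vol (norm1_sq g \<alpha>) = 0" using assms(2) by (simp add: L2_norm1_eq)
  qed
  then show "\<alpha> p v = 0 p v"
    unfolding norm1_sq_eq using assms(1) dual_form_eq_0[OF positive_g] by (simp add: form1_def)
qed

lemma L2_norm1_scale1: "L2_norm1 A g (scale1 r \<alpha>) = \<bar>r\<bar> * L2_norm1 A g \<alpha>"
proof -
  have "norm1_sq g (scale1 r \<alpha>) = (\<lambda>p. r\<^sup>2 * norm1_sq g \<alpha> p)"
    by (simp add: fun_eq_iff norm1_sq_eq scale1_def dual_form_cmult)
  then show ?thesis by (simp add: L2_norm1_eq vol_cmult real_sqrt_mult)
qed

lemma L2_norm1_add: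
  assumes "form1 A \<alpha>" "form1 A \<beta>"
  shows "L2_norm1 A g (\<alpha> + \<beta>) \<le> L2_norm1 A g \<alpha> + L2_norm1 A g \<beta>"
  unfolding L2_norm1_eq
proof (rule sqrt_triangle_from_weighted)
  show "0 \<le> vol (norm1_sq g \<alpha>)" "0 \<le> vol (norm1_sq g \<beta>)" by (intro vol_nonneg norm1_sq_nonneg assms)+
  fix t :: real assume t: "0 < t"
  note cont = continuous_norm1_sq[OF assms(1)] continuous_norm1_sq[OF assms(2)]
  have cr: "continuous_fun (\<lambda>p. r * h p)" if "continuous_fun h" for r h
    using that unfolding continuous_fun_def by (auto intro!: continuous_intros)
  have ca: "continuous_fun (\<lambda>p. h p + k p)" if "continuous_fun h" "continuous_fun k" for h k
    using that unfolding continuous_fun_def by (auto intro!: continuous_intros)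
  have "vol (norm1_sq g (\<alpha> + \<beta>)) \<le> vol (\<lambda>p. (1 + t) * norm1_sq g \<alpha> p + (1 + 1 / t) * norm1_sq g \<beta> p)"
  proof (rule vol_mono)
    show "norm1_sq g (\<alpha> + \<beta>) p \<le> (1 + t) * norm1_sq g \<alpha> p + (1 + 1 / t) * norm1_sq g \<beta> p" for p
      using dual_form_add_le[OF positive_g _ _ t, of "\<alpha> p" "\<beta> p" p] assms
      by (simp add: norm1_sq_eq form1_def plus_fun_def)
  qed (intro ca cr cont continuous_norm1_sq form1_add assms)+
  also have "\<dots> = (1 + t) * vol (norm1_sq g \<alpha>) + (1 + 1 / t) * vol (norm1_sq g \<beta>)"
    by (simp only: vol_add[OF cr[OF cont(1)] cr[OF cont(2)]] vol_cmult)
  finally show "vol (norm1_sq g (\<alpha> + \<beta>)) \<le> (1 + t) * vol (norm1_sq g \<alpha>) + (1 + 1 / t) * vol (norm1_sq g \<beta>)" .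
qed

end

section \<open>Norms on spaces with finitely many separating functionals\<close>

lemma norm_on_subset: "norm_on sc V N \<Longrightarrow> W \<subseteq> V \<Longrightarrow> norm_on sc W N"
  unfolding norm_on_def by (meson subsetD)

definition seminorm_on ::
    "(real \<Rightarrow> 'v::ab_group_add \<Rightarrow> 'v) \<Rightarrow> 'v set \<Rightarrow> ('v \<Rightarrow> real) \<Rightarrow> bool" where
  "seminorm_on sc V \<mu> \<longleftrightarrow> (\<forall>x\<in>V. 0 \<le> \<mu> x) \<and>
     (\<forall>r. \<forall>x\<in>V. \<mu> (sc r x) = \<bar>r\<bar> * \<mu> x) \<and> (\<forall>x\<in>V. \<forall>y\<in>V. \<mu> (x + y) \<le> \<mu> x + \<mu> y)"

lemma seminorm_on_subset: "seminorm_on sc V N \<Longrightarrow> W \<subseteq> V \<Longrightarrow> seminorm_on sc W N"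
  unfolding seminorm_on_def by (meson subsetD)

lemma norm_on_imp_seminorm_on: "norm_on sc V N \<Longrightarrow> seminorm_on sc V N"
  by (simp add: norm_on_def seminorm_on_def)

definition functional_on ::
    "(real \<Rightarrow> 'v::ab_group_add \<Rightarrow> 'v) \<Rightarrow> 'v set \<Rightarrow> ('v \<Rightarrow> real) \<Rightarrow> bool" where
  "functional_on sc V l \<longleftrightarrow>
     (\<forall>x\<in>V. \<forall>y\<in>V. l (x + y) = l x + l y) \<and> (\<forall>r. \<forall>x\<in>V. l (sc r x) = r * l x)"

definition norm_complete_on :: "'v::ab_group_add set \<Rightarrow> ('v \<Rightarrow> real) \<Rightarrow> bool" where
  "norm_complete_on V N \<longleftrightarrow> (\<forall>X :: nat \<Rightarrow> 'v. (\<forall>n. X n \<in> V) \<longrightarrow>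
     (\<forall>e>0. \<exists>M. \<forall>m\<ge>M. \<forall>n\<ge>M. N (X m - X n) < e) \<longrightarrow>
     (\<exists>x\<in>V. (\<lambda>n. N (X n - x)) \<longlonglongrightarrow> 0))"

text \<open>Completeness is carried along in the induction because it makes the kernel of the next
  functional a closed subspace, so that this functional is bounded.\<close>

lemma norm_dominates_seminorms:
  fixes sc :: "real \<Rightarrow> 'v::ab_group_add \<Rightarrow> 'v"
  assumes vs: "vector_space sc" and "finite L" and "module.subspace sc V"
    and "\<And>l. l \<in> L \<Longrightarrow> functional_on sc V l"
    and "\<And>x. x \<in> V \<Longrightarrow> (\<And>l. l \<in> L \<Longrightarrow> l x = 0) \<Longrightarrow> x = 0"
    and "norm_on sc V N"
  shows "(\<forall>\<mu>. seminorm_on sc V \<mu> \<longrightarrow> (\<exists>C. \<forall>x\<in>V. \<mu> x \<le> C * N x)) \<and> norm_complete_on V N"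
  using assms(2-)
proof (induction L arbitrary: V rule: finite_induct)
  case empty
  interpret vector_space sc by (rule vs)
  have V: "V = {0}" using empty.prems(1,3) subspace_0 by blast
  have "N 0 = 0" using empty.prems(4) V by (simp add: norm_on_def)
  have "\<mu> 0 \<le> 0" if "seminorm_on sc V \<mu>" for \<mu>
  proof -
    have "\<mu> (sc 0 0) = \<bar>0\<bar> * \<mu> 0" using that V unfolding seminorm_on_def by blast
    then show ?thesis by simp
  qed
  then show ?case using \<open>N 0 = 0\<close> by (auto simp: V norm_complete_on_def)
next
  case (insert k L)
  interpret vector_space sc by (rule vs)
  note sub = insert.prems(1)
  have k: "functional_on sc V k" using insert.prems(2) by simp
  note N = insert.prems(4)
  have Npos: "0 \<le> N x" and N0: "N x = 0 \<Longrightarrow> x = 0" and Nsc: "N (sc r x) = \<bar>r\<bar> * N x" if "x \<in> V" for x r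
    using N that by (auto simp: norm_on_def)
  have Ntri: "N (x + y) \<le> N x + N y" if "x \<in> V" "y \<in> V" for x y
    using N that by (auto simp: norm_on_def)
  have kadd: "k (x + y) = k x + k y" if "x \<in> V" "y \<in> V" for x y using k that by (auto simp: functional_on_def)
  have ksc: "k (sc r x) = r * k x" if "x \<in> V" for r x using k that by (auto simp: functional_on_def)
  have Nminus: "N (- x) = N x" if "x \<in> V" for x using Nsc[OF that, of "- 1"] by simp
  have kminus: "k (- x) = - k x" if "x \<in> V" for x using ksc[OF that, of "- 1"] by simp
  have kdiff: "k (x - y) = k x - k y" if "x \<in> V" "y \<in> V" for x y
    using kadd[OF that(1) subspace_neg[OF sub that(2)]] kminus[OF that(2)] by simp
  have Ndiff: "N (x - z) \<le> N (x - y) + N (y - z)" if "x \<in> V" "y \<in> V" "z \<in> V" for x y z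
    using Ntri[of "x - y" "y - z"] subspace_diff[OF sub] that by simp
  have Nsym: "N (x - y) = N (y - x)" if "x \<in> V" "y \<in> V" for x y
    using Nminus[OF subspace_diff[OF sub that]] by simp
  define W where "W = {x \<in> V. k x = 0}"
  have WV: "W \<subseteq> V" by (auto simp: W_def)
  have k0: "k 0 = 0" using ksc[OF subspace_0[OF sub], of 0] by simp
  have subW: "subspace W"
    by (rule subspaceI) (auto simp: W_def kadd ksc k0 subspace_0[OF sub] subspace_add[OF sub] subspace_scale[OF sub])
  have IH: "(\<forall>\<mu>. seminorm_on sc W \<mu> \<longrightarrow> (\<exists>C. \<forall>x\<in>W. \<mu> x \<le> C * N x)) \<and> norm_complete_on W N"
  proof (rule insert.IH[OF subW _ _ norm_on_subset[OF N WV]])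
    show "functional_on sc W l" if "l \<in> L" for l
      using insert.prems(2)[of l] that WV unfolding functional_on_def by blast
    show "x = 0" if "x \<in> W" "\<And>l. l \<in> L \<Longrightarrow> l x = 0" for x
      using insert.prems(3)[of x] that unfolding W_def by auto
  qed
  show ?case
  proof (cases "\<forall>x\<in>V. k x = 0")
    case True
    then have "W = V" by (auto simp: W_def)
    then show ?thesis using IH by simp
  next
    case False
    then obtain e0 where e0: "e0 \<in> V" "k e0 \<noteq> 0" by blast
    define e where "e = sc (1 / k e0) e0"
    have e: "e \<in> V" "k e = 1" using e0 by (simp_all add: e_def subspace_scale[OF sub] ksc)
    define w where "w x = x - sc (k x) e" for x
    have w: "w x \<in> W" if "x \<in> V" for x
      using that e by (simp add: w_def W_def kdiff ksc subspace_diff[OF sub] subspace_scale[OF sub])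
    have split: "x = sc (k x) e + w x" for x by (simp add: w_def)
    \<comment> \<open>Otherwise some sequence in W converges to e. It is Cauchy, so by completeness
      of W it also converges to some y in W; then e = y, contradicting k e = 1.\<close>
    have "\<exists>\<delta>>0. \<forall>y\<in>W. \<delta> \<le> N (e - y)"
    proof (rule ccontr)
      assume "\<not> ?thesis"
      then have no: "\<And>\<delta>. 0 < \<delta> \<Longrightarrow> \<exists>y\<in>W. N (e - y) < \<delta>" by (meson not_le)
      have "\<exists>y. y \<in> W \<and> N (e - y) < inverse (real (Suc n))" for n using no[of "inverse (real (Suc n))"] by auto
      then obtain Y where Y: "\<And>n. Y n \<in> W" "\<And>n. N (e - Y n) < inverse (real (Suc n))" by metis
      have YV: "Y n \<in> V" for n using Y WV by blast
      have small: "N (e - Y n) < d" if "inverse (real (Suc M)) < d" "M \<le> n" for d M n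
      proof -
        have "inverse (real (Suc n)) \<le> inverse (real (Suc M))" using that(2) by (intro le_imp_inverse_le) auto
        then show ?thesis using Y(2)[of n] that(1) by linarith
      qed
      have "\<exists>M. \<forall>m\<ge>M. \<forall>n\<ge>M. N (Y m - Y n) < d" if d: "0 < d" for d
      proof -
        obtain M where M: "inverse (real (Suc M)) < d / 2" using reals_Archimedean[of "d / 2"] d by auto
        have "N (Y m - Y n) < d" if "M \<le> m" "M \<le> n" for m n
          using Ndiff[OF YV e(1) YV, of m n] Nsym[OF YV e(1), of m] small[OF M that(1)] small[OF M that(2)] by linarith
        then show ?thesis by blast
      qed
      then obtain y where y: "y \<in> W" "(\<lambda>n. N (Y n - y)) \<longlonglongrightarrow> 0"
        using IH Y(1) unfolding norm_complete_on_def by blast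
      have yV: "y \<in> V" using y WV by blast
      have "N (e - y) \<le> 0 + 0"
      proof (rule LIMSEQ_le_const)
        show "(\<lambda>n. inverse (real (Suc n)) + N (Y n - y)) \<longlonglongrightarrow> 0 + 0"
          by (intro tendsto_add y LIMSEQ_inverse_real_of_nat)
        show "\<exists>M. \<forall>n\<ge>M. N (e - y) \<le> inverse (real (Suc n)) + N (Y n - y)"
          using Ndiff[OF e(1) YV yV] Y(2) by (meson add_right_mono less_imp_le order_trans)
      qed
      then have "N (e - y) = 0" using Npos[OF subspace_diff[OF sub e(1) yV]] by simp
      then have "e - y = 0" using N0[OF subspace_diff[OF sub e(1) yV]] by blast
      then show False using e(2) y(1) by (simp add: W_def)
    qed
    then obtain \<delta> where \<delta>: "0 < \<delta>" "\<And>y. y \<in> W \<Longrightarrow> \<delta> \<le> N (e - y)" by blast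
    have kbound: "\<bar>k x\<bar> \<le> N x / \<delta>" if x: "x \<in> V" for x
    proof (cases "k x = 0")
      case True
      then show ?thesis using Npos[OF x] \<delta>(1) by simp
    next
      case False
      \<comment> \<open>Chosen so that x is k x times e - y; the distance \<delta> of e from W then
        bounds N x from below by \<bar>k x\<bar> times \<delta>.\<close>
      define y where "y = sc (- 1 / k x) (w x)"
      have y: "y \<in> W" unfolding y_def by (rule subspace_scale[OF subW w[OF x]])
      then have yV: "y \<in> V" using WV by blast
      have "sc (k x) (e - y) = sc (k x) e + w x"
        using False by (simp add: y_def scale_right_distrib)
      then have "x = sc (k x) (e - y)" using split[of x] by simp
      then have "N x = \<bar>k x\<bar> * N (e - y)" using Nsc[OF subspace_diff[OF sub e(1) yV]] by metis
      also have "\<dots> \<ge> \<bar>k x\<bar> * \<delta>" using \<delta>(2)[OF y] by (intro mult_left_mono) auto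
      finally show ?thesis using \<delta>(1) by (simp add: field_simps)
    qed
    have wbound: "N (w x) \<le> (1 + N e / \<delta>) * N x" if x: "x \<in> V" for x
    proof -
      have "N (w x) \<le> N x + N (- sc (k x) e)"
        using Ntri[OF x subspace_neg[OF sub subspace_scale[OF sub e(1)]], of "k x"] by (simp add: w_def)
      also have "N (- sc (k x) e) = \<bar>k x\<bar> * N e"
        using Nminus[OF subspace_scale[OF sub e(1)]] Nsc[OF e(1)] by simp
      also have "\<bar>k x\<bar> * N e \<le> N x / \<delta> * N e" using kbound[OF x] Npos[OF e(1)] by (intro mult_right_mono)
      finally show ?thesis by (simp add: algebra_simps)
    qed
    have wdiff: "w x - w y = w (x - y)" if "x \<in> V" "y \<in> V" for x y
      using that by (simp add: w_def kdiff scale_left_diff_distrib)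
    show ?thesis
    proof (intro conjI allI impI)
      fix \<mu> assume \<mu>: "seminorm_on sc V \<mu>"
      then obtain C where C: "\<And>x. x \<in> W \<Longrightarrow> \<mu> x \<le> C * N x" using IH seminorm_on_subset[OF \<mu> WV] by blast
      \<comment> \<open>The first summand of the constant controls the component of x along e, the
        second its projection \<open>w x\<close> to W. The absolute value is there because C may be
        negative.\<close>
      have "\<mu> x \<le> (\<mu> e / \<delta> + \<bar>C\<bar> * (1 + N e / \<delta>)) * N x" if x: "x \<in> V" for x
      proof -
        have wV: "w x \<in> V" using w[OF x] WV by blast
        have "\<mu> x \<le> \<mu> (sc (k x) e) + \<mu> (w x)"
          using \<mu> subspace_scale[OF sub e(1), of "k x"] wV split[of x] unfolding seminorm_on_def by metis
        also have "\<mu> (sc (k x) e) = \<bar>k x\<bar> * \<mu> e" using \<mu> e(1) by (simp add: seminorm_on_def)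
        also have "\<bar>k x\<bar> * \<mu> e \<le> N x / \<delta> * \<mu> e"
          using kbound[OF x] \<mu> e(1) by (intro mult_right_mono) (auto simp: seminorm_on_def)
        also have "\<mu> (w x) \<le> \<bar>C\<bar> * N (w x)"
          using C[OF w[OF x]] Npos[OF wV] by (meson abs_ge_self mult_right_mono order_trans)
        also have "\<bar>C\<bar> * N (w x) \<le> \<bar>C\<bar> * ((1 + N e / \<delta>) * N x)"
          using wbound[OF x] by (intro mult_left_mono) auto
        finally show ?thesis by (simp add: algebra_simps)
      qed
      then show "\<exists>C. \<forall>x\<in>V. \<mu> x \<le> C * N x" by blast
    next
      show "norm_complete_on V N"
        unfolding norm_complete_on_def
      proof (intro allI impI)
        fix X :: "nat \<Rightarrow> 'v"
        assume X: "\<forall>n. X n \<in> V" and Cauchy: "\<forall>e>0. \<exists>M. \<forall>m\<ge>M. \<forall>n\<ge>M. N (X m - X n) < e"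
        have XV: "X n \<in> V" "X m - X n \<in> V" for m n using X subspace_diff[OF sub] by auto
        \<comment> \<open>Since k and w are both bounded, the coefficients along e and the parts in
          W form separate Cauchy sequences, and the limit is assembled from their limits.\<close>
        have "Cauchy (\<lambda>n. k (X n))"
          unfolding Cauchy_def dist_real_def
        proof (intro allI impI)
          fix d :: real assume d: "0 < d"
          obtain M where M: "\<forall>m\<ge>M. \<forall>n\<ge>M. N (X m - X n) < d * \<delta>" using Cauchy d \<delta>(1) by (meson mult_pos_pos)
          have "\<bar>k (X m) - k (X n)\<bar> < d" if "M \<le> m" "M \<le> n" for m n
          proof -
            have "\<bar>k (X m - X n)\<bar> \<le> N (X m - X n) / \<delta>" by (rule kbound[OF XV(2)])
            also have "\<dots> < d" using M that \<delta>(1) by (simp add: pos_divide_less_eq)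
            finally show ?thesis by (simp add: kdiff XV)
          qed
          then show "\<exists>M. \<forall>m\<ge>M. \<forall>n\<ge>M. \<bar>k (X m) - k (X n)\<bar> < d" by blast
        qed
        then obtain \<kappa> where \<kappa>: "(\<lambda>n. k (X n)) \<longlonglongrightarrow> \<kappa>" using real_Cauchy_convergent convergent_def by blast
        define c where "c = 1 + N e / \<delta>"
        have c: "0 < c" using Npos[OF e(1)] \<delta>(1) by (simp add: c_def add_pos_nonneg)
        have "\<exists>M. \<forall>m\<ge>M. \<forall>n\<ge>M. N (w (X m) - w (X n)) < d" if d: "0 < d" for d
        proof -
          obtain M where M: "\<forall>m\<ge>M. \<forall>n\<ge>M. N (X m - X n) < d / c" using Cauchy d c by (meson divide_pos_pos)
          have "N (w (X m) - w (X n)) < d" if "M \<le> m" "M \<le> n" for m n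
          proof -
            have "N (w (X m) - w (X n)) \<le> c * N (X m - X n)"
              using wbound[OF XV(2)] by (simp add: wdiff XV c_def)
            also have "\<dots> < d" using M that c by (simp add: pos_less_divide_eq mult.commute)
            finally show ?thesis .
          qed
          then show ?thesis by blast
        qed
        moreover have "w (X n) \<in> W" for n by (rule w[OF XV(1)])
        ultimately obtain y where y: "y \<in> W" "(\<lambda>n. N (w (X n) - y)) \<longlonglongrightarrow> 0"
          using conjunct2[OF IH, unfolded norm_complete_on_def, rule_format, of "\<lambda>n. w (X n)"] by blast
        have yV: "y \<in> V" using y WV by blast
        define x where "x = sc \<kappa> e + y"
        have xV: "x \<in> V" unfolding x_def by (intro subspace_add[OF sub] subspace_scale[OF sub] e yV)
        have le: "N (X n - x) \<le> \<bar>k (X n) - \<kappa>\<bar> * N e + N (w (X n) - y)" for n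
        proof -
          have wV: "w (X n) - y \<in> V" using w[OF XV(1)] WV yV subspace_diff[OF sub] by blast
          have "X n - x = sc (k (X n) - \<kappa>) e + (w (X n) - y)"
            by (simp add: x_def w_def scale_left_diff_distrib)
          then show ?thesis
            using Ntri[OF subspace_scale[OF sub e(1)] wV, of "k (X n) - \<kappa>"] by (simp only: Nsc[OF e(1)])
        qed
        have "(\<lambda>n. \<bar>k (X n) - \<kappa>\<bar> * N e + N (w (X n) - y)) \<longlonglongrightarrow> \<bar>\<kappa> - \<kappa>\<bar> * N e + 0"
          by (intro tendsto_intros \<kappa> y)
        then have lim: "(\<lambda>n. \<bar>k (X n) - \<kappa>\<bar> * N e + N (w (X n) - y)) \<longlonglongrightarrow> 0" by simp
        have "(\<lambda>n. N (X n - x)) \<longlonglongrightarrow> 0"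
          by (rule tendsto_sandwich[OF always_eventually always_eventually tendsto_const lim])
            (intro allI Npos[OF subspace_diff[OF sub XV(1) xV]] le)+
        then show "\<exists>x\<in>V. (\<lambda>n. N (X n - x)) \<longlonglongrightarrow> 0" using xV by blast
      qed
    qed
  qed
qed

section \<open>Linear sections and the comparison of the norms\<close>

context smooth_manifold
begin

section \<open>Calculus of cohomology classes and their sections\<close>

lemma coh_class_eq: "\<alpha> \<in> closed1 A \<Longrightarrow> coh_class A \<alpha> = {\<beta> \<in> closed1 A. \<beta> - \<alpha> \<in> exact1 A}"
  by (auto simp: coh_class_def cohomologous_def)

lemma coh_class_self: "\<alpha> \<in> closed1 A \<Longrightarrow> \<alpha> \<in> coh_class A \<alpha>"
  by (simp add: coh_class_eq fields.subspace_0[OF subspace_exact1])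

lemma coh_class_cong:
  assumes "\<alpha> \<in> closed1 A" "\<beta> \<in> closed1 A" "\<beta> - \<alpha> \<in> exact1 A"
  shows "coh_class A \<alpha> = coh_class A \<beta>"
proof -
  have "\<gamma> - \<alpha> \<in> exact1 A \<longleftrightarrow> \<gamma> - \<beta> \<in> exact1 A" for \<gamma>
    using fields.subspace_add[OF subspace_exact1, of "\<gamma> - \<beta>" "\<beta> - \<alpha>"]
      fields.subspace_diff[OF subspace_exact1, of "\<gamma> - \<alpha>" "\<beta> - \<alpha>"] assms(3) by auto
  then show ?thesis using assms by (simp add: coh_class_eq)
qed

lemma coh_class_in_H1: "\<alpha> \<in> closed1 A \<Longrightarrow> coh_class A \<alpha> \<in> H1 A"
  unfolding H1_def coh_class_def by (rule quotientI)

text \<open>\<open>H1_add\<close> is a union over all pairs of representatives. All these classes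
  coincide and at least one pair exists, so the union is a single class.\<close>

lemma H1_add_coh_class:
  assumes "\<alpha> \<in> closed1 A" "\<beta> \<in> closed1 A"
  shows "H1_add A (coh_class A \<alpha>) (coh_class A \<beta>) = coh_class A (\<alpha> + \<beta>)"
proof -
  have "coh_class A (\<alpha>' + \<beta>') = coh_class A (\<alpha> + \<beta>)"
    if "\<alpha>' \<in> coh_class A \<alpha>" "\<beta>' \<in> coh_class A \<beta>" for \<alpha>' \<beta>'
  proof -
    have c: "\<alpha>' \<in> closed1 A" "\<beta>' \<in> closed1 A" "\<alpha>' - \<alpha> \<in> exact1 A" "\<beta>' - \<beta> \<in> exact1 A"
      using that assms by (auto simp: coh_class_eq)
    have "(\<alpha>' + \<beta>') - (\<alpha> + \<beta>) \<in> exact1 A"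
      using fields.subspace_add[OF subspace_exact1 c(3,4)] by (simp add: algebra_simps)
    then show ?thesis
      using coh_class_cong fields.subspace_add[OF subspace_closed1] assms c by metis
  qed
  then show ?thesis unfolding H1_add_def using coh_class_self assms by blast
qed

lemma H1_scale_coh_class:
  assumes "\<alpha> \<in> closed1 A"
  shows "H1_scale A r (coh_class A \<alpha>) = coh_class A (scale1 r \<alpha>)"
proof -
  have "coh_class A (scale1 r \<alpha>') = coh_class A (scale1 r \<alpha>)" if "\<alpha>' \<in> coh_class A \<alpha>" for \<alpha>'
  proof -
    have c: "\<alpha>' \<in> closed1 A" "\<alpha>' - \<alpha> \<in> exact1 A"
      using that assms by (auto simp: coh_class_eq)
    have "scale1 r \<alpha>' - scale1 r \<alpha> \<in> exact1 A"
      using fields.subspace_scale[OF subspace_exact1 c(2)] by (simp add: fields.scale_right_diff_distrib)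
    then show ?thesis
      using coh_class_cong fields.subspace_scale[OF subspace_closed1] assms c by metis
  qed
  then show ?thesis unfolding H1_scale_def using coh_class_self assms by blast
qed

lemma linear_section:
  assumes "linear_section A S" and \<alpha>: "\<alpha> \<in> closed1 A"
  shows "S (coh_class A \<alpha>) \<in> closed1 A" "\<alpha> - S (coh_class A \<alpha>) \<in> exact1 A"
    and "coh_class A (S (coh_class A \<alpha>)) = coh_class A \<alpha>"
    and "S (coh_class A (scale1 r \<alpha>)) = scale1 r (S (coh_class A \<alpha>))"
    and "\<beta> \<in> closed1 A \<Longrightarrow> S (coh_class A (\<alpha> + \<beta>)) = S (coh_class A \<alpha>) + S (coh_class A \<beta>)"
proof -
  show c: "S (coh_class A \<alpha>) \<in> closed1 A" and e: "coh_class A (S (coh_class A \<alpha>)) = coh_class A \<alpha>"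
    using assms coh_class_in_H1[OF \<alpha>] by (auto simp: linear_section_def)
  have "S (H1_scale A r (coh_class A \<alpha>)) = scale1 r (S (coh_class A \<alpha>))"
    using assms(1) coh_class_in_H1[OF \<alpha>] unfolding linear_section_def by blast
  then show "S (coh_class A (scale1 r \<alpha>)) = scale1 r (S (coh_class A \<alpha>))"
    by (simp only: H1_scale_coh_class[OF \<alpha>])
  show "\<alpha> - S (coh_class A \<alpha>) \<in> exact1 A" using coh_class_self[OF \<alpha>] c e coh_class_eq by blast
  show "S (coh_class A (\<alpha> + \<beta>)) = S (coh_class A \<alpha>) + S (coh_class A \<beta>)" if "\<beta> \<in> closed1 A"
  proof -
    have "S (H1_add A (coh_class A \<alpha>) (coh_class A \<beta>)) = S (coh_class A \<alpha>) + S (coh_class A \<beta>)"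
      using assms(1) coh_class_in_H1[OF \<alpha>] coh_class_in_H1[OF that] unfolding linear_section_def by blast
    then show ?thesis by (simp only: H1_add_coh_class[OF \<alpha> that])
  qed
qed

end

section \<open>Comparison of the norms on closed 1-forms, and its transfer to vector fields\<close>

locale closed_form_norms = compact_riemannian_manifold A g
  for A :: "('a::{t2_space,second_countable_topology}, 'n::finite) chart set" and g +
  fixes \<nu> :: "('a, 'n) field1 \<Rightarrow> real"
  assumes \<nu>: "norm_on scale1 (exact1 A) \<nu>"
begin

text \<open>The sum norm for the splitting of the closed forms into the image of S and the exact
  forms.\<close>

definition split_norm :: "(('a, 'n) field1 set \<Rightarrow> ('a, 'n) field1) \<Rightarrow> ('a, 'n) field1 \<Rightarrow> real" where
  "split_norm S \<alpha> = L2_norm1 A g (S (coh_class A \<alpha>)) + \<nu> (\<alpha> - S (coh_class A \<alpha>))"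

lemma form1_if_closed1: "\<alpha> \<in> closed1 A \<Longrightarrow> form1 A \<alpha>"
  by (simp add: closed1_def)

lemma norm_on_L2: "norm_on scale1 (closed1 A) (L2_norm1 A g)"
  unfolding norm_on_def
  using form1_if_closed1 L2_norm1_nonneg L2_norm1_eq_0 L2_norm1_scale1 L2_norm1_add L2_norm1_scale1[of 0 0]
  by (auto simp: fields.scale_zero_left)

lemma norm_on_split_norm:
  assumes S: "linear_section A S"
  shows "norm_on scale1 (closed1 A) (split_norm S)"
  unfolding norm_on_def
proof (intro conjI ballI allI)
  fix \<alpha> assume \<alpha>: "\<alpha> \<in> closed1 A"
  note s = linear_section[OF S \<alpha>]
  have nn: "0 \<le> L2_norm1 A g (S (coh_class A \<alpha>))" "0 \<le> \<nu> (\<alpha> - S (coh_class A \<alpha>))"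
    using norm_on_L2 \<nu> s(1,2) by (auto simp: norm_on_def)
  then show "0 \<le> split_norm S \<alpha>" by (simp add: split_norm_def)
  show "split_norm S \<alpha> = 0 \<longleftrightarrow> \<alpha> = 0"
  proof
    assume "split_norm S \<alpha> = 0"
    then have "L2_norm1 A g (S (coh_class A \<alpha>)) = 0" "\<nu> (\<alpha> - S (coh_class A \<alpha>)) = 0"
      using nn by (simp_all add: split_norm_def)
    then have "S (coh_class A \<alpha>) = 0" "\<alpha> - S (coh_class A \<alpha>) = 0"
      using norm_on_L2 \<nu> s(1,2) by (auto simp: norm_on_def)
    then show "\<alpha> = 0" by simp
  next
    assume "\<alpha> = 0"
    moreover have "S (coh_class A 0) = 0"
      using linear_section(4)[OF S fields.subspace_0[OF subspace_closed1], of 0] by simp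
    moreover have "L2_norm1 A g 0 = 0" "\<nu> 0 = 0"
      using norm_on_L2 \<nu> fields.subspace_0[OF subspace_closed1] fields.subspace_0[OF subspace_exact1]
      by (auto simp: norm_on_def)
    ultimately show "split_norm S \<alpha> = 0" by (simp add: split_norm_def)
  qed
  show "split_norm S (scale1 r \<alpha>) = \<bar>r\<bar> * split_norm S \<alpha>" for r
  proof -
    have "\<nu> (scale1 r (\<alpha> - S (coh_class A \<alpha>))) = \<bar>r\<bar> * \<nu> (\<alpha> - S (coh_class A \<alpha>))"
      using \<nu> s(2) by (simp add: norm_on_def)
    then show ?thesis
      by (simp add: split_norm_def s(4) L2_norm1_scale1 fields.scale_right_diff_distrib distrib_left)
  qed
  fix \<beta> assume \<beta>: "\<beta> \<in> closed1 A"
  note t = linear_section[OF S \<beta>]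
  have "L2_norm1 A g (S (coh_class A \<alpha>) + S (coh_class A \<beta>))
      \<le> L2_norm1 A g (S (coh_class A \<alpha>)) + L2_norm1 A g (S (coh_class A \<beta>))"
    by (intro L2_norm1_add form1_if_closed1 s t)
  moreover have "\<nu> ((\<alpha> - S (coh_class A \<alpha>)) + (\<beta> - S (coh_class A \<beta>)))
      \<le> \<nu> (\<alpha> - S (coh_class A \<alpha>)) + \<nu> (\<beta> - S (coh_class A \<beta>))"
    using \<nu> s(2) t(2) by (simp add: norm_on_def)
  ultimately show "split_norm S (\<alpha> + \<beta>) \<le> split_norm S \<alpha> + split_norm S \<beta>"
    by (simp add: split_norm_def s(5)[OF \<beta>] add_diff_add)
qed

lemma split_norm_le:
  assumes S: "linear_section A S" and T: "linear_section A T"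
  shows "\<exists>C>0. \<forall>\<alpha>\<in>closed1 A. split_norm T \<alpha> \<le> C * split_norm S \<alpha>"
proof -
  \<comment> \<open>The image of S, described as the set of closed forms fixed by \<sigma> \<mapsto>
    \<open>S (coh_class A \<sigma>)\<close>.\<close>
  define V where "V = {\<sigma> \<in> closed1 A. S (coh_class A \<sigma>) = \<sigma>}"
  have VC: "V \<subseteq> closed1 A" by (auto simp: V_def)
  have S0: "S (coh_class A 0) = 0"
    using linear_section(4)[OF S fields.subspace_0[OF subspace_closed1], of 0] by simp
  have subV: "fields.subspace V"
    by (rule fields.subspaceI)
      (auto simp: V_def S0 linear_section[OF S] fields.subspace_0[OF subspace_closed1]
        fields.subspace_add[OF subspace_closed1] fields.subspace_scale[OF subspace_closed1])
  obtain L :: "(('a, 'n) field1 \<Rightarrow> real) set" where L: "finite L"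
    "\<And>l. l \<in> L \<Longrightarrow> functional_on scale1 (closed1 A) l"
    "\<And>\<alpha>. \<alpha> \<in> closed1 A \<Longrightarrow> \<forall>l\<in>L. l \<alpha> = 0 \<Longrightarrow> \<alpha> \<in> exact1 A"
  proof -
    obtain L :: "(('a, 'n) field1 \<Rightarrow> real) set" where "finite L"
      "\<forall>l\<in>L. functional_on scale1 (closed1 A) l"
      "\<forall>\<alpha>\<in>closed1 A. (\<forall>l\<in>L. l \<alpha> = 0) \<longrightarrow> \<alpha> \<in> exact1 A"
      using finite_functionals_detect_exactness[OF compact] unfolding functional_on_def by (elim exE conjE)
    then show ?thesis by (intro that[of L]) simp_all
  qed
  have "(\<forall>\<mu>. seminorm_on scale1 V \<mu> \<longrightarrow> (\<exists>C. \<forall>x\<in>V. \<mu> x \<le> C * L2_norm1 A g x)) \<and> norm_complete_on V (L2_norm1 A g)"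
  proof (rule norm_dominates_seminorms[OF vector_space_scale1 L(1) subV])
    show "functional_on scale1 V l" if "l \<in> L" for l
      using L(2)[OF that] VC unfolding functional_on_def by blast
    \<comment> \<open>If all functionals vanish, \<sigma> is exact and so has the class of 0. An
      element of V is recovered from its class by S, which sends the zero class to 0.\<close>
    show "\<sigma> = 0" if \<sigma>: "\<sigma> \<in> V" and "\<And>l. l \<in> L \<Longrightarrow> l \<sigma> = 0" for \<sigma>
    proof -
      have "\<sigma> \<in> exact1 A" using L(3) that VC by blast
      then have "coh_class A 0 = coh_class A \<sigma>"
        using coh_class_cong[OF fields.subspace_0[OF subspace_closed1]] \<sigma> VC by auto
      then show "\<sigma> = 0" using S0 \<sigma> by (simp add: V_def)
    qed
  qed (rule norm_on_subset[OF norm_on_L2 VC])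
  moreover have "seminorm_on scale1 V (split_norm T)"
    using norm_on_imp_seminorm_on[OF norm_on_split_norm[OF T]] seminorm_on_subset VC by blast
  ultimately obtain C where C: "\<And>\<sigma>. \<sigma> \<in> V \<Longrightarrow> split_norm T \<sigma> \<le> C * L2_norm1 A g \<sigma>" by blast
  \<comment> \<open>\<alpha> and \<sigma> have the same class, hence the same image under T. The 1
    in the constant accounts for the exact form \<alpha> - \<sigma>, the C for \<sigma>
    itself.\<close>
  have "split_norm T \<alpha> \<le> max 1 C * split_norm S \<alpha>" if \<alpha>: "\<alpha> \<in> closed1 A" for \<alpha>
  proof -
    note s = linear_section[OF S \<alpha>]
    define \<sigma> where "\<sigma> = S (coh_class A \<alpha>)"
    have \<sigma>: "\<sigma> \<in> V" "\<sigma> \<in> closed1 A" "coh_class A \<sigma> = coh_class A \<alpha>" "\<alpha> - \<sigma> \<in> exact1 A"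
      using s(1,2,3) by (simp_all add: V_def \<sigma>_def)
    have "\<sigma> - T (coh_class A \<sigma>) \<in> exact1 A" using linear_section(2)[OF T \<sigma>(2)] .
    then have "\<nu> ((\<alpha> - \<sigma>) + (\<sigma> - T (coh_class A \<sigma>))) \<le> \<nu> (\<alpha> - \<sigma>) + \<nu> (\<sigma> - T (coh_class A \<sigma>))"
      using \<nu> \<sigma>(4) unfolding norm_on_def by blast
    then have "split_norm T \<alpha> \<le> \<nu> (\<alpha> - \<sigma>) + split_norm T \<sigma>"
      by (simp add: split_norm_def \<sigma>(3))
    also have "\<dots> \<le> 1 * \<nu> (\<alpha> - \<sigma>) + C * L2_norm1 A g \<sigma>" using C[OF \<sigma>(1)] by simp
    also have "\<dots> \<le> max 1 C * \<nu> (\<alpha> - \<sigma>) + max 1 C * L2_norm1 A g \<sigma>"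
      using norm_on_L2 \<nu> \<sigma>(2,4) by (intro add_mono mult_right_mono) (auto simp: norm_on_def)
    also have "\<dots> = max 1 C * split_norm S \<alpha>" by (simp add: split_norm_def \<sigma>_def distrib_left)
    finally show ?thesis .
  qed
  then show ?thesis by (intro exI[of _ "max 1 C"]) auto
qed

text \<open>For constant \<eta>(X) this is the image of X under the isomorphism of the cosymplectic
  structure. With \<eta>(X) as a scalar factor, closedness of the second summand follows from that
  of \<eta>.\<close>

definition cosymplectic_flat :: "('a, 'n) field2 \<Rightarrow> ('a, 'n) field1 \<Rightarrow> ('a, 'n) vfield \<Rightarrow> ('a, 'n) field1" where
  "cosymplectic_flat \<omega> \<eta> X = interior2 X \<omega> + scale1 (eta_value \<eta> X) \<eta>"

text \<open>The hypotheses ask for closedness and for constancy of \<eta>(X) instead of membership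
  in \<open>cosymplectic_vfields\<close>. Both pass at once to sums and multiples of fields, so the
  norm axioms can be checked there with the same formula.\<close>

lemma cosymplectic_norm_eq:
  assumes S: "linear_section A S" and \<alpha>: "interior2 X \<omega> \<in> closed1 A" and \<eta>: "\<eta> \<in> closed1 A"
    and X: "\<And>p. \<eta> p (X p) = eta_value \<eta> X"
  shows "cosymplectic_norm A \<omega> \<eta> g \<nu> S X = split_norm S (cosymplectic_flat \<omega> \<eta> X) + \<bar>eta_value \<eta> X\<bar>"
proof -
  define \<beta> where "\<beta> = scale1 (eta_value \<eta> X) \<eta>"
  have \<beta>: "\<beta> \<in> closed1 A" unfolding \<beta>_def by (rule fields.subspace_scale[OF subspace_closed1 \<eta>])
  have \<beta>_eq: "(\<lambda>p v. \<eta> p (X p) * \<eta> p v) = \<beta>" by (simp add: \<beta>_def scale1_def X)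
  have pot: "smooth_fun A (potential A \<gamma>) \<and> ext_d0 A (potential A \<gamma>) = \<gamma>" if "\<gamma> \<in> exact1 A" for \<gamma>
    unfolding potential_def using that by (intro someI_ex[of "\<lambda>f. smooth_fun A f \<and> ext_d0 A f = \<gamma>"]) (auto simp: exact1_def)
  have diff: "has_differential (potential A \<gamma>) \<gamma> p" if "\<gamma> \<in> exact1 A" for \<gamma> p
    using has_differential_ext_d0[of "potential A \<gamma>" p] pot[OF that] by simp
  let ?H = "S (coh_class A (interior2 X \<omega>))" and ?K = "S (coh_class A \<beta>)"
  \<comment> \<open>Whichever potentials are chosen, the differential of their sum is the sum of the
    two exact parts.\<close>
  have "ext_d0 A (potential A (interior2 X \<omega> - ?H) + potential A (\<beta> - ?K)) = (interior2 X \<omega> - ?H) + (\<beta> - ?K)"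
    unfolding plus_fun_def[of "potential A _"]
    by (intro has_differential_unique has_differential_add diff linear_section[OF S] \<alpha> \<beta>)
  moreover have "(interior2 X \<omega> - ?H) + (\<beta> - ?K) = cosymplectic_flat \<omega> \<eta> X - S (coh_class A (cosymplectic_flat \<omega> \<eta> X))"
    unfolding cosymplectic_flat_def \<beta>_def[symmetric] linear_section(5)[OF S \<alpha> \<beta>] by (rule add_diff_add[symmetric])
  moreover have "?K + ?H = S (coh_class A (cosymplectic_flat \<omega> \<eta> X))"
    unfolding cosymplectic_flat_def \<beta>_def[symmetric] linear_section(5)[OF S \<alpha> \<beta>] by (rule add.commute)
  ultimately show ?thesis
    by (simp add: cosymplectic_norm_def Let_def \<beta>_eq split_norm_def)
qed

lemma cosymplectic_norms_equivalent:
  assumes conn: "connected (UNIV :: 'a set)" and co: "cosymplectic A \<omega> \<eta>"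
    and S: "linear_section A S" and T: "linear_section A T"
  shows "equivalent_norms_on scale_vfield (cosymplectic_vfields A \<omega> \<eta>)
           (cosymplectic_norm A \<omega> \<eta> g \<nu> S) (cosymplectic_norm A \<omega> \<eta> g \<nu> T)"
proof -
  let ?X = "cosymplectic_vfields A \<omega> \<eta>"
  let ?N = "cosymplectic_norm A \<omega> \<eta> g \<nu>"
  let ?f = "cosymplectic_flat \<omega> \<eta>"
  have linw: "bilinear (\<omega> p)" and linh: "linear (\<eta> p)" for p
    using co by (auto simp: cosymplectic_def form2_def tensor2_def form1_def)
  have ev: "eta_value \<eta> X = c" if "\<And>p. \<eta> p (X p) = c" for X c
    using that by (auto simp: eta_value_def)
  have eX: "\<eta> p (X p) = eta_value \<eta> X" if "X \<in> ?X" for X p by (rule eta_value[OF co that conn])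
  have iX: "interior2 X \<omega> \<in> closed1 A" if "X \<in> ?X" for X by (rule interior2_closed1[OF co that])
  have eta: "\<eta> \<in> closed1 A" using co by (simp add: cosymplectic_def closed1_def)
  have flat: "?f X \<in> closed1 A" if "X \<in> ?X" for X
    unfolding cosymplectic_flat_def
    by (intro fields.subspace_add[OF subspace_closed1] fields.subspace_scale[OF subspace_closed1] iX that eta)
  have Neq: "?N R X = split_norm R (?f X) + \<bar>eta_value \<eta> X\<bar>" if "linear_section A R" "X \<in> ?X" for R X
    by (rule cosymplectic_norm_eq[OF that(1) iX[OF that(2)] eta eX[OF that(2)]])
  have norm: "norm_on scale_vfield ?X (?N R)" if R: "linear_section A R" for R
    unfolding norm_on_def
  proof (intro conjI ballI allI)
    note sn = norm_on_split_norm[OF R, unfolded norm_on_def]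
    fix X assume X: "X \<in> ?X"
    have nn: "0 \<le> split_norm R (?f X)" using sn flat[OF X] by blast
    then show "0 \<le> ?N R X" by (simp add: Neq[OF R X])
    show "?N R X = 0 \<longleftrightarrow> X = 0"
    proof
      assume "?N R X = 0"
      then have "split_norm R (?f X) = 0" using nn by (simp add: Neq[OF R X])
      then have f0: "?f X = 0" using sn flat[OF X] by blast
      show "X = 0"
      proof (rule ext)
        fix p
        \<comment> \<open>Definiteness: if the combined form vanishes at p, then \<open>X p\<close>
          and 0 have the same image under the pointwise isomorphism.\<close>
        have inj: "inj (\<lambda>v w. \<omega> p v w + \<eta> p v * \<eta> p w)"
          using co unfolding cosymplectic_def by (meson bij_betw_imp_inj_on)
        have "\<omega> p (X p) w + \<eta> p (X p) * \<eta> p w = 0" for w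
          using fun_cong[OF fun_cong[OF f0, of p], of w]
          by (simp add: cosymplectic_flat_def interior2_def scale1_def eX[OF X])
        then have "(\<lambda>w. \<omega> p (X p) w + \<eta> p (X p) * \<eta> p w) = (\<lambda>w. \<omega> p 0 w + \<eta> p 0 * \<eta> p w)"
          by (simp add: bilinear_lzero[OF linw] linear_0[OF linh])
        then show "X p = 0 p" using injD[OF inj] by simp
      qed
    next
      assume 0: "X = 0"
      have e0: "eta_value \<eta> 0 = 0" by (rule ev) (simp add: linear_0[OF linh])
      have "?f 0 = 0"
        by (simp add: cosymplectic_flat_def e0 interior2_def fun_eq_iff bilinear_lzero[OF linw])
      moreover have "split_norm R 0 = 0" using sn fields.subspace_0[OF subspace_closed1] by blast
      ultimately show "?N R X = 0" using Neq[OF R X] 0 e0 by simp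
    qed
    show "?N R (scale_vfield r X) = \<bar>r\<bar> * ?N R X" for r
    proof -
      have e: "eta_value \<eta> (scale_vfield r X) = r * eta_value \<eta> X"
        by (rule ev) (simp add: scale_vfield_def linear_cmul[OF linh] eX[OF X])
      have i: "interior2 (scale_vfield r X) \<omega> = scale1 r (interior2 X \<omega>)"
        by (simp add: interior2_def scale_vfield_def scale1_def fun_eq_iff bilinear_lmul[OF linw])
      have f: "?f (scale_vfield r X) = scale1 r (?f X)"
        by (simp add: cosymplectic_flat_def e i fields.scale_right_distrib)
      have "?N R (scale_vfield r X) = split_norm R (?f (scale_vfield r X)) + \<bar>eta_value \<eta> (scale_vfield r X)\<bar>"
      proof (rule cosymplectic_norm_eq[OF R _ eta])
        show "interior2 (scale_vfield r X) \<omega> \<in> closed1 A"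
          unfolding i by (rule fields.subspace_scale[OF subspace_closed1 iX[OF X]])
      qed (unfold e, simp add: scale_vfield_def linear_cmul[OF linh] eX[OF X])
      moreover have "split_norm R (scale1 r (?f X)) = \<bar>r\<bar> * split_norm R (?f X)" using sn flat[OF X] by blast
      ultimately show ?thesis by (simp add: f e Neq[OF R X] abs_mult distrib_left)
    qed
    fix Y assume Y: "Y \<in> ?X"
    have e: "eta_value \<eta> (X + Y) = eta_value \<eta> X + eta_value \<eta> Y"
      by (rule ev) (simp add: linear_add[OF linh] eX[OF X] eX[OF Y])
    have i: "interior2 (X + Y) \<omega> = interior2 X \<omega> + interior2 Y \<omega>"
      by (simp add: interior2_def fun_eq_iff bilinear_ladd[OF linw])
    have f: "?f (X + Y) = ?f X + ?f Y"
      by (simp add: cosymplectic_flat_def e i fields.scale_left_distrib)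
    have "?N R (X + Y) = split_norm R (?f (X + Y)) + \<bar>eta_value \<eta> (X + Y)\<bar>"
    proof (rule cosymplectic_norm_eq[OF R _ eta])
      show "interior2 (X + Y) \<omega> \<in> closed1 A"
        unfolding i by (rule fields.subspace_add[OF subspace_closed1 iX[OF X] iX[OF Y]])
    qed (simp add: e linear_add[OF linh] eX[OF X] eX[OF Y])
    moreover have "split_norm R (?f X + ?f Y) \<le> split_norm R (?f X) + split_norm R (?f Y)"
      using sn flat[OF X] flat[OF Y] by blast
    ultimately show "?N R (X + Y) \<le> ?N R X + ?N R Y"
      unfolding f e Neq[OF R X] Neq[OF R Y] by linarith
  qed
  have le: "\<exists>C>0. \<forall>X\<in>?X. ?N R X \<le> C * ?N R' X"
    if R: "linear_section A R" and R': "linear_section A R'" for R R'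
  proof -
    obtain C where C: "C > 0" "\<And>\<alpha>. \<alpha> \<in> closed1 A \<Longrightarrow> split_norm R \<alpha> \<le> C * split_norm R' \<alpha>"
      using split_norm_le[OF R' R] by blast
    \<comment> \<open>The 1 accounts for the term \<bar>\<eta>(X)\<bar>, which is common to both
      norms.\<close>
    have "?N R X \<le> max 1 C * ?N R' X" if X: "X \<in> ?X" for X
    proof -
      have nn: "0 \<le> split_norm R' (?f X)"
        using norm_on_split_norm[OF R'] flat[OF X] by (simp add: norm_on_def)
      have "?N R X \<le> C * split_norm R' (?f X) + 1 * \<bar>eta_value \<eta> X\<bar>"
        using C(2)[OF flat[OF X]] by (simp add: Neq[OF R X])
      also have "\<dots> \<le> max 1 C * split_norm R' (?f X) + max 1 C * \<bar>eta_value \<eta> X\<bar>"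
        using nn by (intro add_mono mult_right_mono) auto
      finally show ?thesis by (simp add: Neq[OF R' X] distrib_left)
    qed
    then show ?thesis by (intro exI[of _ "max 1 C"]) auto
  qed
  show ?thesis unfolding equivalent_norms_on_def using norm[OF S] norm[OF T] le[OF S T] le[OF T S] by blast
qed

end

theorem theorem6p1:
  fixes A :: "('a::{t2_space,second_countable_topology}, 'n::finite) chart set"
    and \<omega> g :: "('a, 'n) field2"
    and \<eta> :: "('a, 'n) field1"
    and \<nu> :: "('a, 'n) field1 \<Rightarrow> real"
    and S T :: "('a, 'n) field1 set \<Rightarrow> ('a, 'n) field1"
  assumes "smooth_atlas A"
    and "compact (UNIV :: 'a set)"
    and "connected (UNIV :: 'a set)"
    and "cosymplectic A \<omega> \<eta>"
    and "riemannian_metric A g"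
    and "equivalent_norms_on scale1 (exact1 A) \<nu> (osc A)"
    and "linear_section A S"
    and "linear_section A T"
  shows "equivalent_norms_on scale_vfield (cosymplectic_vfields A \<omega> \<eta>)
           (cosymplectic_norm A \<omega> \<eta> g \<nu> S) (cosymplectic_norm A \<omega> \<eta> g \<nu> T)"
proof -
  interpret closed_form_norms A g \<nu>
    using assms(1,2,5,6) by unfold_locales (auto simp: equivalent_norms_on_def)
  show ?thesis by (rule cosymplectic_norms_equivalent[OF assms(3,4,7,8)])
qed

end
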